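(* Let $\varepsilon>4$ be a constant. Let $G$ be a finite simple undirected graph with $n$ vertices, $m$ edges and degeneracy $d$. Then DEC-ADG with parameter $\varepsilon$ takes $O(\log d\,\log^2 n)$ depth and $O(n+m)$ work with high probability in the CRCW setting.
   Context: Graphs are stored in adjacency-array (CSR) form. For $U\subseteq V$, $N_U(v)$ denotes the set of neighbors of $v$ in $U$. The degeneracy $d$ of $G$ is the smallest $s$ such that every nonempty induced subgraph of $G$ has a vertex of degree at most $s$. Cost model: a parallel computation is a directed acyclic graph (DAG) of constant-time operations; its work is the number of nodes and its depth is the length of the longest directed path. In the CRCW setting concurrent reads, concurrent writes and atomic read-modify-write operations to the same memory cell take $O(1)$ time. Summing (Reduce) or counting over an array of size $N$ takes $O(\log N)$ depth and $O(N)$ work. "With high probability": for every constant $c$, with probability at least $1-n^{-c}$ (hidden constants may depend on $c$ and $\varepsilon$). In asymptotic bounds, factors such as $\log n$, $\log d$ are read as $\max\{1,\cdot\}$. Algorithm ADG with accuracy $\eta$. Initialize $U=V$, $D[v]=\deg(v)$, $\ell=1$. While $U\ne\emptyset$: $\widehat\delta=\frac1{|U|}\sum_{v\in U}D[v]$; $R(\ell)=\{u\in U:D[u]\le(1+\eta)\widehat\delta\}$; for all $v\in R(\ell)$ and all $u\in N_U(v)$ in parallel, atomically decrement $D[u]$; $U=U\setminus R(\ell)$; set $\rho(v)=\ell$ for $v\in R(\ell)$; $\ell=\ell+1$. Let $\overline\rho$ be the number of iterations; $R(1),\dots,R(\overline\rho)$ partition $V$. Write $G(\ell)=G[R(\ell)]$.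 Algorithm DEC-ADG with parameter $\varepsilon$. Run ADG with accuracy $\eta=\varepsilon/12$, recording the partitions $G(1),\dots,G(\overline\rho)$. Put $\mu=\varepsilon/4$. Each vertex $v$ has a set $B_v$ of forbidden colors, initially empty, stored as a bitmap (with $O(1)$ membership test and insertion). For $\ell=\overline\rho,\overline\rho-1,\dots,1$: let $Q=R(\overline\rho)\cup\dots\cup R(\ell+1)$ (the already colored vertices); for all $v\in R(\ell)$ and all $u\in N_Q(v)$ in parallel, insert $C[u]$ into $B_v$; then run SIM-COL on $G(\ell)$ with the sets $B_v$, $v\in R(\ell)$. SIM-COL on $G(\ell)$: let $\deg_\ell(v)=|N_{Q\cup R(\ell)}(v)|$. Set $U=R(\ell)$. While $U\ne\emptyset$: (1) every $v\in U$ in parallel chooses independently a color $C[v]$ uniformly at random from $\{1,\dots,\lceil(1+\mu)\deg_\ell(v)\rceil\}$ (from $\{1\}$ if $\deg_\ell(v)=0$); (2) every $v\in U$ in parallel checks, by a Reduce over $N_U(v)$, whether some $u\in N_U(v)$ chose the same color in this round, and whether $C[v]\in B_v$; if either holds, $C[v]$ is reset to $0$ (all comparisons use the colors chosen in step (1)); (3) for every $v\in U$ and $u\in N_U(v)$ in parallel with $C[u]>0$, insert $C[u]$ into $B_v$; then remove from $U$ all $v$ with $C[v]>0$. *)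

theory Defs
  imports "HOL-Probability.Probability"
begin

section \<open>Graphs\<close>

definition simple_graph :: "nat set \<Rightarrow> nat set set \<Rightarrow> bool" where
  "simple_graph V E \<longleftrightarrow> finite V \<and> (\<forall>e\<in>E. e \<subseteq> V \<and> card e = 2)"

text \<open>\<open>nbhd E U v\<close> is the set $N_U(v)$.\<close>

definition nbhd :: "nat set set \<Rightarrow> nat set \<Rightarrow> nat \<Rightarrow> nat set" where
  "nbhd E U v = {u \<in> U. {u, v} \<in> E}"

definition degeneracy :: "nat set \<Rightarrow> nat set set \<Rightarrow> nat" where
  "degeneracy V E =
     (LEAST s. \<forall>W. W \<subseteq> V \<and> W \<noteq> {} \<longrightarrow> (\<exists>v\<in>W. card (nbhd E W v) \<le> s))"

text \<open>Adjacency-array form of a graph with vertex set \<open>{..<n}\<close>: the neighbors of \<open>v\<close> occupy, in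
  arbitrary order, the segment of \<open>csr_adj\<close> from \<open>csr_off ! v\<close> to \<open>csr_off ! Suc v - 1\<close>.\<close>

record csr =
  csr_off :: "nat list"
  csr_adj :: "nat list"

definition nbrs :: "csr \<Rightarrow> nat \<Rightarrow> nat list" where
  "nbrs G v = map (\<lambda>i. csr_adj G ! i) [csr_off G ! v ..< csr_off G ! Suc v]"

definition csr_of :: "nat \<Rightarrow> nat set set \<Rightarrow> csr \<Rightarrow> bool" where
  "csr_of n E G \<longleftrightarrow>
     length (csr_off G) = Suc n \<and> csr_off G ! 0 = 0 \<and> sorted (csr_off G) \<and>
     csr_off G ! n = length (csr_adj G) \<and>
     (\<forall>v<n. distinct (nbrs G v) \<and> set (nbrs G v) = nbhd E {..<n} v)"


section \<open>Computation DAGs\<close>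

text \<open>A fork-join computation, read as a directed acyclic graph whose nodes are the constant-time
  operations. A node is named by its position in the term. In \<open>Seq a b\<close> every operation
  of \<open>a\<close> precedes every operation of \<open>b\<close>; there are no edges between the branches of \<open>Par\<close>.\<close>

datatype dag = Op | Seq dag dag | Par "dag list"

lemma size_nth_less_size_list [termination_simp]:
  "i < length ts \<Longrightarrow> size (ts ! i) < Suc (size_list size ts)"
  by (metis less_Suc_eq_le nth_mem size_list_estimation' order_refl)

fun nodes :: "dag \<Rightarrow> nat list set" where
  "nodes Op = {[]}"
| "nodes (Seq a b) = (#) 0 ` nodes a \<union> (#) 1 ` nodes b"
| "nodes (Par ts) = (\<Union>i\<in>{..<length ts}. (#) i ` nodes (ts ! i))"

fun edges :: "dag \<Rightarrow> (nat list \<times> nat list) set" where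
  "edges Op = {}"
| "edges (Seq a b) =
     map_prod ((#) 0) ((#) 0) ` edges a \<union> map_prod ((#) 1) ((#) 1) ` edges b \<union>
     ((#) 0 ` nodes a) \<times> ((#) 1 ` nodes b)"
| "edges (Par ts) = (\<Union>i\<in>{..<length ts}. map_prod ((#) i) ((#) i) ` edges (ts ! i))"

lemma finite_nodes: "finite (nodes t)"
  by (induction t rule: nodes.induct) auto

lemma edges_nodes: "edges t \<subseteq> nodes t \<times> nodes t"
  by (induction t rule: edges.induct) fastforce+

lemma edges_lexord: "edges t \<subseteq> lexord less_than"
  by (induction t rule: edges.induct) fastforce+

lemma acyclic_edges: "acyclic (edges t)"
proof -
  have "trans (lexord less_than)"
    by (rule lexord_transI) simp
  moreover have "irrefl (lexord less_than)"
    by (rule lexord_irrefl) (simp add: irrefl_on_def)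
  ultimately have "acyclic (lexord less_than)"
    by (simp add: acyclic_irrefl)
  then show ?thesis
    using edges_lexord by (rule acyclic_subset)
qed

definition work :: "dag \<Rightarrow> nat" where
  "work t = card (nodes t)"

text \<open>The length of a longest directed path, counted in edges. \<open>edges t ^^ k\<close> is nonempty iff there
  is a path of length \<open>k\<close> (for \<open>k = 0\<close> it is the identity relation).\<close>

definition depth :: "dag \<Rightarrow> nat" where
  "depth t = Max {k. edges t ^^ k \<noteq> {}}"

text \<open>Balanced binary reduction over \<open>N\<close> elements: one operation per leaf and one per inner node.\<close>

fun reduce_dag :: "nat \<Rightarrow> dag" where
  "reduce_dag N =
     (if N \<le> 1 then Op
      else Seq (Par [reduce_dag (N div 2), reduce_dag (N - N div 2)]) Op)"

declare reduce_dag.simps [simp del]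


section \<open>Parallel commands\<close>

text \<open>The shared memory; the field names follow the variables of the algorithms.
  \<open>U_of\<close> is the current set \<open>U\<close> (of ADG or of SIM-COL), \<open>lev_of\<close> is \<open>\<ell>\<close>,
  \<open>R_of s l\<close> is \<open>R(l)\<close>, \<open>nb_of s v\<close> is the adjacency array of \<open>v\<close> in the graph \<open>G(\<rho>(v))\<close>, and
  \<open>deg_of s v\<close> is $deg_\ell(v)$. The fields \<open>sum_of\<close>, \<open>cnt_of\<close>, \<open>avg_of\<close> serve the average
  $\widehat\delta$, and \<open>bad_of\<close> holds the outcome of the conflict test of SIM-COL.\<close>

record mem =
  U_of :: "nat set"
  D_of :: "nat \<Rightarrow> int"
  sum_of :: int
  cnt_of :: nat
  avg_of :: real
  lev_of :: nat
  rho_of :: "nat \<Rightarrow> nat"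
  R_of :: "nat \<Rightarrow> nat set"
  nb_of :: "nat \<Rightarrow> nat list"
  deg_of :: "nat \<Rightarrow> nat"
  B_of :: "nat \<Rightarrow> nat set"
  C_of :: "nat \<Rightarrow> nat"
  bad_of :: "nat \<Rightarrow> bool"

text \<open>Executing a command yields the new memory and the DAG of the operations executed. Loops may
  fail to terminate; the missing probability mass of the resulting subdistribution is the
  probability of nontermination.\<close>

type_synonym cmd = "mem \<Rightarrow> (mem \<times> dag) spmf"

text \<open>A constant-time operation. It is only used for updates that touch a constant number of memory
  cells. Inserting an element into a set or a list and deleting one from a set are such updates
  (arrays with a size counter advanced by an atomic fetch-and-add, and bitmaps).\<close>

definition atomic :: "(mem \<Rightarrow> mem) \<Rightarrow> cmd" where
  "atomic f s = return_spmf (f s, Op)"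

definition seq :: "cmd \<Rightarrow> cmd \<Rightarrow> cmd" (infixr \<open>;;\<close> 60) where
  "(p ;; q) s = do {
     (s1, t1) \<leftarrow> p s;
     (s2, t2) \<leftarrow> q s1;
     return_spmf (s2, Seq t1 t2)
   }"

text \<open>Parallel loop: one operation forks the iterations, which lie on independent branches of the
  DAG. The iteration space is determined when the loop starts. The memory is threaded through
  the iterations, i.e. one particular interleaving is fixed; in all the loops below
  the iterations write disjoint cells or perform atomic updates that commute (up to the order of
  the entries of an adjacency array), and otherwise read no cell written by another iteration, so
  the interleaving does not matter.\<close>

primrec branches :: "(nat \<Rightarrow> cmd) \<Rightarrow> nat list \<Rightarrow> mem \<Rightarrow> (mem \<times> dag list) spmf" where
  "branches p [] s = return_spmf (s, [])"
| "branches p (x # xs) s = do {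
     (s1, t) \<leftarrow> p x s;
     (s2, ts) \<leftarrow> branches p xs s1;
     return_spmf (s2, t # ts)
   }"

definition par_list :: "(mem \<Rightarrow> nat list) \<Rightarrow> (nat \<Rightarrow> cmd) \<Rightarrow> cmd" where
  "par_list xs p s = do {
     (s', ts) \<leftarrow> branches p (xs s) s;
     return_spmf (s', Seq Op (Par ts))
   }"

definition par_set :: "(mem \<Rightarrow> nat set) \<Rightarrow> (nat \<Rightarrow> cmd) \<Rightarrow> cmd" where
  "par_set A p = par_list (\<lambda>s. sorted_list_of_set (A s)) p"

text \<open>Sum of \<open>f\<close> over the array \<open>xs\<close>; the result is stored by \<open>upd\<close>.\<close>

definition reduce ::
  "(mem \<Rightarrow> nat list) \<Rightarrow> (mem \<Rightarrow> nat \<Rightarrow> 'a::comm_monoid_add) \<Rightarrow> ('a \<Rightarrow> mem \<Rightarrow> mem) \<Rightarrow> cmd" where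
  "reduce xs f upd s = return_spmf (upd (\<Sum>x\<leftarrow>xs s. f s x) s, reduce_dag (length (xs s)))"

text \<open>Each evaluation of the loop condition is one operation.\<close>

partial_function (spmf) while_cmd :: "(mem \<Rightarrow> bool) \<Rightarrow> cmd \<Rightarrow> cmd" where
  "while_cmd b p s =
     (if b s then do {
        (s1, t1) \<leftarrow> p s;
        (s2, t2) \<leftarrow> while_cmd b p s1;
        return_spmf (s2, Seq Op (Seq t1 t2))
      }
      else return_spmf (s, Op))"


section \<open>ADG\<close>

definition adg_init :: "nat \<Rightarrow> csr \<Rightarrow> cmd" where
  "adg_init n G =
     par_list (\<lambda>_. [0..<n]) (\<lambda>v. atomic (\<lambda>s.
       s\<lparr>U_of := insert v (U_of s),
         D_of := (D_of s)(v := int (csr_off G ! Suc v) - int (csr_off G ! v))\<rparr>)) ;;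
     atomic (\<lambda>s. s\<lparr>lev_of := 1\<rparr>)"

definition adg_iteration :: "real \<Rightarrow> csr \<Rightarrow> cmd" where
  "adg_iteration \<eta> G =
     reduce (\<lambda>s. sorted_list_of_set (U_of s)) D_of (\<lambda>x s. s\<lparr>sum_of := x\<rparr>) ;;
     reduce (\<lambda>s. sorted_list_of_set (U_of s)) (\<lambda>_ _. 1) (\<lambda>x s. s\<lparr>cnt_of := x\<rparr>) ;;
     atomic (\<lambda>s. s\<lparr>avg_of := of_int (sum_of s) / of_nat (cnt_of s)\<rparr>) ;;
     par_set U_of (\<lambda>u. atomic (\<lambda>s.
       if of_int (D_of s u) \<le> (1 + \<eta>) * avg_of s
       then s\<lparr>R_of := (R_of s)(lev_of s := insert u (R_of s (lev_of s)))\<rparr> else s)) ;;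
     par_set (\<lambda>s. R_of s (lev_of s)) (\<lambda>v. par_list (\<lambda>_. nbrs G v) (\<lambda>u. atomic (\<lambda>s.
       if u \<in> U_of s then s\<lparr>D_of := (D_of s)(u := D_of s u - 1)\<rparr> else s))) ;;
     par_set (\<lambda>s. R_of s (lev_of s)) (\<lambda>v. atomic (\<lambda>s.
       s\<lparr>U_of := U_of s - {v}, rho_of := (rho_of s)(v := lev_of s)\<rparr>))"

text \<open>Recording \<open>G(\<ell>)\<close>: the adjacency arrays are restricted to neighbors inside \<open>R(\<ell>)\<close>.\<close>

definition record_partition :: "csr \<Rightarrow> cmd" where
  "record_partition G =
     par_set (\<lambda>s. R_of s (lev_of s)) (\<lambda>v. par_list (\<lambda>_. nbrs G v) (\<lambda>u. atomic (\<lambda>s.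
       if rho_of s u = lev_of s then s\<lparr>nb_of := (nb_of s)(v := nb_of s v @ [u])\<rparr> else s)))"

definition adg :: "real \<Rightarrow> nat \<Rightarrow> csr \<Rightarrow> cmd" where
  "adg \<eta> n G =
     adg_init n G ;;
     while_cmd (\<lambda>s. U_of s \<noteq> {})
       (adg_iteration \<eta> G ;; record_partition G ;; atomic (\<lambda>s. s\<lparr>lev_of := lev_of s + 1\<rparr>))"


section \<open>SIM-COL\<close>

definition palette :: "real \<Rightarrow> nat \<Rightarrow> nat set" where
  "palette \<mu> k = (if k = 0 then {1} else {1..nat \<lceil>(1 + \<mu>) * real k\<rceil>})"

definition choose_color :: "real \<Rightarrow> nat \<Rightarrow> cmd" where
  "choose_color \<mu> v s =
     map_spmf (\<lambda>c. (s\<lparr>C_of := (C_of s)(v := c)\<rparr>, Op)) (spmf_of_set (palette \<mu> (deg_of s v)))"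

text \<open>Step (2) is two parallel loops: the first only compares the chosen colors, the second resets.
  Inside \<open>G(\<ell>)\<close>, a loop over $N_U(v)$ scans the adjacency array of \<open>v\<close> in \<open>G(\<ell>)\<close> and tests
  membership in \<open>U\<close>.\<close>

definition sim_col_round :: "real \<Rightarrow> cmd" where
  "sim_col_round \<mu> =
     par_set U_of (choose_color \<mu>) ;;
     par_set U_of (\<lambda>v. reduce (\<lambda>s. nb_of s v)
       (\<lambda>s u. if u \<in> U_of s \<and> C_of s u = C_of s v then 1 else 0 :: nat)
       (\<lambda>x s. s\<lparr>bad_of := (bad_of s)(v := (x > 0))\<rparr>)) ;;
     par_set U_of (\<lambda>v. atomic (\<lambda>s.
       if bad_of s v \<or> C_of s v \<in> B_of s v then s\<lparr>C_of := (C_of s)(v := 0)\<rparr> else s)) ;;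
     par_set U_of (\<lambda>v. par_list (\<lambda>s. nb_of s v) (\<lambda>u. atomic (\<lambda>s.
       if u \<in> U_of s \<and> C_of s u > 0
       then s\<lparr>B_of := (B_of s)(v := insert (C_of s u) (B_of s v))\<rparr> else s))) ;;
     par_set U_of (\<lambda>v. atomic (\<lambda>s.
       if C_of s v > 0 then s\<lparr>U_of := U_of s - {v}\<rparr> else s))"

text \<open>With \<open>\<ell> = lev_of s\<close>, a vertex \<open>u\<close> lies in \<open>Q\<close> iff \<open>\<rho>(u) > \<ell>\<close> and in \<open>Q \<union> R(\<ell>)\<close> iff
  \<open>\<rho>(u) \<ge> \<ell>\<close>.\<close>

definition sim_col :: "real \<Rightarrow> csr \<Rightarrow> cmd" where
  "sim_col \<mu> G =
     par_set (\<lambda>s. R_of s (lev_of s)) (\<lambda>v. reduce (\<lambda>_. nbrs G v)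
       (\<lambda>s u. if rho_of s u \<ge> lev_of s then 1 else 0)
       (\<lambda>x s. s\<lparr>deg_of := (deg_of s)(v := x)\<rparr>)) ;;
     par_set (\<lambda>s. R_of s (lev_of s)) (\<lambda>v. atomic (\<lambda>s. s\<lparr>U_of := insert v (U_of s)\<rparr>)) ;;
     while_cmd (\<lambda>s. U_of s \<noteq> {}) (sim_col_round \<mu>)"


section \<open>DEC-ADG\<close>

text \<open>ADG leaves \<open>lev_of\<close> at one more than the number of its iterations, so the second loop runs
  through the levels in descending order, down to 1.\<close>

definition dec_adg_cmd :: "real \<Rightarrow> nat \<Rightarrow> csr \<Rightarrow> cmd" where
  "dec_adg_cmd \<epsilon> n G =
     par_list (\<lambda>_. [0..<n]) (\<lambda>v. atomic (\<lambda>s.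
       s\<lparr>B_of := (B_of s)(v := {}), C_of := (C_of s)(v := 0)\<rparr>)) ;;
     adg (\<epsilon> / 12) n G ;;
     while_cmd (\<lambda>s. lev_of s > 1)
       (atomic (\<lambda>s. s\<lparr>lev_of := lev_of s - 1\<rparr>) ;;
        par_set (\<lambda>s. R_of s (lev_of s)) (\<lambda>v. par_list (\<lambda>_. nbrs G v) (\<lambda>u. atomic (\<lambda>s.
          if rho_of s u > lev_of s
          then s\<lparr>B_of := (B_of s)(v := insert (C_of s u) (B_of s v))\<rparr> else s))) ;;
        sim_col (\<epsilon> / 4) G)"

definition empty_mem :: mem where
  "empty_mem =
     \<lparr>U_of = {}, D_of = \<lambda>_. 0, sum_of = 0, cnt_of = 0, avg_of = 0, lev_of = 0, rho_of = \<lambda>_. 0,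
      R_of = \<lambda>_. {}, nb_of = \<lambda>_. [], deg_of = \<lambda>_. 0, B_of = \<lambda>_. {}, C_of = \<lambda>_. 0,
      bad_of = \<lambda>_. False\<rparr>"

definition dec_adg :: "real \<Rightarrow> nat \<Rightarrow> csr \<Rightarrow> (mem \<times> dag) spmf" where
  "dec_adg \<epsilon> n G = dec_adg_cmd \<epsilon> n G empty_mem"

text \<open>Logarithmic factors in asymptotic bounds.\<close>

definition lg :: "nat \<Rightarrow> real" where
  "lg k = max 1 (log 2 (real k))"

end

(* The partition produced by ADG is deterministic: by Markov's inequality at most a fraction
   1 / (1 + eta) of the vertices survives an iteration, so there are O(log n) levels with total work
   O(n + m), and every degree inside a level is at most (1 + eta) times an average degree, hence
   O(min(d, sqrt m)).

   In a round of SIM-COL the failures are dependent, but a failed vertex conflicts with an earlier or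
   with a later vertex in any fixed order. Revealing the colors in order, and in reverse order, each
   kind of conflict has conditional probability at most q = 1 / (1 + mu) < 1/2. This bounds both the
   expected number of failures by 2 q |U| and, for small theta, the exponential moment of the failed
   weight W (vertices plus incident edges inside the level) by exp(theta r W(U)) with r < 1.

   Hence exp(theta (alpha W(U) + 1)) is a supermartingale bound for exp(theta * work) of a level, and
   1 + A |U| is one for beta^rounds. The bounds multiply over the levels: E exp(theta * work) <=
   exp(theta O(n + m)) for theta of order 1 / sqrt(n + m), which the degree bound O(sqrt m) permits, and
   E exp(b * depth) <= exp(O(log^2 n)) for b of order 1 / log d. Markov's inequality gives both tails. *)
theory Submission
  imports Defs
begin

text \<open>The colors given to one level shape the forbidden sets of the next, so the levels are
  dependent. Every bound therefore holds uniformly over the memory in which a level starts, and such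
  conditional bounds multiply. A moment ignores diverging runs, since the missing mass of a
  subdistribution adds nothing to an integral; termination with probability 1 is shown separately.
  For the work, linearizing the exponential requires \<theta> times the largest weight in a level,
  of order sqrt (n + m), to stay below a constant. A tail of n^-c then costs (c log n) / \<theta>,
  of order sqrt (n + m) log n, which vanishes in n + m. For the depth, a round costs O(log d)
  because its Reduce scans arrays of length O(d); b makes the moment \<beta> of a round a constant
  with 2 q \<beta> < 1. Each of the O(log n) levels then contributes a factor polynomial in n, and
  division by b brings in log d. The condition \<epsilon> > 4 means \<mu> > 1, which is 2 q <
  1.\<close>

section \<open>Cost of computations\<close>

text \<open>Overestimates \<open>depth\<close>: \<open>Seq\<close> charges an edge even when one
  side has no operations. The recursion follows the shape of the term, which relation powers do not;
  the inserted 0 covers the empty \<open>Par\<close>.\<close>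

fun dep :: "dag \<Rightarrow> nat" where
  "dep Op = 0"
| "dep (Seq a b) = Suc (dep a + dep b)"
| "dep (Par ts) = Max (insert 0 (dep ` set ts))"

lemma dep_nth_le: "i < length ts \<Longrightarrow> dep (ts ! i) \<le> dep (Par ts)"
  by (auto intro!: Max_ge)

text \<open>A potential that grows along every edge and never exceeds \<open>dep t\<close> caps the
  length of all paths. For \<open>Seq\<close> the ranks of the second part are shifted above those
  of the first, with one extra step for the connecting edges.\<close>

lemma edges_rank:
  "\<exists>h. (\<forall>x\<in>nodes t. h x \<le> dep t) \<and> (\<forall>(x, y)\<in>edges t. h x < (h y :: nat))"
proof (induction t rule: edges.induct)
  case 1
  then show ?case by auto
next
  case (2 a b)
  obtain f where f: "\<forall>x\<in>nodes a. f x \<le> dep a" "\<forall>(x, y)\<in>edges a. f x < (f y :: nat)"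
    using 2(1) by blast
  obtain g where g: "\<forall>x\<in>nodes b. g x \<le> dep b" "\<forall>(x, y)\<in>edges b. g x < (g y :: nat)"
    using 2(2) by blast
  show ?case
    by (rule exI[of _ "\<lambda>x. if hd x = 0 then f (tl x) else Suc (dep a + g (tl x))"])
       (use f g in \<open>fastforce simp: le_imp_less_Suc trans_le_add1\<close>)
next
  case (3 ts)
  then have "\<forall>i\<in>{..<length ts}. \<exists>h. (\<forall>x\<in>nodes (ts ! i). h x \<le> dep (ts ! i)) \<and>
      (\<forall>(x, y)\<in>edges (ts ! i). h x < (h y :: nat))"
    by blast
  from bchoice[OF this] obtain h where h: "\<And>i x. i < length ts \<Longrightarrow> x \<in> nodes (ts ! i) \<Longrightarrow> h i x \<le> dep (ts ! i)"
      "\<And>i x y. i < length ts \<Longrightarrow> (x, y) \<in> edges (ts ! i) \<Longrightarrow> h i x < (h i y :: nat)"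
    by (metis (no_types, lifting) case_prodD lessThan_iff)
  show ?case
  proof (rule exI[of _ "\<lambda>x. h (hd x) (tl x)"], intro conjI ballI)
    fix x assume "x \<in> nodes (Par ts)"
    then show "h (hd x) (tl x) \<le> dep (Par ts)"
      using h(1) le_trans[OF h(1) dep_nth_le] by (auto simp del: dep.simps)
  qed (use h(2) in auto)
qed

lemma edges_relpow_le:
  assumes "(x, y) \<in> edges t ^^ k"
  shows "k \<le> dep t"
\<comment> \<open>At \<open>k = 0\<close> the power relates every list to itself, node or not, and
  the rank gives nothing; for positive \<open>k\<close> the last edge makes \<open>y\<close> a
  node.\<close>
proof (cases k)
  case (Suc k')
  obtain h where h: "\<forall>x\<in>nodes t. h x \<le> dep t" "\<forall>(x, y)\<in>edges t. h x < (h y :: nat)"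
    using edges_rank by blast
  have rank: "(x, y) \<in> edges t ^^ j \<Longrightarrow> h x + j \<le> h y" for x y j
  proof (induction j arbitrary: y)
    case (Suc j)
    then obtain z where z: "(x, z) \<in> edges t ^^ j" "(z, y) \<in> edges t"
      by auto
    show ?case
      using Suc.IH[OF z(1)] h(2) z(2) by fastforce
  qed auto
  obtain z where "(z, y) \<in> edges t"
    using assms Suc by auto
  then have "y \<in> nodes t"
    using edges_nodes by blast
  then show ?thesis
    using rank[OF assms] h(1) by fastforce
qed simp

lemma depth_le_dep: "depth t \<le> dep t"
proof -
  have sub: "{k. edges t ^^ k \<noteq> {}} \<subseteq> {..dep t}"
    using edges_relpow_le by fastforce
  \<comment> \<open>\<open>Max\<close> has its meaning only on a finite nonempty set; the identity
    relation provides the member 0.\<close>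
  have "0 \<in> {k. edges t ^^ k \<noteq> {}}"
    by auto
  then show ?thesis
    unfolding depth_def using sub finite_subset[OF sub] by (intro Max.boundedI) blast+
qed

lemma work_Op [simp]: "work Op = 1"
  by (simp add: work_def)

lemma work_Seq [simp]: "work (Seq a b) = work a + work b"
proof -
  have "card ((#) 0 ` nodes a \<union> (#) 1 ` nodes b) = card ((#) (0::nat) ` nodes a) + card ((#) (1::nat) ` nodes b)"
    by (rule card_Un_disjoint) (auto simp: finite_nodes)
  then show ?thesis
    by (simp add: work_def card_image)
qed

lemma work_Par [simp]: "work (Par ts) = sum_list (map work ts)"
proof -
  have "card (\<Union>i\<in>{..<length ts}. (#) i ` nodes (ts ! i)) = (\<Sum>i<length ts. card ((#) i ` nodes (ts ! i)))"
    by (rule card_UN_disjoint) (auto simp: finite_nodes)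
  then show ?thesis
    by (simp add: work_def card_image sum_list_sum_nth atLeast0LessThan)
qed

lemma work_reduce_dag: "work (reduce_dag N) \<le> 2 * N + 1"
proof -
  \<comment> \<open>The induction needs the sharp \<open>2 * N - 1\<close>: the two halves then
    leave exactly one unit for the combining operation. The weaker form of the statement also covers
    the single operation spent at \<open>N = 0\<close>.\<close>
  have "N \<ge> 1 \<Longrightarrow> work (reduce_dag N) \<le> 2 * N - 1"
  proof (induction N rule: reduce_dag.induct)
    case (1 N)
    show ?case
    proof (cases "N \<le> 1")
      case False
      then have "work (reduce_dag (N div 2)) \<le> 2 * (N div 2) - 1"
          "work (reduce_dag (N - N div 2)) \<le> 2 * (N - N div 2) - 1"
        using 1 by auto
      moreover have "2 * (N div 2) - 1 + (2 * (N - N div 2) - 1) + 1 \<le> 2 * N - 1" "N div 2 \<ge> 1"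
        using False by auto
      ultimately have "work (reduce_dag (N div 2)) + work (reduce_dag (N - N div 2)) + 1 \<le> 2 * N - 1"
        by linarith
      with False show ?thesis
        by (subst reduce_dag.simps) simp
    qed (use 1 in \<open>simp add: reduce_dag.simps\<close>)
  qed
  moreover have "work (reduce_dag 0) = 1"
    by (simp add: reduce_dag.simps)
  ultimately show ?thesis
    by (cases "N = 0") auto
qed

lemma dep_reduce_dag: "N \<le> 2 ^ k \<Longrightarrow> dep (reduce_dag N) \<le> 2 * k"
proof (induction k arbitrary: N)
  case (Suc k)
  show ?case
  proof (cases "N \<le> 1")
    case False
    then have "dep (reduce_dag (N div 2)) \<le> 2 * k" "dep (reduce_dag (N - N div 2)) \<le> 2 * k"
      using Suc by auto
    then show ?thesis
      using False by (subst reduce_dag.simps) simp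
  qed (simp add: reduce_dag.simps)
qed (simp add: reduce_dag.simps)

section \<open>Deterministic commands and bounds on their cost\<close>

definition runs :: "cmd \<Rightarrow> mem \<Rightarrow> mem \<Rightarrow> real \<Rightarrow> real \<Rightarrow> bool" where
  "runs p s s' w d \<longleftrightarrow> (\<exists>t. p s = return_spmf (s', t) \<and> real (work t) \<le> w \<and> real (dep t) \<le> d)"

lemma runs_mono: "runs p s s' w d \<Longrightarrow> w \<le> w' \<Longrightarrow> d \<le> d' \<Longrightarrow> runs p s s' w' d'"
  unfolding runs_def by force

lemma runs_atomic: "runs (atomic f) s (f s) 1 0"
  by (simp add: runs_def atomic_def)

lemma runs_seq:
  assumes "runs p s s1 w1 d1" "runs q s1 s2 w2 d2"
  shows "runs (p ;; q) s s2 (w1 + w2) (d1 + d2 + 1)"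
  using assms by (fastforce simp: runs_def seq_def)

lemma runs_reduce:
  assumes "length (xs s) \<le> 2 ^ k"
  shows "runs (reduce xs f upd) s (upd (\<Sum>x\<leftarrow>xs s. f s x) s) (2 * real (length (xs s)) + 1) (2 * real k)"
  using dep_reduce_dag[OF assms] work_reduce_dag[of "length (xs s)"]
  by (auto simp: runs_def reduce_def)

text \<open>The memory is threaded through the iterations, so the result is a \<open>fold\<close>.
  The invariant \<open>I\<close> protects whatever the cost of an iteration depends on, such as
  adjacency arrays that are kept in memory.\<close>

lemma runs_branches:
  assumes "\<And>x s. x \<in> set xs \<Longrightarrow> I s \<Longrightarrow> runs (p x) s (g x s) (w x) d \<and> I (g x s)" "I s"
  shows "\<exists>ts. branches p xs s = return_spmf (fold g xs s, ts) \<and>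
    real (sum_list (map work ts)) \<le> (\<Sum>x\<leftarrow>xs. w x) \<and> (\<forall>t\<in>set ts. real (dep t) \<le> d) \<and> I (fold g xs s)"
  using assms
proof (induction xs arbitrary: s)
  case (Cons x xs)
  have "runs (p x) s (g x s) (w x) d" and I: "I (g x s)"
    using Cons.prems by simp_all
  then obtain t where t: "p x s = return_spmf (g x s, t)" "real (work t) \<le> w x" "real (dep t) \<le> d"
    unfolding runs_def by blast
  have "\<exists>ts. branches p xs (g x s) = return_spmf (fold g xs (g x s), ts) \<and>
    real (sum_list (map work ts)) \<le> (\<Sum>x\<leftarrow>xs. w x) \<and> (\<forall>t\<in>set ts. real (dep t) \<le> d) \<and> I (fold g xs (g x s))"
    by (rule Cons.IH) (use Cons.prems I in simp_all)
  then obtain ts where "branches p xs (g x s) = return_spmf (fold g xs (g x s), ts)"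
    "real (sum_list (map work ts)) \<le> (\<Sum>x\<leftarrow>xs. w x)" "\<forall>t\<in>set ts. real (dep t) \<le> d" "I (fold g xs (g x s))"
    by blast
  with t show ?case
    by (intro exI[of _ "t # ts"]) simp
qed simp

lemma runs_par_list:
  assumes "\<And>x s. x \<in> set ys \<Longrightarrow> I s \<Longrightarrow> runs (p x) s (g x s) (w x) d \<and> I (g x s)" "I s" "d \<ge> 0" "ys = xs s"
  shows "runs (par_list xs p) s (fold g ys s) (1 + (\<Sum>x\<leftarrow>ys. w x)) (1 + d)"
proof -
  obtain ts where ts: "branches p ys s = return_spmf (fold g ys s, ts)"
    "real (sum_list (map work ts)) \<le> (\<Sum>x\<leftarrow>ys. w x)" "\<forall>t\<in>set ts. real (dep t) \<le> d"
    using runs_branches[of ys I p g w d s] assms by blast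
  \<comment> \<open>For an empty loop the maximum is the inserted 0, and this is where
    \<open>d \<ge> 0\<close> enters.\<close>
  have "dep (Par ts) \<in> insert 0 (dep ` set ts)"
    unfolding dep.simps by (rule Max_in) auto
  then have "real (dep (Par ts)) \<le> d"
    using ts(3) \<open>d \<ge> 0\<close> by (force simp del: dep.simps)
  with ts show ?thesis
    using assms(4) by (auto simp: runs_def par_list_def)
qed

lemma runs_par_set:
  assumes "\<And>x s. x \<in> A \<Longrightarrow> I s \<Longrightarrow> runs (p x) s (g x s) (w x) d \<and> I (g x s)"
    "I s" "d \<ge> 0" "A = X s" "finite A"
  shows "runs (par_set X p) s (fold g (sorted_list_of_set A) s) (1 + (\<Sum>x\<in>A. w x)) (1 + d)"
proof -
  have "(\<Sum>x\<leftarrow>sorted_list_of_set A. w x) = (\<Sum>x\<in>A. w x)"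
    using assms(5) by (simp add: sum_list_distinct_conv_sum_set)
  moreover have "runs (par_list (\<lambda>s. sorted_list_of_set (X s)) p) s (fold g (sorted_list_of_set A) s)
      (1 + (\<Sum>x\<leftarrow>sorted_list_of_set A. w x)) (1 + d)"
    by (rule runs_par_list[where I = I]) (use assms in auto)
  ultimately show ?thesis
    by (simp add: par_set_def)
qed

lemma runs_par_list_atomic:
  "runs (par_list xs (\<lambda>x. atomic (f x))) s (fold f (xs s) s) (1 + real (length (xs s))) 1"
  using runs_par_list[of "xs s" "\<lambda>_. True" "\<lambda>x. atomic (f x)" f "\<lambda>_. 1" 0 s xs]
  by (simp add: runs_atomic sum_list_triv)

lemma runs_par_set_atomic:
  assumes "A = X s" "finite A"
  shows "runs (par_set X (\<lambda>x. atomic (f x))) s (fold f (sorted_list_of_set A) s) (1 + real (card A)) 1"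
  using runs_par_set[of A "\<lambda>_. True" "\<lambda>x. atomic (f x)" f "\<lambda>_. 1" 0 s X] assms
  by (simp add: runs_atomic)

section \<open>Exponential moments of the cost\<close>

text \<open>Exponentials turn the additive cost of sequential composition into a product, and an \<open>F\<close> that
  is infinite outside an invariant makes a finite moment certify the invariant almost surely.\<close>

definition mgf :: "real \<Rightarrow> real \<Rightarrow> (mem \<times> dag) spmf \<Rightarrow> (mem \<Rightarrow> ennreal) \<Rightarrow> ennreal" where
  "mgf a b p F = (\<integral>\<^sup>+(s, t). ennreal (exp (a * real (work t) + b * real (dep t))) * F s \<partial>measure_spmf p)"

lemma nn_integral_bind_spmf:
  "(\<integral>\<^sup>+x. f x \<partial>measure_spmf (p \<bind> q)) = (\<integral>\<^sup>+y. \<integral>\<^sup>+x. f x \<partial>measure_spmf (q y) \<partial>measure_spmf p)"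
  unfolding measure_spmf_bind o_def
  by (rule nn_integral_bind[where B = "count_space UNIV"])
     (auto simp: space_measure_spmf intro: measure_spmf_in_space_subprob_algebra)

lemma nn_integral_return_spmf: "(\<integral>\<^sup>+x. f x \<partial>measure_spmf (return_spmf y)) = f y"
  by (simp add: measure_spmf_return_spmf nn_integral_return)

lemma mgf_return: "mgf a b (return_spmf (s, t)) F = ennreal (exp (a * real (work t) + b * real (dep t))) * F s"
  by (simp add: mgf_def nn_integral_return_spmf)

lemma mgf_mono: "(\<And>s t. (s, t) \<in> set_spmf p \<Longrightarrow> F s \<le> F' s) \<Longrightarrow> mgf a b p F \<le> mgf a b p F'"
  unfolding mgf_def by (intro nn_integral_mono_AE) (auto simp: AE_measure_spmf_iff intro!: mult_left_mono)

lemma mgf_cmult: "mgf a b p (\<lambda>s. c * F s) = c * mgf a b p F"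
  unfolding mgf_def split_beta by (simp add: nn_integral_cmult[symmetric] mult_ac)

lemma mgf_runs:
  assumes "runs p s s' w d" "a \<ge> 0" "b \<ge> 0"
  shows "mgf a b (p s) F \<le> ennreal (exp (a * w + b * d)) * F s'"
proof -
  obtain t where "p s = return_spmf (s', t)" "real (work t) \<le> w" "real (dep t) \<le> d"
    using assms(1) by (auto simp: runs_def)
  then show ?thesis
    using assms(2,3) by (auto simp: mgf_return intro!: mult_right_mono ennreal_leI add_mono mult_left_mono)
qed

text \<open>The inner moment on the right conditions on the intermediate memory, so a bound on it
  that is uniform in the memory can be pulled out as a factor. The edge that joins the two parts
  yields \<open>exp b\<close>.\<close>

lemma mgf_seq: "mgf a b ((p ;; q) s) F = ennreal (exp b) * mgf a b (p s) (\<lambda>s1. mgf a b (q s1) F)"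
  unfolding seq_def mgf_def split_beta
  by (subst nn_integral_cmult[symmetric], simp)
     (auto simp: nn_integral_bind_spmf nn_integral_return_spmf nn_integral_cmult[symmetric] exp_add
        ennreal_mult algebra_simps intro!: nn_integral_cong)

lemma mgf_seq_runs:
  assumes "runs p s s1 w d" "a \<ge> 0" "b \<ge> 0"
  shows "mgf a b ((p ;; q) s) F \<le> ennreal (exp (a * w + b * (d + 1))) * mgf a b (q s1) F"
proof -
  have "mgf a b ((p ;; q) s) F \<le> ennreal (exp b) * (ennreal (exp (a * w + b * d)) * mgf a b (q s1) F)"
    unfolding mgf_seq by (intro mult_left_mono mgf_runs[OF assms]) auto
  also have "\<dots> = ennreal (exp (a * w + b * (d + 1))) * mgf a b (q s1) F"
    by (simp add: mult.assoc[symmetric] ennreal_mult[symmetric] exp_add[symmetric] algebra_simps)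
  finally show ?thesis .
qed

text \<open>Makes moment bounds admissible for fixpoint induction. The mass functions of a chain
  increase pointwise, so monotone convergence exchanges integral and supremum; for an arbitrary
  chain this needs a countable space, here the support of the limit.\<close>

lemma nn_integral_lub_spmf_le:
  assumes chain: "Complete_Partial_Order.chain (ord_spmf (=)) Y" and Y: "Y \<noteq> {}"
    and le: "\<And>p. p \<in> Y \<Longrightarrow> (\<integral>\<^sup>+x. f x \<partial>measure_spmf p) \<le> c"
  shows "(\<integral>\<^sup>+x. f x \<partial>measure_spmf (lub_spmf Y)) \<le> c"
proof -
  let ?M = "count_space (set_spmf (lub_spmf Y))"
  have "(\<integral>\<^sup>+x. f x \<partial>measure_spmf (lub_spmf Y)) = (\<integral>\<^sup>+x. (SUP y\<in>Y. ennreal (spmf y x) * f x) \<partial>?M)"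
    using Y by (simp add: nn_integral_measure_spmf' ennreal_spmf_lub_spmf[OF chain Y] SUP_mult_right_ennreal)
  also have "\<dots> = (SUP y\<in>Y. \<integral>\<^sup>+x. ennreal (spmf y x) * f x \<partial>?M)"
    using Y
  proof (rule nn_integral_monotone_convergence_SUP_countable)
    have "(\<lambda>i x. ennreal (spmf i x) * f x) ` Y = (\<lambda>g x. g x * f x) ` (\<lambda>p x. ennreal (spmf p x)) ` Y"
      by (simp add: image_image)
    also have "Complete_Partial_Order.chain (\<le>) \<dots>"
      using chain_ord_spmf_eqD[OF chain]
      by (rule chain_imageI) (auto simp: le_fun_def intro: mult_right_mono)
    finally show "Complete_Partial_Order.chain (\<le>) ((\<lambda>i x. ennreal (spmf i x) * f x) ` Y)" .
  qed simp
  also have "\<dots> \<le> c"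
  proof (rule SUP_least)
    fix y assume "y \<in> Y"
    have "(\<integral>\<^sup>+x. ennreal (spmf y x) * f x \<partial>?M) \<le> (\<integral>\<^sup>+x. ennreal (spmf y x) * f x \<partial>count_space UNIV)"
      by (auto simp: nn_integral_count_space_indicator intro!: nn_integral_mono split: split_indicator)
    also have "\<dots> \<le> c"
      using le[OF \<open>y \<in> Y\<close>] by (simp add: nn_integral_measure_spmf)
    finally show "(\<integral>\<^sup>+x. ennreal (spmf y x) * f x \<partial>?M) \<le> c" .
  qed
  finally show ?thesis .
qed

text \<open>\<open>Seq Op (Seq t1 t2)\<close> adds one operation, the loop test, and two joining
  edges, hence \<open>x + 2 * y\<close>.\<close>

lemma mgf_loop_body:
  "mgf x y (bind_spmf p (\<lambda>(s1, t1). bind_spmf (q s1) (\<lambda>(s2, t2). return_spmf (s2, Seq Op (Seq t1 t2))))) F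
    = ennreal (exp (x + 2 * y)) * mgf x y p (\<lambda>s1. mgf x y (q s1) F)"
  unfolding mgf_def split_beta
  by (subst nn_integral_cmult[symmetric], simp)
     (auto simp: nn_integral_bind_spmf nn_integral_return_spmf nn_integral_cmult[symmetric] exp_add
        ennreal_mult algebra_simps intro!: nn_integral_cong)

text \<open>\<open>\<Phi>\<close> is a supersolution of the cost recursion, and the loop is its
  least solution; each approximation obeys the bound, and so does the limit. On exit only the
  failing test is paid. Divergence has no mass here, so no termination follows.\<close>

lemma mgf_while:
  assumes step: "\<And>s. b s \<Longrightarrow> ennreal (exp (x + 2 * y)) * mgf x y (p s) \<Phi> \<le> \<Phi> s"
    and exit: "\<And>s. \<not> b s \<Longrightarrow> ennreal (exp x) * F s \<le> \<Phi> s"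
  shows "mgf x y (while_cmd b p s) F \<le> \<Phi> s"
proof -
  have "\<forall>s. mgf x y (while_cmd b p s) F \<le> \<Phi> s"
  proof (induction rule: while_cmd.fixp_induct)
    case 1
    show ?case
    proof (simp, rule ccpo.admissibleI, intro allI)
      fix A :: "(((mem \<Rightarrow> bool) \<times> cmd) \<times> mem \<Rightarrow> (mem \<times> dag) spmf) set" and s
      assume A: "Complete_Partial_Order.chain spmf.le_fun A" "A \<noteq> {}"
        "\<forall>w\<in>A. \<forall>s. mgf x y (w ((b, p), s)) F \<le> \<Phi> s"
      have "{z. \<exists>w\<in>A. z = w ((b, p), s)} = (\<lambda>w. w ((b, p), s)) ` A"
        by auto
      moreover have "Complete_Partial_Order.chain (ord_spmf (=)) ((\<lambda>w. w ((b, p), s)) ` A)"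
        by (rule chain_imageI[OF A(1)]) (simp add: fun_ord_def)
      ultimately show "mgf x y (spmf.lub_fun A ((b, p), s)) F \<le> \<Phi> s"
        unfolding mgf_def fun_lub_def using A(2,3)
        by (auto simp: mgf_def intro!: nn_integral_lub_spmf_le)
    qed
  next
    case 2
    show ?case by (simp only: mgf_def measure_spmf_return_pmf_None nn_integral_null_measure) simp
  next
    case (3 w)
    have "mgf x y (w b p s1) F \<le> \<Phi> s1" for s1
      using 3 by blast
    then have "mgf x y (p s) (\<lambda>s1. mgf x y (w b p s1) F) \<le> mgf x y (p s) \<Phi>" for s
      by (intro mgf_mono)
    then have "ennreal (exp (x + 2 * y)) * mgf x y (p s) (\<lambda>s1. mgf x y (w b p s1) F) \<le> \<Phi> s" if "b s" for s
      using order_trans[OF mult_left_mono step[OF that]] by simp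
    then show ?case
      using exit by (simp add: mgf_loop_body mgf_return)
  qed
  then show ?thesis by blast
qed


text \<open>In a discrete distribution an almost sure property holds at every point of the
  support.\<close>

lemma mgf_finite_imp:
  assumes "mgf a b p (\<lambda>s. if P s then F s else \<infinity>) < \<infinity>" "(s, t) \<in> set_spmf p"
  shows "P s"
proof (rule ccontr)
  assume "\<not> P s"
  have "AE x in measure_spmf p. (case x of (s, t) \<Rightarrow>
      ennreal (exp (a * real (work t) + b * real (dep t))) * (if P s then F s else \<infinity>)) \<noteq> \<infinity>"
    using assms(1) unfolding mgf_def by (intro nn_integral_noteq_infinite) auto
  then show False
    using assms(2) \<open>\<not> P s\<close> by (auto simp: AE_measure_spmf_iff ennreal_mult_top)
qed

text \<open>The divergence probability \<open>g\<close> of a memory is the mean of \<open>g\<close>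
  over its successors. While the loop runs, \<open>g\<close> is at most 1 and thus at most
  \<open>V\<close>; every unfolding improves this bound by the factor \<open>r\<close>. So
  \<open>g\<close> is below \<open>r ^ k\<close> times a finite number for all \<open>k\<close>. An
  infinite \<open>V\<close> marks memories outside the invariant.\<close>

lemma lossless_while:
  fixes V :: "mem \<Rightarrow> ennreal"
  assumes lossless: "\<And>s. b s \<Longrightarrow> V s < \<infinity> \<Longrightarrow> lossless_spmf (p s)"
    and decr: "\<And>s. b s \<Longrightarrow> V s < \<infinity> \<Longrightarrow> mgf 0 0 (p s) V \<le> ennreal r * V s"
    and pos: "\<And>s. b s \<Longrightarrow> V s \<ge> 1"
    and r: "0 \<le> r" "r < 1"
    and s: "V s < \<infinity>"
  shows "lossless_spmf (while_cmd b p s)"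
proof -
  define g where "g s = ennreal (pmf (while_cmd b p s) None)" for s
  have step: "g s = (\<integral>\<^sup>+x. g (fst x) \<partial>measure_spmf (p s))" if "b s" "V s < \<infinity>" for s
  proof -
    have "g s = ennreal (\<integral>x. pmf (while_cmd b p (fst x)) None \<partial>measure_spmf (p s))"
      using that lossless[OF that] unfolding g_def
      by (subst while_cmd.simps)
         (simp add: pmf_bind_spmf_None lossless_iff_pmf_None split_beta)
    also have "\<dots> = (\<integral>\<^sup>+x. g (fst x) \<partial>measure_spmf (p s))"
      unfolding g_def split_beta
      by (rule nn_integral_eq_integral[symmetric])
         (auto intro!: measure_spmf.integrable_const_bound[where B = 1] simp: pmf_le_1)
    finally show ?thesis .
  qed
  have bound: "V s < \<infinity> \<Longrightarrow> g s \<le> ennreal (r ^ k) * V s" for s k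
  proof (induction k arbitrary: s)
    case 0
    show ?case
    proof (cases "b s")
      case True
      have "g s \<le> 1"
        unfolding g_def using pmf_le_1[of "while_cmd b p s" None] by (simp add: ennreal_le_1)
      with pos[OF True] show ?thesis
        by simp
    qed (simp add: g_def while_cmd.simps)
  next
    case (Suc k)
    show ?case
    proof (cases "b s")
      case True
      \<comment> \<open>The induction hypothesis is available only where \<open>V\<close> is finite;
        a finite mean of \<open>V\<close> ensures this at every possible successor.\<close>
      have fin: "mgf 0 0 (p s) V < \<infinity>"
        using decr[OF True Suc.prems] Suc.prems by (auto simp: ennreal_mult_less_top intro: le_less_trans)
      have V: "V = (\<lambda>s. if V s < \<infinity> then V s else \<infinity>)"
        by (auto simp: fun_eq_iff less_top[symmetric])
      have fin': "mgf 0 0 (p s) (\<lambda>s. if V s < \<infinity> then V s else \<infinity>) < \<infinity>"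
        using fin by (rule subst[OF V])
      have "V s1 < \<infinity>" if "(s1, t1) \<in> set_spmf (p s)" for s1 t1
        by (rule mgf_finite_imp[OF fin' that])
      then have "g s \<le> mgf 0 0 (p s) (\<lambda>s1. ennreal (r ^ k) * V s1)"
        unfolding step[OF True Suc.prems] mgf_def
        by (intro nn_integral_mono_AE) (auto simp: AE_measure_spmf_iff intro!: Suc.IH)
      also have "\<dots> \<le> ennreal (r ^ k) * (ennreal r * V s)"
        unfolding mgf_cmult by (intro mult_left_mono decr True Suc.prems) auto
      also have "\<dots> = ennreal (r ^ Suc k) * V s"
        using r by (simp add: ennreal_mult mult_ac)
      finally show ?thesis .
    qed (simp add: g_def while_cmd.simps)
  qed
  obtain v where v: "V s = ennreal v" "v \<ge> 0"
    using s by (cases "V s") auto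
  have "pmf (while_cmd b p s) None \<le> r ^ k * v" for k
    using bound[OF s, of k] r v unfolding g_def v(1) by (simp add: ennreal_mult[symmetric])
  moreover have "(\<lambda>k. r ^ k * v) \<longlonglongrightarrow> 0 * v"
    using r by (intro tendsto_mult LIMSEQ_power_zero tendsto_const) auto
  ultimately have "pmf (while_cmd b p s) None \<le> 0"
    by (intro LIMSEQ_le_const[of "\<lambda>k. r ^ k * v"]) auto
  then show ?thesis
    by (simp add: lossless_iff_pmf_None order_antisym)
qed

section \<open>Random colorings\<close>

text \<open>Independent draws in the form of successive updates, as the parallel loop over
  \<open>choose_color\<close> produces them. Reordering draws becomes commutation of
  \<open>bind_spmf\<close>.\<close>

primrec colorings :: "(nat \<Rightarrow> nat set) \<Rightarrow> nat list \<Rightarrow> (nat \<Rightarrow> nat) \<Rightarrow> (nat \<Rightarrow> nat) spmf" where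
  "colorings P [] f = return_spmf f"
| "colorings P (x # xs) f = bind_spmf (spmf_of_set (P x)) (\<lambda>c. colorings P xs (f(x := c)))"

lemma colorings_append: "colorings P (xs @ ys) f = bind_spmf (colorings P xs f) (colorings P ys)"
  by (induction xs arbitrary: f) auto

text \<open>Draws into different cells commute. With \<open>x\<close> drawn last, its color can be
  averaged out while the colors of all other vertices in the list are fixed.\<close>

lemma colorings_rotate1:
  "x \<notin> set xs \<Longrightarrow> colorings P (x # xs) f = colorings P (xs @ [x]) f"
proof (induction xs arbitrary: f)
  case (Cons y xs)
  have "colorings P (x # y # xs) f =
      bind_spmf (spmf_of_set (P y)) (\<lambda>d. bind_spmf (spmf_of_set (P x)) (\<lambda>c. colorings P xs (f(x := c, y := d))))"
    by (simp, rule bind_commute_spmf)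
  also have "\<dots> = bind_spmf (spmf_of_set (P y)) (\<lambda>d. colorings P (x # xs) (f(y := d)))"
    using Cons.prems by (simp add: fun_upd_twist)
  also have "\<dots> = colorings P ((y # xs) @ [x]) f"
    using Cons.prems by (subst Cons.IH) auto
  finally show ?case .
qed simp

text \<open>Allows the conflicts to be analyzed in both orders on one and the same
  distribution.\<close>

lemma colorings_rev: "distinct xs \<Longrightarrow> colorings P (rev xs) f = colorings P xs f"
proof (induction xs arbitrary: f)
  case (Cons x xs)
  then have "colorings P (rev (x # xs)) f = colorings P (xs @ [x]) f"
    by (simp add: colorings_append)
  with Cons.prems show ?case
    using colorings_rotate1[of x xs P f] by simp
qed simp

lemma colorings_support:
  assumes "f \<in> set_spmf (colorings P xs f0)" "\<And>x. x \<in> set xs \<Longrightarrow> finite (P x)"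
  shows "\<forall>x. (x \<in> set xs \<longrightarrow> f x \<in> P x) \<and> (x \<notin> set xs \<longrightarrow> f x = f0 x)"
  using assms
proof (induction xs arbitrary: f0)
  case (Cons x xs)
  then obtain c where c: "c \<in> P x" "f \<in> set_spmf (colorings P xs (f0(x := c)))"
    by (auto simp: set_bind_spmf)
  have "\<forall>z. (z \<in> set xs \<longrightarrow> f z \<in> P z) \<and> (z \<notin> set xs \<longrightarrow> f z = (f0(x := c)) z)"
    using Cons.IH[OF c(2)] Cons.prems by simp
  with c(1) show ?case
    by (metis fun_upd_apply set_ConsD list.set_intros)
qed simp

lemma lossless_colorings:
  "(\<And>x. x \<in> set xs \<Longrightarrow> finite (P x) \<and> P x \<noteq> {}) \<Longrightarrow> lossless_spmf (colorings P xs f)"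
  by (induction xs arbitrary: f) auto

text \<open>The factor of a vertex depends only on its own color and on the colors of the vertices that
  follow it in the list, so the colors can be averaged out one vertex at a time.\<close>

primrec conflict_weight ::
  "(nat \<Rightarrow> nat set) \<Rightarrow> (nat \<Rightarrow> nat set) \<Rightarrow> (nat \<Rightarrow> real) \<Rightarrow> nat list \<Rightarrow> (nat \<Rightarrow> nat) \<Rightarrow> real" where
  "conflict_weight B N a [] f = 1"
| "conflict_weight B N a (x # xs) f =
     (if f x \<in> B x \<or> (\<exists>u\<in>set xs \<inter> N x. f u = f x) then a x else 1) * conflict_weight B N a xs f"

lemma conflict_weight_cong:
  "(\<And>x. x \<in> set xs \<Longrightarrow> f x = g x) \<Longrightarrow> conflict_weight B N a xs f = conflict_weight B N a xs g"
proof (induction xs)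
  case (Cons x xs)
  then have "conflict_weight B N a xs f = conflict_weight B N a xs g"
    by simp
  moreover have "(\<exists>u\<in>set xs \<inter> N x. f u = f x) = (\<exists>u\<in>set xs \<inter> N x. g u = g x)" "f x = g x"
    using Cons.prems by auto
  ultimately show ?case
    by simp
qed simp

lemma conflict_weight_ge_1:
  "(\<And>x. x \<in> set xs \<Longrightarrow> a x \<ge> 1) \<Longrightarrow> conflict_weight B N a xs f \<ge> 1"
  by (induction xs) (auto intro: mult_ge1_I simp: mult_ge1_I)

lemma conflict_weight_power2:
  "conflict_weight B N (\<lambda>x. (a x)\<^sup>2) xs f = (conflict_weight B N a xs f)\<^sup>2"
  by (induction xs) (auto simp: power_mult_distrib)

text \<open>The factor is 1 plus \<open>a - 1\<close> on a hit, and a hit has probability at most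
  \<open>q\<close>; members of \<open>S\<close> outside \<open>P\<close> only enlarge the
  estimate.\<close>

lemma expected_hit_weight:
  assumes P: "finite P" "P \<noteq> {}" and S: "finite S" "real (card S) \<le> q * real (card P)" and a: "a \<ge> 1"
  shows "(\<integral>\<^sup>+c. ennreal (if c \<in> S then a else 1) \<partial>measure_spmf (spmf_of_set P)) \<le> ennreal (1 + q * (a - 1))"
proof -
  have cP: "card P > 0"
    using P by (simp add: card_gt_0_iff)
  have "real (card (P \<inter> S)) \<le> q * real (card P)"
    using S card_mono[of S "P \<inter> S"] by auto
  then have "real (card (P \<inter> S)) * (a - 1) \<le> q * real (card P) * (a - 1)"
    using a by (intro mult_right_mono) auto
  moreover have "(\<Sum>c\<in>P. if c \<in> S then a else 1) = (\<Sum>c\<in>P. 1 + (if c \<in> S then a - 1 else 0))"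
    by (intro sum.cong) auto
  then have "(\<Sum>c\<in>P. if c \<in> S then a else 1) = real (card P) + real (card (P \<inter> S)) * (a - 1)"
    using P by (simp add: sum.distrib sum.If_cases)
  ultimately have "(\<Sum>c\<in>P. if c \<in> S then a else 1) / real (card P) \<le> 1 + q * (a - 1)"
    using cP by (simp add: field_simps)
  moreover have "(\<Sum>c\<in>P. ennreal (if c \<in> S then a else 1)) = ennreal (\<Sum>c\<in>P. if c \<in> S then a else 1)"
    using a by (intro sum_ennreal) auto
  then have "(\<integral>\<^sup>+c. ennreal (if c \<in> S then a else 1) \<partial>measure_spmf (spmf_of_set P))
      = ennreal ((\<Sum>c\<in>P. if c \<in> S then a else 1) / real (card P))"
    using a cP by (auto simp: nn_integral_spmf_of_set divide_ennreal ennreal_of_nat_eq_real_of_nat sum_nonneg)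
  ultimately show ?thesis
    by (simp add: ennreal_leI)
qed

text \<open>Draw the head of the list last. The factors of the other vertices do not see its color,
  and its own factor exceeds 1 only if its color hits a set that is already fixed and has relative
  size at most \<open>q\<close>. This contributes one factor, and the induction hypothesis handles
  the rest.\<close>

lemma expected_conflict_weight:
  assumes "distinct xs"
    and "\<And>x. x \<in> set xs \<Longrightarrow> finite (P x) \<and> P x \<noteq> {} \<and> finite (B x) \<and> a x \<ge> 1 \<and>
      real (card (B x) + card (set xs \<inter> N x)) \<le> q * real (card (P x))"
    and q: "q \<ge> 0"
  shows "(\<integral>\<^sup>+f. ennreal (conflict_weight B N a xs f) \<partial>measure_spmf (colorings P xs f0))
    \<le> ennreal (\<Prod>x\<leftarrow>xs. 1 + q * (a x - 1))"
  using assms(1,2)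
proof (induction xs)
  case (Cons x xs)
  have cw1: "conflict_weight B N a xs f \<ge> 1" for f
    using Cons.prems by (intro conflict_weight_ge_1) auto
  have ax: "a x \<ge> 1"
    using Cons.prems by simp
  have inner: "(\<integral>\<^sup>+c. ennreal (conflict_weight B N a (x # xs) (g(x := c))) \<partial>measure_spmf (spmf_of_set (P x)))
      \<le> ennreal (1 + q * (a x - 1)) * ennreal (conflict_weight B N a xs g)" for g
  proof -
    \<comment> \<open>The colors that are bad for \<open>x\<close> once the colors \<open>g\<close>
      of the later vertices are known.\<close>
    let ?S = "B x \<union> g ` (set xs \<inter> N x)"
    have "card ?S \<le> card (B x) + card (set xs \<inter> N x)"
      by (intro order_trans[OF card_Un_le] add_left_mono card_image_le) auto
    also have "\<dots> \<le> card (B x) + card (set (x # xs) \<inter> N x)"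
      by (intro add_left_mono card_mono) auto
    finally have S: "real (card ?S) \<le> q * real (card (P x))"
      using Cons.prems(2)[of x] by auto
    have eq: "conflict_weight B N a (x # xs) (g(x := c)) = (if c \<in> ?S then a x else 1) * conflict_weight B N a xs g" for c
    proof -
      have "conflict_weight B N a xs (g(x := c)) = conflict_weight B N a xs g"
        using Cons.prems by (intro conflict_weight_cong) auto
      moreover have "(\<exists>u\<in>set xs \<inter> N x. (g(x := c)) u = c) \<longleftrightarrow> c \<in> g ` (set xs \<inter> N x)"
        using Cons.prems by auto
      ultimately show ?thesis
        by simp
    qed
    have "(\<integral>\<^sup>+c. ennreal (conflict_weight B N a (x # xs) (g(x := c))) \<partial>measure_spmf (spmf_of_set (P x)))
        = (\<integral>\<^sup>+c. ennreal (if c \<in> ?S then a x else 1) \<partial>measure_spmf (spmf_of_set (P x))) * ennreal (conflict_weight B N a xs g)"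
      unfolding eq using ax order_trans[OF zero_le_one cw1[of g]]
      by (subst ennreal_mult) (auto simp: nn_integral_multc)
    also have "\<dots> \<le> ennreal (1 + q * (a x - 1)) * ennreal (conflict_weight B N a xs g)"
      using Cons.prems(2)[of x] S by (intro mult_right_mono expected_hit_weight) auto
    finally show ?thesis .
  qed
  have IH: "(\<integral>\<^sup>+f. ennreal (conflict_weight B N a xs f) \<partial>measure_spmf (colorings P xs f0))
      \<le> ennreal (\<Prod>x\<leftarrow>xs. 1 + q * (a x - 1))"
  proof (rule Cons.IH)
    fix y assume y: "y \<in> set xs"
    have "card (set xs \<inter> N y) \<le> card (set (x # xs) \<inter> N y)"
      by (intro card_mono) auto
    with Cons.prems(2)[of y] y show "finite (P y) \<and> P y \<noteq> {} \<and> finite (B y) \<and> a y \<ge> 1 \<and>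
        real (card (B y) + card (set xs \<inter> N y)) \<le> q * real (card (P y))"
      by auto
  qed (use Cons.prems in simp)
  have "(\<integral>\<^sup>+f. ennreal (conflict_weight B N a (x # xs) f) \<partial>measure_spmf (colorings P (x # xs) f0))
      = (\<integral>\<^sup>+g. (\<integral>\<^sup>+c. ennreal (conflict_weight B N a (x # xs) (g(x := c))) \<partial>measure_spmf (spmf_of_set (P x)))
          \<partial>measure_spmf (colorings P xs f0))"
    using Cons.prems(1)
    by (subst colorings_rotate1)
       (simp_all add: colorings_append nn_integral_bind_spmf nn_integral_return_spmf del: conflict_weight.simps)
  also have "\<dots> \<le> (\<integral>\<^sup>+g. ennreal (1 + q * (a x - 1)) * ennreal (conflict_weight B N a xs g) \<partial>measure_spmf (colorings P xs f0))"
    by (intro nn_integral_mono inner)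
  also have "\<dots> \<le> ennreal (1 + q * (a x - 1)) * ennreal (\<Prod>x\<leftarrow>xs. 1 + q * (a x - 1))"
    using IH by (subst nn_integral_cmult) (auto intro: mult_left_mono)
  also have "\<dots> = ennreal (\<Prod>x\<leftarrow>x # xs. 1 + q * (a x - 1))"
    using ax q by (simp add: ennreal_mult')
  finally show ?case .
qed (simp only: colorings.simps conflict_weight.simps nn_integral_return_spmf, simp)

text \<open>A product over the vertex set lets the weights of a list and of its reverse be compared
  factor by factor. The term \<open>tl (dropWhile ...)\<close> is the part of the list behind
  \<open>x\<close>.\<close>

lemma conflict_weight_conv_prod:
  "distinct xs \<Longrightarrow> conflict_weight B N a xs f =
    (\<Prod>x\<in>set xs. if f x \<in> B x \<or> (\<exists>u\<in>set (tl (dropWhile (\<lambda>y. y \<noteq> x) xs)) \<inter> N x. f u = f x) then a x else 1)"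
proof (induction xs)
  case (Cons x xs)
  have "(\<Prod>y\<in>set xs. if f y \<in> B y \<or> (\<exists>u\<in>set (tl (dropWhile (\<lambda>z. z \<noteq> y) (x # xs))) \<inter> N y. f u = f y) then a y else 1)
     = (\<Prod>y\<in>set xs. if f y \<in> B y \<or> (\<exists>u\<in>set (tl (dropWhile (\<lambda>z. z \<noteq> y) xs)) \<inter> N y. f u = f y) then a y else 1)"
    using Cons.prems by (intro prod.cong) auto
  with Cons show ?case
    by (subst set_simps, subst prod.insert) auto
qed simp

definition failed :: "(nat \<Rightarrow> nat set) \<Rightarrow> (nat \<Rightarrow> nat set) \<Rightarrow> nat set \<Rightarrow> (nat \<Rightarrow> nat) \<Rightarrow> nat set" where
  "failed B N U f = {v \<in> U. f v \<in> B v \<or> (\<exists>u\<in>U \<inter> N v. f u = f v)}"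

text \<open>A conflicting neighbor comes later in the list either in the given order or in the reverse one;
  the product of the two weights is then split by \<open>2xy \<le> x\<^sup>2 + y\<^sup>2\<close>, since they are dependent.\<close>

lemma prod_failed_le:
  assumes "distinct xs" "\<And>x. x \<in> set xs \<Longrightarrow> a x \<ge> 1" "\<And>x. x \<in> set xs \<Longrightarrow> x \<notin> N x"
  shows "(\<Prod>v\<in>failed B N (set xs) f. a v) \<le> conflict_weight B N a xs f * conflict_weight B N a (rev xs) f"
proof -
  let ?X = "\<lambda>ys x. f x \<in> B x \<or> (\<exists>u\<in>set (tl (dropWhile (\<lambda>y. y \<noteq> x) ys)) \<inter> N x. f u = f x)"
  have "(\<Prod>v\<in>failed B N (set xs) f. a v) = (\<Prod>x\<in>set xs. if x \<in> failed B N (set xs) f then a x else 1)"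
    by (rule prod.mono_neutral_cong_left) (auto simp: failed_def)
  also have "\<dots> \<le> (\<Prod>x\<in>set xs. (if ?X xs x then a x else 1) * (if ?X (rev xs) x then a x else 1))"
  proof (rule prod_mono, rule conjI)
    fix x assume x: "x \<in> set xs"
    show "0 \<le> (if x \<in> failed B N (set xs) f then a x else 1)"
      using assms(2)[OF x] by auto
    obtain ys zs where xs: "xs = ys @ x # zs" "x \<notin> set ys" "x \<notin> set zs"
      using x assms(1) by (metis split_list distinct_append distinct.simps(2) disjoint_insert(1) inf_commute list.simps(15) disjoint_iff list.set_intros(1))
    have "dropWhile (\<lambda>y. y \<noteq> x) xs = x # zs" "dropWhile (\<lambda>y. y \<noteq> x) (rev xs) = x # rev ys"
      using xs by (auto simp: dropWhile_append)
    then have "set xs = set (tl (dropWhile (\<lambda>y. y \<noteq> x) xs)) \<union> set (tl (dropWhile (\<lambda>y. y \<noteq> x) (rev xs))) \<union> {x}"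
      using xs by auto
    \<comment> \<open>The vertex with the same color is not \<open>x\<close> itself, because
      \<open>x \<notin> N x\<close>; so it lies strictly on one side.\<close>
    then have "x \<in> failed B N (set xs) f \<Longrightarrow> ?X xs x \<or> ?X (rev xs) x"
      using assms(3)[OF x] unfolding failed_def by blast
    \<comment> \<open>A vertex may conflict on both sides and pay twice; \<open>a x \<ge> 1\<close>
      makes the surplus harmless.\<close>
    moreover have "a x \<le> a x * a x" "1 \<le> a x * a x"
      using assms(2)[OF x] by (auto intro: mult_ge1_I)
    ultimately show "(if x \<in> failed B N (set xs) f then a x else 1) \<le> (if ?X xs x then a x else 1) * (if ?X (rev xs) x then a x else 1)"
      using assms(2)[OF x] by auto
  qed
  also have "\<dots> = conflict_weight B N a xs f * conflict_weight B N a (rev xs) f"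
    using assms(1) by (simp add: conflict_weight_conv_prod prod.distrib)
  finally show ?thesis .
qed

lemma expected_prod_failed:
  assumes "distinct xs"
    and P: "\<And>x. x \<in> set xs \<Longrightarrow> finite (P x) \<and> P x \<noteq> {} \<and> finite (B x) \<and> a x \<ge> 1 \<and> x \<notin> N x \<and>
      real (card (B x) + card (set xs \<inter> N x)) \<le> q * real (card (P x))"
    and q: "q \<ge> 0"
  shows "(\<integral>\<^sup>+f. ennreal (\<Prod>v\<in>failed B N (set xs) f. a v) \<partial>measure_spmf (colorings P xs f0))
    \<le> ennreal (\<Prod>x\<in>set xs. 1 + q * ((a x)\<^sup>2 - 1))"
proof -
  let ?a = "\<lambda>x. (a x)\<^sup>2" and ?M = "measure_spmf (colorings P xs f0)"
  \<comment> \<open>Neither the distribution nor the final product depends on the order, so both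
    directions obey the same bound.\<close>
  have bound: "(\<integral>\<^sup>+f. ennreal (conflict_weight B N ?a ys f) \<partial>?M) \<le> ennreal (\<Prod>x\<in>set xs. 1 + q * ((a x)\<^sup>2 - 1))"
    if "ys = xs \<or> ys = rev xs" for ys
  proof -
    have ys: "distinct ys" "set ys = set xs" "colorings P xs f0 = colorings P ys f0"
      using that assms(1) colorings_rev[of xs] by auto
    have "(\<integral>\<^sup>+f. ennreal (conflict_weight B N ?a ys f) \<partial>?M) \<le> ennreal (\<Prod>x\<leftarrow>ys. 1 + q * (?a x - 1))"
      unfolding ys(3) by (rule expected_conflict_weight) (use ys P q in auto)
    then show ?thesis
      using ys by (simp add: prod.distinct_set_conv_list[symmetric])
  qed
  have "(\<integral>\<^sup>+f. ennreal (\<Prod>v\<in>failed B N (set xs) f. a v) \<partial>?M)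
      \<le> (\<integral>\<^sup>+f. ennreal (1/2) * (ennreal (conflict_weight B N ?a xs f) + ennreal (conflict_weight B N ?a (rev xs) f)) \<partial>?M)"
  proof (rule nn_integral_mono)
    fix f
    let ?c = "conflict_weight B N a xs f" and ?d = "conflict_weight B N a (rev xs) f"
    have "(\<Prod>v\<in>failed B N (set xs) f. a v) \<le> ?c * ?d"
      using assms by (intro prod_failed_le) auto
    also have "\<dots> \<le> 1/2 * (?c\<^sup>2 + ?d\<^sup>2)"
      using sum_squares_bound[of ?c ?d] by simp
    finally show "ennreal (\<Prod>v\<in>failed B N (set xs) f. a v) \<le>
        ennreal (1/2) * (ennreal (conflict_weight B N ?a xs f) + ennreal (conflict_weight B N ?a (rev xs) f))"
      unfolding conflict_weight_power2
      by (simp only: ennreal_plus[OF zero_le_power2 zero_le_power2, symmetric] ennreal_mult'[symmetric] ennreal_leI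
          half_gt_zero_iff zero_le_divide_1_iff zero_le_numeral)
  qed
  also have "\<dots> = ennreal (1/2) * ((\<integral>\<^sup>+f. ennreal (conflict_weight B N ?a xs f) \<partial>?M) + (\<integral>\<^sup>+f. ennreal (conflict_weight B N ?a (rev xs) f) \<partial>?M))"
    by (subst nn_integral_cmult) (auto simp: nn_integral_add)
  also have "\<dots> \<le> ennreal (1/2) * (ennreal (\<Prod>x\<in>set xs. 1 + q * ((a x)\<^sup>2 - 1)) + ennreal (\<Prod>x\<in>set xs. 1 + q * ((a x)\<^sup>2 - 1)))"
    by (intro mult_left_mono add_mono bound) auto
  also have "\<dots> = ennreal (\<Prod>x\<in>set xs. 1 + q * ((a x)\<^sup>2 - 1))"
  proof -
    have "(\<Prod>x\<in>set xs. 1 + q * ((a x)\<^sup>2 - 1)) \<ge> 0"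
      using P q by (intro prod_nonneg ballI add_nonneg_nonneg mult_nonneg_nonneg) (auto simp: one_le_power)
    then show ?thesis
      by (simp only: ennreal_plus[symmetric] ennreal_mult'[symmetric] half_gt_zero_iff
          zero_le_divide_1_iff zero_le_numeral) simp
  qed
  finally show ?thesis .
qed

text \<open>A union bound over the two directions. With weight 2 at \<open>v\<close> and 1
  elsewhere, each weight is 1 or 2, equals 2 exactly when \<open>v\<close> conflicts in that
  direction, and has mean at most \<open>1 + q\<close>. The squared weights of
  \<open>expected_prod_failed\<close> with the same choice would only give 3 q, which need not be
  below 1.\<close>

lemma prob_failed:
  assumes "distinct xs"
    and P: "\<And>x. x \<in> set xs \<Longrightarrow> finite (P x) \<and> P x \<noteq> {} \<and> finite (B x) \<and> x \<notin> N x \<and>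
      real (card (B x) + card (set xs \<inter> N x)) \<le> q * real (card (P x))"
    and q: "q \<ge> 0" and v: "v \<in> set xs"
  shows "(\<integral>\<^sup>+f. indicator (failed B N (set xs) f) v \<partial>measure_spmf (colorings P xs f0)) \<le> ennreal (2 * q)"
proof -
  let ?M = "measure_spmf (colorings P xs f0)"
  let ?a = "\<lambda>x. if x = v then 2 else 1 :: real"
  have bound: "(\<integral>\<^sup>+f. ennreal (conflict_weight B N ?a ys f) \<partial>?M) \<le> ennreal (1 + q)"
    if "ys = xs \<or> ys = rev xs" for ys
  proof -
    have ys: "distinct ys" "set ys = set xs" "colorings P xs f0 = colorings P ys f0"
      using that assms(1) colorings_rev[of xs] by auto
    have "(\<integral>\<^sup>+f. ennreal (conflict_weight B N ?a ys f) \<partial>?M) \<le> ennreal (\<Prod>x\<leftarrow>ys. 1 + q * (?a x - 1))"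
      unfolding ys(3) by (rule expected_conflict_weight) (use ys P q in auto)
    also have "(\<Prod>x\<leftarrow>ys. 1 + q * (?a x - 1)) = (\<Prod>x\<in>set xs. if x = v then 1 + q else 1)"
      using ys by (subst prod.distinct_set_conv_list[symmetric], simp, intro prod.cong) auto
    also have "\<dots> = 1 + q"
      using v by (simp add: prod.delta)
    finally show ?thesis .
  qed
  \<comment> \<open>Total mass 1 makes the mean of the constant 2 equal to 2, so the constant can be
    added first and cancelled at the end.\<close>
  have lossless: "lossless_spmf (colorings P xs f0)"
    using P by (intro lossless_colorings) auto
  then have "emeasure ?M (space ?M) = 1"
    by (simp add: lossless_spmf_def space_measure_spmf measure_spmf.emeasure_eq_measure)
  then have "2 + (\<integral>\<^sup>+f. indicator (failed B N (set xs) f) v \<partial>?M) = (\<integral>\<^sup>+f. 2 + indicator (failed B N (set xs) f) v \<partial>?M)"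
    by (subst nn_integral_add) (auto simp: nn_integral_const)
  also have "\<dots> \<le> (\<integral>\<^sup>+f. ennreal (conflict_weight B N ?a xs f) + ennreal (conflict_weight B N ?a (rev xs) f) \<partial>?M)"
  proof (rule nn_integral_mono)
    fix f
    let ?c = "conflict_weight B N ?a xs f" and ?d = "conflict_weight B N ?a (rev xs) f"
    have cd: "?c \<ge> 1" "?d \<ge> 1"
      by (auto intro: conflict_weight_ge_1)
    have two: "conflict_weight B N ?a ys f \<in> {1, 2}" if "distinct ys" for ys
    proof -
      define X where "X = (\<lambda>x. f x \<in> B x \<or> (\<exists>u\<in>set (tl (dropWhile (\<lambda>y. y \<noteq> x) ys)) \<inter> N x. f u = f x))"
      have "conflict_weight B N ?a ys f = (\<Prod>x\<in>set ys. if x = v then (if X x then 2 else 1) else 1)"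
        unfolding conflict_weight_conv_prod[OF that] X_def by (intro prod.cong) auto
      also have "\<dots> = (if v \<in> set ys then (if X v then 2 else 1) else 1)"
        by (rule prod.delta) simp
      finally show ?thesis
        by auto
    qed
    have "(\<Prod>x\<in>failed B N (set xs) f. ?a x) = (if v \<in> failed B N (set xs) f then 2 else 1)"
      by (subst prod.delta) (auto simp: failed_def)
    moreover have "(\<Prod>x\<in>failed B N (set xs) f. ?a x) \<le> ?c * ?d"
      using assms by (intro prod_failed_le) auto
    ultimately have "2 + indicator (failed B N (set xs) f) v \<le> ?c + ?d"
      using two[of xs] two[of "rev xs"] \<open>distinct xs\<close> cd by (auto simp: indicator_def split: if_splits)
    then have "ennreal (2 + indicator (failed B N (set xs) f) v) \<le> ennreal (?c + ?d)"
      by (rule ennreal_leI)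
    then show "2 + indicator (failed B N (set xs) f) v \<le> ennreal ?c + ennreal ?d"
      using cd by (cases "v \<in> failed B N (set xs) f") simp_all
  qed
  also have "\<dots> \<le> ennreal (1 + q) + ennreal (1 + q)"
    by (subst nn_integral_add) (auto intro!: add_mono bound)
  also have "\<dots> = 2 + ennreal (2 * q)"
    using q by (simp add: ennreal_plus[symmetric] del: ennreal_plus) (simp add: ennreal_plus)
  finally show ?thesis
    by (simp add: ennreal_add_left_cancel_le)
qed

section \<open>SIM-COL\<close>

lemma lossless_atomic: "lossless_spmf (atomic f s)"
  by (simp add: atomic_def)

lemma lossless_seq:
  "lossless_spmf (p s) \<Longrightarrow> (\<And>s1 t. (s1, t) \<in> set_spmf (p s) \<Longrightarrow> lossless_spmf (q s1)) \<Longrightarrow> lossless_spmf ((p ;; q) s)"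
  by (auto simp: seq_def split_beta)

lemma lossless_branches: "(\<And>x s. x \<in> set xs \<Longrightarrow> lossless_spmf (p x s)) \<Longrightarrow> lossless_spmf (branches p xs s)"
  by (induction xs arbitrary: s) (auto simp: split_beta)

lemma lossless_par_list: "(\<And>x s. lossless_spmf (p x s)) \<Longrightarrow> lossless_spmf (par_list xs p s)"
  by (auto simp: par_list_def split_beta intro!: lossless_branches)

lemma lossless_par_set: "(\<And>x s. lossless_spmf (p x s)) \<Longrightarrow> lossless_spmf (par_set A p s)"
  by (simp add: par_set_def lossless_par_list)

lemma lossless_reduce: "lossless_spmf (reduce xs f upd s)"
  by (simp add: reduce_def)

lemma finite_palette: "finite (palette \<mu> k)"
  by (simp add: palette_def)

lemma card_palette: "\<mu> > 0 \<Longrightarrow> (1 + \<mu>) * real k \<le> real (card (palette \<mu> k))"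
  by (auto simp: palette_def)

lemma palette_nonempty: "\<mu> > 0 \<Longrightarrow> palette \<mu> k \<noteq> {}"
proof (cases "k = 0")
  case False
  assume "\<mu> > 0"
  with False have "0 < (1 + \<mu>) * real k"
    by simp
  with card_palette[OF \<open>\<mu> > 0\<close>, of k] have "card (palette \<mu> k) \<noteq> 0"
    by linarith
  then show ?thesis
    by auto
qed (simp add: palette_def)

text \<open>The color 0 is thus free to mark failure, and the test for a positive color separates
  the vertices that keep their color.\<close>

lemma palette_pos: "c \<in> palette \<mu> k \<Longrightarrow> c > 0"
  by (auto simp: palette_def split: if_splits)

text \<open>A choice writes only to \<open>C_of\<close>, so the palettes stay fixed during the
  loop.\<close>

lemma branches_choose_color:
  "branches (choose_color \<mu>) xs s =
    map_spmf (\<lambda>f. (s\<lparr>C_of := f\<rparr>, replicate (length xs) Op)) (colorings (\<lambda>v. palette \<mu> (deg_of s v)) xs (C_of s))"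
proof (induction xs arbitrary: s)
  case (Cons x xs)
  show ?case
    by (simp add: choose_color_def[of \<mu> x s] Cons.IH bind_map_spmf map_spmf_bind_spmf o_def
        map_spmf_conv_bind_spmf)
qed simp

lemma mgf_choose_colors:
  assumes "finite (U_of s)"
  shows "mgf a b (par_set U_of (choose_color \<mu>) s) F =
    ennreal (exp (a * (1 + real (card (U_of s))) + b)) *
    (\<integral>\<^sup>+f. F (s\<lparr>C_of := f\<rparr>) \<partial>measure_spmf
      (colorings (\<lambda>v. palette \<mu> (deg_of s v)) (sorted_list_of_set (U_of s)) (C_of s)))"
proof -
  have "Max (insert 0 (dep ` set (replicate n Op))) = 0" for n
    by (cases n) (auto simp: set_replicate_conv_if)
  then show ?thesis
    unfolding mgf_def par_set_def par_list_def branches_choose_color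
    by (simp add: map_spmf_conv_bind_spmf nn_integral_bind_spmf nn_integral_return_spmf
        nn_integral_cmult[symmetric] split_beta sum_list_replicate ac_simps)
qed

lemma indicator_sum_list_pos: "(\<Sum>u\<leftarrow>us. if Q u then 1 else 0 :: nat) > 0 \<longleftrightarrow> (\<exists>u\<in>set us. Q u)"
  by (induction us) auto

lemma fold_bad:
  "fold (\<lambda>v s. s\<lparr>bad_of := (bad_of s)(v := (\<Sum>u\<leftarrow>nb_of s v. if u \<in> U_of s \<and> C_of s u = C_of s v then 1 else 0 :: nat) > 0)\<rparr>) xs s
    = s\<lparr>bad_of := \<lambda>v. if v \<in> set xs then \<exists>u\<in>set (nb_of s v). u \<in> U_of s \<and> C_of s u = C_of s v else bad_of s v\<rparr>"
  unfolding indicator_sum_list_pos by (induction xs arbitrary: s) (auto simp: fun_eq_iff)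

lemma fold_reset:
  "distinct xs \<Longrightarrow> fold (\<lambda>v s. if bad_of s v \<or> C_of s v \<in> B_of s v then s\<lparr>C_of := (C_of s)(v := 0)\<rparr> else s) xs s
    = s\<lparr>C_of := \<lambda>v. if v \<in> set xs \<and> (bad_of s v \<or> C_of s v \<in> B_of s v) then 0 else C_of s v\<rparr>"
proof (induction xs arbitrary: s)
  case (Cons x xs)
  then show ?case
    by (cases s) (auto simp: fun_eq_iff)
qed simp

text \<open>The test is abstract because colors are forbidden in two places, by the neighbors in Q
  before SIM-COL starts and by the neighbors colored in a round. It must not depend on the sets
  being extended.\<close>

lemma fold_forbid_inner:
  "fold (\<lambda>u s. if Q u s then s\<lparr>B_of := (B_of s)(v := insert (C_of s u) (B_of s v))\<rparr> else s) us s
    = s\<lparr>B_of := (B_of s)(v := B_of s v \<union> C_of s ` {u \<in> set us. Q u s})\<rparr>"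
  if "\<And>u s B. Q u (s\<lparr>B_of := B\<rparr>) = Q u s"
proof (induction us arbitrary: s)
  case (Cons x us)
  have "{u \<in> set (x # us). Q u s} = (if Q x s then insert x {u \<in> set us. Q u s} else {u \<in> set us. Q u s})"
    by auto
  with Cons show ?case
    by (simp add: that insert_commute cong: if_cong)
qed simp

lemma fold_forbid:
  "fold (\<lambda>v s. s\<lparr>B_of := (B_of s)(v := B_of s v \<union> C_of s ` {u \<in> set (N v s). Q u s})\<rparr>) xs s
    = s\<lparr>B_of := \<lambda>v. if v \<in> set xs then B_of s v \<union> C_of s ` {u \<in> set (N v s). Q u s} else B_of s v\<rparr>"
  if "\<And>u s B. Q u (s\<lparr>B_of := B\<rparr>) = Q u s" "\<And>v s B. N v (s\<lparr>B_of := B\<rparr>) = N v s"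
  using that by (induction xs arbitrary: s) (auto simp: fun_eq_iff)

lemma fold_remove:
  "fold (\<lambda>v s. if C_of s v > 0 then s\<lparr>U_of := U_of s - {v}\<rparr> else s) xs s
    = s\<lparr>U_of := U_of s - {v \<in> set xs. C_of s v > 0}\<rparr>"
proof (induction xs arbitrary: s)
  case (Cons x xs)
  then show ?case
    by (cases s) auto
qed simp

text \<open>Once the colors are chosen the round is deterministic; splitting it off leaves a single
  source of randomness.\<close>

definition round_tail :: cmd where
  "round_tail =
     par_set U_of (\<lambda>v. reduce (\<lambda>s. nb_of s v)
       (\<lambda>s u. if u \<in> U_of s \<and> C_of s u = C_of s v then 1 else 0 :: nat)
       (\<lambda>x s. s\<lparr>bad_of := (bad_of s)(v := (x > 0))\<rparr>)) ;;
     par_set U_of (\<lambda>v. atomic (\<lambda>s.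
       if bad_of s v \<or> C_of s v \<in> B_of s v then s\<lparr>C_of := (C_of s)(v := 0)\<rparr> else s)) ;;
     par_set U_of (\<lambda>v. par_list (\<lambda>s. nb_of s v) (\<lambda>u. atomic (\<lambda>s.
       if u \<in> U_of s \<and> C_of s u > 0
       then s\<lparr>B_of := (B_of s)(v := insert (C_of s u) (B_of s v))\<rparr> else s))) ;;
     par_set U_of (\<lambda>v. atomic (\<lambda>s.
       if C_of s v > 0 then s\<lparr>U_of := U_of s - {v}\<rparr> else s))"

text \<open>The cost of later rounds depends on the surviving vertices and on the number of their
  forbidden colors, so the new colors and conflict flags may stay existential.\<close>

lemma runs_round_tail:
  fixes s f
  defines "F \<equiv> failed (B_of s) (\<lambda>v. set (nb_of s v)) (U_of s) f"
  assumes U: "finite (U_of s)" and f: "\<And>v. v \<in> U_of s \<Longrightarrow> f v > 0"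
    and k: "\<And>v. v \<in> U_of s \<Longrightarrow> length (nb_of s v) \<le> 2 ^ k"
  shows "\<exists>C bad. runs round_tail (s\<lparr>C_of := f\<rparr>)
    (s\<lparr>C_of := C, bad_of := bad, U_of := F,
       B_of := \<lambda>v. if v \<in> U_of s then B_of s v \<union> f ` (set (nb_of s v) \<inter> (U_of s - F)) else B_of s v\<rparr>)
    (4 + 4 * real (card (U_of s)) + 3 * (\<Sum>v\<in>U_of s. real (length (nb_of s v)))) (8 + 2 * real k)"
proof -
  define U nb B where defs: "U = U_of s" "nb = nb_of s" "B = B_of s"
  let ?xs = "sorted_list_of_set U"
  have xs: "set ?xs = U" "distinct ?xs"
    using U by (auto simp: defs)
  define bad where "bad = (\<lambda>v. if v \<in> U then \<exists>u\<in>set (nb v). u \<in> U \<and> f u = f v else bad_of s v)"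
  define C where "C = (\<lambda>v. if v \<in> F then 0 else f v)"
  define s1 where "s1 = s\<lparr>C_of := f\<rparr>"
  define s2 where "s2 = s1\<lparr>bad_of := bad\<rparr>"
  define s3 where "s3 = s2\<lparr>C_of := C\<rparr>"
  define s4 where "s4 = s3\<lparr>B_of := \<lambda>v. if v \<in> U then B v \<union> f ` (set (nb v) \<inter> (U - F)) else B v\<rparr>"
  define s5 where "s5 = s4\<lparr>U_of := F\<rparr>"
  note s_defs = s1_def s2_def s3_def s4_def s5_def
  have F: "F \<subseteq> U" "v \<in> F \<longleftrightarrow> v \<in> U \<and> (bad v \<or> f v \<in> B v)" for v
    by (auto simp: F_def failed_def defs bad_def)
  have r1: "runs (par_set U_of (\<lambda>v. reduce (\<lambda>s. nb_of s v)
       (\<lambda>s u. if u \<in> U_of s \<and> C_of s u = C_of s v then 1 else 0 :: nat)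
       (\<lambda>x s. s\<lparr>bad_of := (bad_of s)(v := (x > 0))\<rparr>))) s1 s2
       (1 + (\<Sum>v\<in>U. 2 * real (length (nb v)) + 1)) (1 + 2 * real k)"
  proof -
    have "runs (par_set U_of (\<lambda>v. reduce (\<lambda>s. nb_of s v)
       (\<lambda>s u. if u \<in> U_of s \<and> C_of s u = C_of s v then 1 else 0 :: nat)
       (\<lambda>x s. s\<lparr>bad_of := (bad_of s)(v := (x > 0))\<rparr>))) s1
       (fold (\<lambda>v s. s\<lparr>bad_of := (bad_of s)(v := (\<Sum>u\<leftarrow>nb_of s v. if u \<in> U_of s \<and> C_of s u = C_of s v then 1 else 0 :: nat) > 0)\<rparr>) ?xs s1)
       (1 + (\<Sum>v\<in>U. 2 * real (length (nb v)) + 1)) (1 + 2 * real k)"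
    proof (rule runs_par_set[where I = "\<lambda>s. nb_of s = nb"])
      fix v and s :: mem assume "v \<in> U" "nb_of s = nb"
      then show "runs (reduce (\<lambda>s. nb_of s v) (\<lambda>s u. if u \<in> U_of s \<and> C_of s u = C_of s v then 1 else 0 :: nat)
          (\<lambda>x s. s\<lparr>bad_of := (bad_of s)(v := (x > 0))\<rparr>)) s
          (s\<lparr>bad_of := (bad_of s)(v := (\<Sum>u\<leftarrow>nb_of s v. if u \<in> U_of s \<and> C_of s u = C_of s v then 1 else 0 :: nat) > 0)\<rparr>)
          (2 * real (length (nb v)) + 1) (2 * real k) \<and>
          nb_of (s\<lparr>bad_of := (bad_of s)(v := (\<Sum>u\<leftarrow>nb_of s v. if u \<in> U_of s \<and> C_of s u = C_of s v then 1 else 0 :: nat) > 0)\<rparr>) = nb"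
        using runs_reduce[of "\<lambda>s. nb_of s v" s k "\<lambda>s u. if u \<in> U_of s \<and> C_of s u = C_of s v then 1 else 0 :: nat"
            "\<lambda>x s. s\<lparr>bad_of := (bad_of s)(v := (x > 0))\<rparr>"] k[of v]
        by (simp add: defs)
    qed (use U in \<open>auto simp: defs s1_def\<close>)
    then show ?thesis
      unfolding fold_bad using xs by (simp add: s1_def s2_def bad_def defs cong: if_cong)
  qed
  have r2: "runs (par_set U_of (\<lambda>v. atomic (\<lambda>s.
       if bad_of s v \<or> C_of s v \<in> B_of s v then s\<lparr>C_of := (C_of s)(v := 0)\<rparr> else s))) s2 s3
       (1 + real (card U)) 1"
  proof -
    have "runs (par_set U_of (\<lambda>v. atomic (\<lambda>s.
       if bad_of s v \<or> C_of s v \<in> B_of s v then s\<lparr>C_of := (C_of s)(v := 0)\<rparr> else s))) s2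
       (fold (\<lambda>v s. if bad_of s v \<or> C_of s v \<in> B_of s v then s\<lparr>C_of := (C_of s)(v := 0)\<rparr> else s) ?xs s2)
       (1 + real (card U)) 1"
      by (rule runs_par_set_atomic) (use U in \<open>auto simp: defs s1_def s2_def\<close>)
    moreover have "C = (\<lambda>v. if v \<in> U \<and> (bad v \<or> f v \<in> B v) then 0 else f v)"
      by (auto simp: C_def F(2))
    ultimately show ?thesis
      unfolding fold_reset[OF xs(2)] using xs by (simp add: s1_def s2_def s3_def defs cong: if_cong)
  qed
  \<comment> \<open>Chosen colors are positive, so among the vertices of \<open>U\<close> a positive
    entry after the reset means success.\<close>
  have C_pos: "{u \<in> set (nb v). u \<in> U \<and> 0 < C u} = set (nb v) \<inter> (U - F)" for v
    using f by (auto simp: C_def defs)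
  have C_img: "C ` (set (nb v) \<inter> (U - F)) = f ` (set (nb v) \<inter> (U - F))" for v
    by (auto simp: C_def)
  have r3: "runs (par_set U_of (\<lambda>v. par_list (\<lambda>s. nb_of s v) (\<lambda>u. atomic (\<lambda>s.
       if u \<in> U_of s \<and> C_of s u > 0
       then s\<lparr>B_of := (B_of s)(v := insert (C_of s u) (B_of s v))\<rparr> else s)))) s3 s4
       (1 + (\<Sum>v\<in>U. 1 + real (length (nb v)))) (1 + 1)"
  proof -
    have "runs (par_set U_of (\<lambda>v. par_list (\<lambda>s. nb_of s v) (\<lambda>u. atomic (\<lambda>s.
       if u \<in> U_of s \<and> C_of s u > 0
       then s\<lparr>B_of := (B_of s)(v := insert (C_of s u) (B_of s v))\<rparr> else s)))) s3
       (fold (\<lambda>v s. s\<lparr>B_of := (B_of s)(v := B_of s v \<union> C_of s ` {u \<in> set (nb_of s v). u \<in> U_of s \<and> C_of s u > 0})\<rparr>) ?xs s3)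
       (1 + (\<Sum>v\<in>U. 1 + real (length (nb v)))) (1 + 1)"
    proof (rule runs_par_set[where I = "\<lambda>s. nb_of s = nb"])
      fix v and s :: mem assume "v \<in> U" "nb_of s = nb"
      then show "runs (par_list (\<lambda>s. nb_of s v) (\<lambda>u. atomic (\<lambda>s.
         if u \<in> U_of s \<and> C_of s u > 0
         then s\<lparr>B_of := (B_of s)(v := insert (C_of s u) (B_of s v))\<rparr> else s))) s
         (s\<lparr>B_of := (B_of s)(v := B_of s v \<union> C_of s ` {u \<in> set (nb_of s v). u \<in> U_of s \<and> C_of s u > 0})\<rparr>)
         (1 + real (length (nb v))) 1 \<and>
         nb_of (s\<lparr>B_of := (B_of s)(v := B_of s v \<union> C_of s ` {u \<in> set (nb_of s v). u \<in> U_of s \<and> C_of s u > 0})\<rparr>) = nb"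
        using runs_par_list_atomic[of "\<lambda>s. nb_of s v" "\<lambda>u s. if u \<in> U_of s \<and> C_of s u > 0
         then s\<lparr>B_of := (B_of s)(v := insert (C_of s u) (B_of s v))\<rparr> else s" s]
        by (subst (asm) fold_forbid_inner) auto
    qed (use U in \<open>auto simp: defs s_defs\<close>)
    moreover have "fold (\<lambda>v s. s\<lparr>B_of := (B_of s)(v := B_of s v \<union> C_of s ` {u \<in> set (nb_of s v). u \<in> U_of s \<and> C_of s u > 0})\<rparr>) ?xs s3 = s4"
    proof -
      have "U_of s3 = U" "nb_of s3 = nb" "C_of s3 = C" "B_of s3 = B"
        by (simp_all add: defs s_defs)
      then show ?thesis
        by (subst fold_forbid[where N = "\<lambda>v s. nb_of s v" and Q = "\<lambda>u s. u \<in> U_of s \<and> C_of s u > 0"])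
           (simp_all add: xs s4_def C_pos C_img cong: if_cong)
    qed
    ultimately show ?thesis
      by simp
  qed
  have r4: "runs (par_set U_of (\<lambda>v. atomic (\<lambda>s.
       if C_of s v > 0 then s\<lparr>U_of := U_of s - {v}\<rparr> else s))) s4 s5 (1 + real (card U)) 1"
  proof -
    have "runs (par_set U_of (\<lambda>v. atomic (\<lambda>s. if C_of s v > 0 then s\<lparr>U_of := U_of s - {v}\<rparr> else s))) s4
       (fold (\<lambda>v s. if C_of s v > 0 then s\<lparr>U_of := U_of s - {v}\<rparr> else s) ?xs s4) (1 + real (card U)) 1"
      by (rule runs_par_set_atomic) (use U in \<open>auto simp: defs s_defs\<close>)
    moreover have "U_of s4 = U" "C_of s4 = C"
      by (simp_all add: defs s_defs)
    moreover have "U - {v \<in> U. 0 < C v} = F"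
      using F(1) f by (auto simp: C_def defs)
    ultimately show ?thesis
      unfolding fold_remove using xs by (simp add: s5_def)
  qed
  have s5_eq: "s5 = s\<lparr>C_of := C, bad_of := bad, U_of := F,
       B_of := \<lambda>v. if v \<in> U_of s then B_of s v \<union> f ` (set (nb_of s v) \<inter> (U_of s - F)) else B_of s v\<rparr>"
    by (simp add: s_defs defs cong: if_cong)
  have sums: "(\<Sum>v\<in>U. 2 * real (length (nb v)) + 1) = 2 * (\<Sum>v\<in>U. real (length (nb v))) + real (card U)"
    "(\<Sum>v\<in>U. 1 + real (length (nb v))) = real (card U) + (\<Sum>v\<in>U. real (length (nb v)))"
    by (simp_all add: sum.distrib sum_distrib_left)
  have run: "runs round_tail s1 s5 (4 + 4 * real (card U) + 3 * (\<Sum>v\<in>U. real (length (nb v)))) (8 + 2 * real k)"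
    unfolding round_tail_def
    by (rule runs_mono[OF runs_seq[OF r1 runs_seq[OF r2 runs_seq[OF r3 r4]]]], unfold sums, linarith, linarith)
  show ?thesis
    by (intro exI) (rule run[unfolded s5_eq, unfolded s1_def defs])
qed


text \<open>The forbidden colors and the remaining neighbors of a vertex together never outnumber its degree, so
  in every round a color is in conflict with conditional probability at most \<open>1 / (1 + \<mu>)\<close>.\<close>

definition sim_inv :: "mem \<Rightarrow> mem \<Rightarrow> bool" where
  "sim_inv s0 s \<longleftrightarrow>
     nb_of s = nb_of s0 \<and> deg_of s = deg_of s0 \<and> R_of s = R_of s0 \<and> rho_of s = rho_of s0 \<and>
     lev_of s = lev_of s0 \<and> U_of s \<subseteq> U_of s0 \<and>
     (\<forall>v. v \<notin> U_of s0 \<longrightarrow> B_of s v = B_of s0 v) \<and>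
     (\<forall>v\<in>U_of s. finite (B_of s v) \<and>
        card (B_of s v) + card (set (nb_of s v) \<inter> U_of s) \<le> deg_of s v)"

text \<open>A neighbor that leaves \<open>U\<close> gives up its place among the remaining neighbors
  and adds at most one forbidden color.\<close>

lemma card_forbidden_step:
  assumes "finite B" "finite N" "F \<subseteq> U"
  shows "card (B \<union> f ` (N \<inter> (U - F))) + card (N \<inter> F) \<le> card B + card (N \<inter> U)"
proof -
  have "card (B \<union> f ` (N \<inter> (U - F))) \<le> card B + card (N \<inter> (U - F))"
    using assms by (intro order_trans[OF card_Un_le] add_left_mono card_image_le) auto
  moreover have "card (N \<inter> U) = card (N \<inter> (U - F)) + card (N \<inter> F)"
    using assms by (subst card_Un_disjoint[symmetric]) (auto intro: arg_cong[where f = card])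
  ultimately show ?thesis
    by simp
qed

lemma sim_col_round_alt: "sim_col_round \<mu> = (par_set U_of (choose_color \<mu>) ;; round_tail)"
  by (simp add: sim_col_round_def round_tail_def)

text \<open>\<open>s0\<close> is the memory at the start of the loop of SIM-COL and fixes the
  adjacency arrays; \<open>k\<close> controls the depth of a Reduce over one of them.\<close>

locale coloring_level =
  fixes \<mu> :: real and s0 :: mem and k :: nat
  assumes mu: "\<mu> > 1"
    and fin: "finite (U_of s0)"
    and len: "v \<in> U_of s0 \<Longrightarrow> length (nb_of s0 v) \<le> 2 ^ k"
    and irrefl: "v \<in> U_of s0 \<Longrightarrow> v \<notin> set (nb_of s0 v)"
begin

definition q where "q = 1 / (1 + \<mu>)"

lemma q: "0 < q" "2 * q < 1"
  using mu by (auto simp: q_def)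

text \<open>The arrays do not shrink while a level is colored, so a vertex pays for its whole array
  in every round it survives.\<close>

definition weight :: "nat \<Rightarrow> real" where
  "weight v = 1 + real (length (nb_of s0 v))"

definition new_failed :: "mem \<Rightarrow> (nat \<Rightarrow> nat) \<Rightarrow> nat set" where
  "new_failed s f = failed (B_of s) (\<lambda>v. set (nb_of s v)) (U_of s) f"

definition round_colorings :: "mem \<Rightarrow> (nat \<Rightarrow> nat) spmf" where
  "round_colorings s =
     colorings (\<lambda>v. palette \<mu> (deg_of s v)) (sorted_list_of_set (U_of s)) (C_of s)"

lemma sim_inv_finite: "sim_inv s0 s \<Longrightarrow> finite (U_of s)"
  using fin by (auto simp: sim_inv_def intro: finite_subset)

lemma sim_inv_palette:
  assumes "sim_inv s0 s" "v \<in> U_of s"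
  shows "finite (B_of s v)" "v \<notin> set (nb_of s v)"
    "real (card (B_of s v) + card (U_of s \<inter> set (nb_of s v))) \<le> q * real (card (palette \<mu> (deg_of s v)))"
proof -
  show "finite (B_of s v)" "v \<notin> set (nb_of s v)"
    using assms irrefl by (auto simp: sim_inv_def)
  have "real (card (B_of s v) + card (U_of s \<inter> set (nb_of s v))) \<le> real (deg_of s v)"
    using assms by (auto simp: sim_inv_def Int_commute)
  moreover have "real (deg_of s v) \<le> q * real (card (palette \<mu> (deg_of s v)))"
    using card_palette[of \<mu> "deg_of s v"] mu by (simp add: q_def field_simps)
  ultimately show "real (card (B_of s v) + card (U_of s \<inter> set (nb_of s v))) \<le> q * real (card (palette \<mu> (deg_of s v)))"
    by simp
qed

text \<open>Serves the potentials for work, depth and termination alike. Each is controlled on the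
  invariant by a function \<open>h\<close> of the set \<open>U\<close>, and the next value of
  \<open>U\<close> is the failed set.\<close>

lemma mgf_round:
  assumes inv: "sim_inv s0 s" and ne: "U_of s \<noteq> {}" and ab: "a \<ge> 0" "b \<ge> 0"
    and h: "\<And>s'. sim_inv s0 s' \<Longrightarrow> \<Phi> s' \<le> h (U_of s')"
  shows "mgf a b (sim_col_round \<mu> s) \<Phi> \<le>
    ennreal (exp (a * (10 * (\<Sum>v\<in>U_of s. weight v)) + b * (10 + 2 * real k))) *
    (\<integral>\<^sup>+f. h (new_failed s f) \<partial>measure_spmf (round_colorings s))"
proof -
  have fU: "finite (U_of s)" and sub: "U_of s \<subseteq> U_of s0"
    using sim_inv_finite[OF inv] inv by (auto simp: sim_inv_def)
  let ?w = "4 + 4 * real (card (U_of s)) + 3 * (\<Sum>v\<in>U_of s. real (length (nb_of s v)))"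
  have tail: "mgf a b (round_tail (s\<lparr>C_of := f\<rparr>)) \<Phi> \<le> ennreal (exp (a * ?w + b * (8 + 2 * real k))) * h (new_failed s f)"
    if f: "f \<in> set_spmf (round_colorings s)" for f
  proof -
    have fpos: "f v > 0" if "v \<in> U_of s" for v
    proof -
      have "f v \<in> palette \<mu> (deg_of s v)"
        using colorings_support[OF f[unfolded round_colorings_def]] that fU by (auto simp: finite_palette)
      then show ?thesis
        by (rule palette_pos)
    qed
    have "\<exists>C bad. runs round_tail (s\<lparr>C_of := f\<rparr>)
        (s\<lparr>C_of := C, bad_of := bad, U_of := new_failed s f,
           B_of := \<lambda>v. if v \<in> U_of s then B_of s v \<union> f ` (set (nb_of s v) \<inter> (U_of s - new_failed s f)) else B_of s v\<rparr>)
        ?w (8 + 2 * real k)"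
      unfolding new_failed_def
      by (rule runs_round_tail[OF fU fpos]) (use inv len sub in \<open>auto simp: sim_inv_def\<close>)
    then obtain C bad where r: "runs round_tail (s\<lparr>C_of := f\<rparr>)
        (s\<lparr>C_of := C, bad_of := bad, U_of := new_failed s f,
           B_of := \<lambda>v. if v \<in> U_of s then B_of s v \<union> f ` (set (nb_of s v) \<inter> (U_of s - new_failed s f)) else B_of s v\<rparr>)
        ?w (8 + 2 * real k)" (is "runs _ _ ?s' _ _")
      by blast
    have Fsub: "new_failed s f \<subseteq> U_of s"
      by (auto simp: new_failed_def failed_def)
    have "finite (B_of s v) \<and> card (B_of s v \<union> f ` (set (nb_of s v) \<inter> (U_of s - new_failed s f)))
        + card (set (nb_of s v) \<inter> new_failed s f) \<le> deg_of s v" if "v \<in> new_failed s f" for v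
      using card_forbidden_step[of "B_of s v" "set (nb_of s v)" "new_failed s f" "U_of s" f] that Fsub inv
      by (fastforce simp: sim_inv_def)
    then have inv': "sim_inv s0 ?s'"
      using inv Fsub sub unfolding sim_inv_def by auto
    have "mgf a b (round_tail (s\<lparr>C_of := f\<rparr>)) \<Phi> \<le> ennreal (exp (a * ?w + b * (8 + 2 * real k))) * \<Phi> ?s'"
      by (rule mgf_runs[OF r ab])
    also have "\<dots> \<le> ennreal (exp (a * ?w + b * (8 + 2 * real k))) * h (new_failed s f)"
      using h[OF inv'] by (intro mult_left_mono) auto
    finally show ?thesis .
  qed
  let ?I = "\<integral>\<^sup>+f. h (new_failed s f) \<partial>measure_spmf (round_colorings s)"
  have "mgf a b (sim_col_round \<mu> s) \<Phi> = ennreal (exp b) * (ennreal (exp (a * (1 + real (card (U_of s))) + b)) *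
      (\<integral>\<^sup>+f. mgf a b (round_tail (s\<lparr>C_of := f\<rparr>)) \<Phi> \<partial>measure_spmf (round_colorings s)))"
    unfolding sim_col_round_alt mgf_seq mgf_choose_colors[OF fU] round_colorings_def ..
  also have "\<dots> \<le> ennreal (exp b) * (ennreal (exp (a * (1 + real (card (U_of s))) + b)) *
      (\<integral>\<^sup>+f. ennreal (exp (a * ?w + b * (8 + 2 * real k))) * h (new_failed s f) \<partial>measure_spmf (round_colorings s)))"
    by (intro mult_left_mono nn_integral_mono_AE) (auto simp: AE_measure_spmf_iff tail)
  also have "\<dots> = ennreal (exp b) * (ennreal (exp (a * (1 + real (card (U_of s))) + b)) *
      (ennreal (exp (a * ?w + b * (8 + 2 * real k))) * ?I))"
    by (subst nn_integral_cmult) auto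
  also have "\<dots> = ennreal (exp (b + (a * (1 + real (card (U_of s))) + b) + (a * ?w + b * (8 + 2 * real k)))) * ?I"
    by (simp only: mult.assoc[symmetric] ennreal_mult[symmetric] exp_ge_zero exp_add[symmetric] mult_nonneg_nonneg add.assoc)
  also have "\<dots> \<le> ennreal (exp (a * (10 * (\<Sum>v\<in>U_of s. weight v)) + b * (10 + 2 * real k))) * ?I"
  proof -
    have "(\<Sum>v\<in>U_of s. weight v) = real (card (U_of s)) + (\<Sum>v\<in>U_of s. real (length (nb_of s v)))"
      using inv by (simp add: weight_def sum.distrib sim_inv_def)
    \<comment> \<open>\<open>U\<close> is nonempty, so the additive constants of the five loops are
      absorbed: 5 + 5 |U| is at most 10 |U|.\<close>
    moreover have "card (U_of s) \<ge> 1" "(\<Sum>v\<in>U_of s. real (length (nb_of s v))) \<ge> 0"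
      using ne fU by (auto simp: Suc_le_eq card_gt_0_iff intro: sum_nonneg)
    ultimately have "1 + real (card (U_of s)) + ?w \<le> 10 * (\<Sum>v\<in>U_of s. weight v)"
      by simp
    then have "a * (1 + real (card (U_of s)) + ?w) \<le> a * (10 * (\<Sum>v\<in>U_of s. weight v))"
      using ab by (intro mult_left_mono) auto
    then show ?thesis
      by (intro mult_right_mono ennreal_leI) (auto simp: algebra_simps)
  qed
  finally show ?thesis .
qed

lemma expected_prod_new_failed:
  assumes inv: "sim_inv s0 s" and a: "\<And>v. v \<in> U_of s \<Longrightarrow> a v \<ge> 1"
  shows "(\<integral>\<^sup>+f. ennreal (\<Prod>v\<in>new_failed s f. a v) \<partial>measure_spmf (round_colorings s))
    \<le> ennreal (\<Prod>v\<in>U_of s. 1 + q * ((a v)\<^sup>2 - 1))"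
proof -
  have xs: "set (sorted_list_of_set (U_of s)) = U_of s"
    using sim_inv_finite[OF inv] by simp
  have "(\<integral>\<^sup>+f. ennreal (\<Prod>v\<in>failed (B_of s) (\<lambda>v. set (nb_of s v)) (set (sorted_list_of_set (U_of s))) f. a v) \<partial>measure_spmf (round_colorings s))
    \<le> ennreal (\<Prod>v\<in>set (sorted_list_of_set (U_of s)). 1 + q * ((a v)\<^sup>2 - 1))"
    unfolding round_colorings_def
    by (rule expected_prod_failed)
       (use sim_inv_palette[OF inv] a q mu in \<open>auto simp: xs finite_palette palette_nonempty simp del: of_nat_add\<close>)
  then show ?thesis
    by (simp add: xs new_failed_def)
qed

lemma expected_card_new_failed:
  assumes inv: "sim_inv s0 s"
  shows "(\<integral>\<^sup>+f. ennreal (real (card (new_failed s f))) \<partial>measure_spmf (round_colorings s)) \<le> ennreal (2 * q * real (card (U_of s)))"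
proof -
  have fU: "finite (U_of s)"
    using sim_inv_finite[OF inv] .
  then have xs: "set (sorted_list_of_set (U_of s)) = U_of s"
    by simp
  have "(\<integral>\<^sup>+f. indicator (failed (B_of s) (\<lambda>v. set (nb_of s v)) (set (sorted_list_of_set (U_of s))) f) v \<partial>measure_spmf (round_colorings s)) \<le> ennreal (2 * q)"
    if "v \<in> U_of s" for v
    unfolding round_colorings_def
    by (rule prob_failed)
       (use sim_inv_palette[OF inv] q mu that in \<open>auto simp: xs finite_palette palette_nonempty simp del: of_nat_add\<close>)
  then have *: "(\<integral>\<^sup>+f. indicator (new_failed s f) v \<partial>measure_spmf (round_colorings s)) \<le> ennreal (2 * q)"
    if "v \<in> U_of s" for v
    using that by (simp add: xs new_failed_def)
  have "ennreal (real (card (new_failed s f))) = (\<Sum>v\<in>U_of s. indicator (new_failed s f) v)" for f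
  proof -
    have "new_failed s f \<subseteq> U_of s"
      by (auto simp: new_failed_def failed_def)
    then have "(\<Sum>v\<in>U_of s. indicator (new_failed s f) v :: ennreal) = of_nat (card (U_of s \<inter> new_failed s f))"
      using fU by (simp add: indicator_def sum.If_cases Int_def)
    then show ?thesis
      using \<open>new_failed s f \<subseteq> U_of s\<close> by (simp add: ennreal_of_nat_eq_real_of_nat Int_absorb1)
  qed
  then have "(\<integral>\<^sup>+f. ennreal (real (card (new_failed s f))) \<partial>measure_spmf (round_colorings s))
      = (\<Sum>v\<in>U_of s. \<integral>\<^sup>+f. indicator (new_failed s f) v \<partial>measure_spmf (round_colorings s))"
    by (simp add: nn_integral_sum)
  also have "\<dots> \<le> (\<Sum>v\<in>U_of s. ennreal (2 * q))"
    by (intro sum_mono *)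
  also have "\<dots> = ennreal (2 * q * real (card (U_of s)))"
    using q by (simp add: ennreal_of_nat_eq_real_of_nat ennreal_mult' mult_ac)
  finally show ?thesis .
qed

section \<open>Work, depth and termination of the loop of SIM-COL\<close>

abbreviation "coloring_loop \<equiv> while_cmd (\<lambda>s. U_of s \<noteq> {}) (sim_col_round \<mu>)"

text \<open>A round shrinks the exponential moment of the failed weight by the factor \<open>r\<close>, and
  \<open>\<alpha>\<close> solves \<open>11 + \<alpha> * r = \<alpha>\<close>: a round and its loop test cost at most 11 times the weight of \<open>U\<close>.\<close>

definition r where "r = 1 - (1 - 2 * q)\<^sup>2"
definition \<alpha> where "\<alpha> = 11 / (1 - r)"

lemma r: "0 < r" "r < 1"
  using q power_strict_mono[of "1 - 2 * q" 1 2] by (auto simp: r_def)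

lemma alpha: "\<alpha> > 0" "11 + \<alpha> * r = \<alpha>"
  using r by (auto simp: \<alpha>_def field_simps)

text \<open>In the potential, \<open>\<alpha>\<close> times the weight of \<open>U\<close> pays for
  this and all later rounds, and the added 1 for the final loop test. The condition on
  \<open>\<theta>\<close> bounds the exponent of each squared factor by the margin
  \<open>1 - 2 * q\<close>.\<close>

lemma mgf_coloring_loop_work:
  assumes inv: "sim_inv s0 s" and \<theta>: "\<theta> > 0" "\<And>v. v \<in> U_of s0 \<Longrightarrow> 2 * \<theta> * \<alpha> * weight v \<le> 1 - 2 * q"
  shows "mgf \<theta> 0 (coloring_loop s) (\<lambda>s. if sim_inv s0 s \<and> U_of s = {} then 1 else \<infinity>)
    \<le> ennreal (exp (\<theta> * (\<alpha> * (\<Sum>v\<in>U_of s. weight v) + 1)))"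
proof -
  define \<Phi> where "\<Phi> s = (if sim_inv s0 s then ennreal (exp (\<theta> * (\<alpha> * (\<Sum>v\<in>U_of s. weight v) + 1))) else \<infinity>)" for s
  have "mgf \<theta> 0 (coloring_loop s) (\<lambda>s. if sim_inv s0 s \<and> U_of s = {} then 1 else \<infinity>) \<le> \<Phi> s"
  proof (rule mgf_while)
    fix s :: mem assume ne: "U_of s \<noteq> {}"
    show "ennreal (exp (\<theta> + 2 * 0)) * mgf \<theta> 0 (sim_col_round \<mu> s) \<Phi> \<le> \<Phi> s"
    proof (cases "sim_inv s0 s")
      case True
      let ?W = "\<Sum>v\<in>U_of s. weight v"
      have fU: "finite (U_of s)"
        using sim_inv_finite[OF True] .
      define a where "a v = exp (\<theta> * \<alpha> * weight v)" for v
      have w1: "weight v \<ge> 1" for v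
        by (simp add: weight_def)
      have a1: "a v \<ge> 1" for v
        using \<theta>(1) alpha w1[of v] by (simp add: a_def)
      \<comment> \<open>This estimate determines \<open>r\<close>. With \<open>x\<close> at most 1 -
        2 q, the quadratic term of the exponential is at most x (1 - 2 q), and q (1 + (1 - 2 q)) is
        r / 2; the other half of x comes from the squaring.\<close>
      have factor: "1 + q * ((a v)\<^sup>2 - 1) \<le> exp (\<theta> * \<alpha> * r * weight v)" if "v \<in> U_of s" for v
      proof -
        define x where "x = 2 * \<theta> * \<alpha> * weight v"
        have x: "0 \<le> x" "x \<le> 1 - 2 * q"
          using \<theta>(2)[of v] that True \<theta>(1) alpha w1[of v] by (auto simp: x_def sim_inv_def)
        have "(a v)\<^sup>2 = exp x"
          by (simp add: a_def x_def exp_double[symmetric] mult_ac)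
        also have "\<dots> \<le> 1 + x + x\<^sup>2"
          using x q by (intro exp_bound) auto
        also have "\<dots> \<le> 1 + x + x * (1 - 2 * q)"
          using x by (simp add: power2_eq_square mult_left_mono)
        finally have "q * ((a v)\<^sup>2 - 1) \<le> q * (x + x * (1 - 2 * q))"
          using q by (intro mult_left_mono) auto
        also have "\<dots> = \<theta> * \<alpha> * r * weight v"
          by (simp add: x_def r_def power2_eq_square algebra_simps)
        finally show ?thesis
          using exp_ge_add_one_self[of "\<theta> * \<alpha> * r * weight v"] by linarith
      qed
      have "mgf \<theta> 0 (sim_col_round \<mu> s) \<Phi> \<le> ennreal (exp (\<theta> * (10 * ?W) + 0 * (10 + 2 * real k))) *
          (\<integral>\<^sup>+f. ennreal (exp \<theta>) * ennreal (\<Prod>v\<in>new_failed s f. a v) \<partial>measure_spmf (round_colorings s))"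
      proof (rule mgf_round[OF True ne])
        fix s' assume s': "sim_inv s0 s'"
        have "exp (\<theta> * (\<alpha> * (\<Sum>v\<in>U_of s'. weight v) + 1)) = exp \<theta> * (\<Prod>v\<in>U_of s'. a v)"
          using sim_inv_finite[OF s'] unfolding a_def
          by (simp add: exp_sum[symmetric] exp_add[symmetric] sum_distrib_left algebra_simps)
        then show "\<Phi> s' \<le> ennreal (exp \<theta>) * ennreal (\<Prod>v\<in>U_of s'. a v)"
          using s' by (simp add: \<Phi>_def ennreal_mult')
      qed (use \<theta>(1) in auto)
      also have "\<dots> \<le> ennreal (exp (\<theta> * (10 * ?W))) * (ennreal (exp \<theta>) * ennreal (\<Prod>v\<in>U_of s. 1 + q * ((a v)\<^sup>2 - 1)))"
        using expected_prod_new_failed[OF True a1]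
        by (subst nn_integral_cmult) (auto intro!: mult_left_mono)
      also have "\<dots> \<le> ennreal (exp (\<theta> * (10 * ?W))) * (ennreal (exp \<theta>) * ennreal (exp (\<theta> * \<alpha> * r * ?W)))"
      proof -
        have "(\<Prod>v\<in>U_of s. 1 + q * ((a v)\<^sup>2 - 1)) \<le> (\<Prod>v\<in>U_of s. exp (\<theta> * \<alpha> * r * weight v))"
          using factor a1 q by (intro prod_mono conjI add_nonneg_nonneg mult_nonneg_nonneg) (auto simp: one_le_power)
        also have "\<dots> = exp (\<theta> * \<alpha> * r * ?W)"
          using fU by (simp add: exp_sum[symmetric] sum_distrib_left)
        finally show ?thesis
          by (intro mult_left_mono ennreal_leI) auto
      qed
      also have "\<dots> = ennreal (exp (\<theta> * (10 * ?W) + (\<theta> + \<theta> * \<alpha> * r * ?W)))"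
        by (simp add: ennreal_mult'[symmetric] exp_add)
      finally have "ennreal (exp \<theta>) * mgf \<theta> 0 (sim_col_round \<mu> s) \<Phi> \<le>
          ennreal (exp \<theta>) * ennreal (exp (\<theta> * (10 * ?W) + (\<theta> + \<theta> * \<alpha> * r * ?W)))"
        by (rule mult_left_mono) simp
      also have "\<dots> = ennreal (exp (\<theta> + (\<theta> * (10 * ?W) + (\<theta> + \<theta> * \<alpha> * r * ?W))))"
        by (simp only: ennreal_mult'[symmetric] exp_ge_zero exp_add[symmetric])
      also have "\<dots> \<le> ennreal (exp (\<theta> * (\<alpha> * ?W + 1)))"
      proof -
        \<comment> \<open>As \<open>?W\<close> is at least 1, it also pays for the loop test: 1 + 10
          + \<alpha> r is exactly \<alpha>.\<close>
        have "(\<Sum>v\<in>U_of s. 1) \<le> ?W"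
          by (intro sum_mono w1)
        moreover have "card (U_of s) \<ge> 1"
          using ne fU by (simp add: Suc_le_eq card_gt_0_iff)
        ultimately have "?W \<ge> 1"
          by simp
        then have "1 + (10 * ?W + (1 + \<alpha> * r * ?W)) \<le> (11 + \<alpha> * r) * ?W + 1"
          by (simp add: algebra_simps)
        then have "\<theta> * (1 + (10 * ?W + (1 + \<alpha> * r * ?W))) \<le> \<theta> * (\<alpha> * ?W + 1)"
          unfolding alpha using \<theta>(1) by (intro mult_left_mono) auto
        then show ?thesis
          by (intro ennreal_leI) (simp add: algebra_simps)
      qed
      finally show ?thesis
        using True by (simp add: \<Phi>_def)
    qed (simp add: \<Phi>_def)
  qed (auto simp: \<Phi>_def)
  then show ?thesis
    using inv by (simp add: \<Phi>_def)
qed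

text \<open>\<open>\<beta>\<close> is the moment of a round together with the two loop edges. Only
  the mean number of failures is used, and it contracts by 2 q, so the potential is linear in |U|.
  Its slope makes \<beta> (1 + 2 q A u) \<le> 1 + A u an equality at u = 1, the worst nonempty
  case.\<close>

lemma mgf_coloring_loop_depth:
  assumes inv: "sim_inv s0 s" and b: "b \<ge> 0"
    and \<beta>: "\<beta> = exp (b * (12 + 2 * real k))" "2 * q * \<beta> < 1"
  shows "mgf 0 b (coloring_loop s) (\<lambda>s. if sim_inv s0 s \<and> U_of s = {} then 1 else \<infinity>)
    \<le> ennreal (1 + (\<beta> - 1) / (1 - 2 * q * \<beta>) * real (card (U_of s)))"
proof -
  define A where "A = (\<beta> - 1) / (1 - 2 * q * \<beta>)"
  have b1: "\<beta> \<ge> 1"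
    using b by (simp add: \<beta>(1))
  then have A: "A \<ge> 0" "A - 2 * q * \<beta> * A = \<beta> - 1"
  proof -
    have "A * (1 - 2 * q * \<beta>) = \<beta> - 1"
      using \<beta>(2) by (simp add: A_def)
    then show "A - 2 * q * \<beta> * A = \<beta> - 1"
      by (simp add: algebra_simps)
    show "A \<ge> 0"
      using \<beta>(2) b1 by (simp add: A_def)
  qed
  define \<Phi> where "\<Phi> s = (if sim_inv s0 s then ennreal (1 + A * real (card (U_of s))) else \<infinity>)" for s
  have "mgf 0 b (coloring_loop s) (\<lambda>s. if sim_inv s0 s \<and> U_of s = {} then 1 else \<infinity>) \<le> \<Phi> s"
  proof (rule mgf_while)
    fix s :: mem assume ne: "U_of s \<noteq> {}"
    show "ennreal (exp (0 + 2 * b)) * mgf 0 b (sim_col_round \<mu> s) \<Phi> \<le> \<Phi> s"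
    proof (cases "sim_inv s0 s")
      case True
      let ?M = "measure_spmf (round_colorings s)" and ?n = "real (card (U_of s))"
      have fU: "finite (U_of s)"
        using sim_inv_finite[OF True] .
      then have n1: "?n \<ge> 1"
        using ne by (simp add: Suc_le_eq card_gt_0_iff)
      have "mgf 0 b (sim_col_round \<mu> s) \<Phi> \<le> ennreal (exp (0 * (10 * (\<Sum>v\<in>U_of s. weight v)) + b * (10 + 2 * real k))) *
          (\<integral>\<^sup>+f. 1 + ennreal A * ennreal (real (card (new_failed s f))) \<partial>?M)"
        by (rule mgf_round[OF True ne]) (use b A in \<open>auto simp: \<Phi>_def ennreal_mult'\<close>)
      also have "(\<integral>\<^sup>+f. 1 + ennreal A * ennreal (real (card (new_failed s f))) \<partial>?M) \<le> 1 + ennreal A * ennreal (2 * q * ?n)"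
      proof (subst nn_integral_add)
        have "(\<integral>\<^sup>+f. 1 \<partial>?M) \<le> 1"
          by (simp add: measure_spmf.emeasure_space_le_1)
        moreover have "(\<integral>\<^sup>+f. ennreal A * ennreal (real (card (new_failed s f))) \<partial>?M) \<le> ennreal A * ennreal (2 * q * ?n)"
          using expected_card_new_failed[OF True] by (subst nn_integral_cmult) (auto intro!: mult_left_mono)
        ultimately show "(\<integral>\<^sup>+f. 1 \<partial>?M) + (\<integral>\<^sup>+f. ennreal A * ennreal (real (card (new_failed s f))) \<partial>?M)
            \<le> 1 + ennreal A * ennreal (2 * q * ?n)"
          by (rule add_mono)
      qed auto
      also have "\<dots> = ennreal (1 + A * (2 * q * ?n))"
        using A q by (simp add: ennreal_mult')
      finally have "mgf 0 b (sim_col_round \<mu> s) \<Phi> \<le> ennreal (exp (b * (10 + 2 * real k))) * ennreal (1 + A * (2 * q * ?n))"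
        by (simp add: mult_left_mono)
      then have "ennreal (exp (2 * b)) * mgf 0 b (sim_col_round \<mu> s) \<Phi> \<le>
          ennreal (exp (2 * b)) * (ennreal (exp (b * (10 + 2 * real k))) * ennreal (1 + A * (2 * q * ?n)))"
        by (rule mult_left_mono) simp
      also have "\<dots> = ennreal (\<beta> * (1 + A * (2 * q * ?n)))"
        using A q by (simp only: \<beta>(1) ennreal_mult'[symmetric] mult.assoc[symmetric] exp_ge_zero exp_add[symmetric] mult_nonneg_nonneg)
          (simp add: algebra_simps)
      also have "\<dots> \<le> ennreal (1 + A * ?n)"
      proof (rule ennreal_leI)
        have "(\<beta> - 1) * 1 \<le> (A - 2 * q * \<beta> * A) * ?n"
          unfolding A(2) using b1 n1 by (intro mult_left_mono) auto
        then show "\<beta> * (1 + A * (2 * q * ?n)) \<le> 1 + A * ?n"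
          by (simp add: algebra_simps)
      qed
      finally show ?thesis
        using True by (simp add: \<Phi>_def)
    qed (simp add: \<Phi>_def)
  qed (auto simp: \<Phi>_def)
  then show ?thesis
    using inv by (simp add: \<Phi>_def A_def)
qed

text \<open>|U| itself is a ranking potential: at least 1 while the loop runs, and contracted in the
  mean by 2 q.\<close>

lemma lossless_coloring_loop:
  assumes "sim_inv s0 s"
  shows "lossless_spmf (coloring_loop s)"
proof (rule lossless_while)
  let ?V = "\<lambda>s. if sim_inv s0 s then ennreal (real (card (U_of s))) else \<infinity>"
  show "?V s < \<infinity>"
    using assms by simp
  show "lossless_spmf (sim_col_round \<mu> s)" for s
    unfolding sim_col_round_def using mu
    by (intro lossless_seq lossless_par_set lossless_atomic lossless_reduce lossless_par_list)
       (auto simp: choose_color_def finite_palette palette_nonempty)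
  fix s :: mem assume ne: "U_of s \<noteq> {}"
  show "?V s \<ge> 1"
    using ne sim_inv_finite[of s] by (auto simp: Suc_le_eq card_gt_0_iff)
  assume "?V s < \<infinity>"
  then have inv: "sim_inv s0 s"
    by (auto split: if_splits)
  have "mgf 0 0 (sim_col_round \<mu> s) ?V \<le> ennreal (exp (0 * (10 * (\<Sum>v\<in>U_of s. weight v)) + 0 * (10 + 2 * real k))) *
      (\<integral>\<^sup>+f. ennreal (real (card (new_failed s f))) \<partial>measure_spmf (round_colorings s))"
    by (rule mgf_round[OF inv ne]) auto
  also have "\<dots> \<le> ennreal (2 * q * real (card (U_of s)))"
    using expected_card_new_failed[OF inv] by simp
  also have "\<dots> = ennreal (2 * q) * ?V s"
    using inv q by (simp add: ennreal_mult')
  finally show "mgf 0 0 (sim_col_round \<mu> s) ?V \<le> ennreal (2 * q) * ?V s" .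
qed (use q in auto)

end

section \<open>ADG\<close>

lemma runs_while_exit: "\<not> b s \<Longrightarrow> runs (while_cmd b p) s s 1 0"
  by (simp add: runs_def while_cmd.simps)

lemma runs_while_step:
  assumes "b s" "runs p s s1 w1 d1" "runs (while_cmd b p) s1 s2 w2 d2"
  shows "runs (while_cmd b p) s s2 (1 + w1 + w2) (2 + d1 + d2)"
proof -
  obtain t1 t2 where t: "p s = return_spmf (s1, t1)" "real (work t1) \<le> w1" "real (dep t1) \<le> d1"
    "while_cmd b p s1 = return_spmf (s2, t2)" "real (work t2) \<le> w2" "real (dep t2) \<le> d2"
    using assms(2,3) by (auto simp: runs_def)
  then have "while_cmd b p s = return_spmf (s2, Seq Op (Seq t1 t2))"
    using assms(1) by (subst while_cmd.simps) simp
  with t show ?thesis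
    by (auto simp: runs_def)
qed

section \<open>Counting edges inside vertex sets\<close>

locale csr_graph =
  fixes n :: nat and E :: "nat set set" and G :: csr
  assumes graph: "simple_graph {..<n} E" and csr: "csr_of n E G"
begin

lemma edge: "e \<in> E \<Longrightarrow> e \<subseteq> {..<n} \<and> card e = 2"
  using graph by (auto simp: simple_graph_def)

lemma finite_E: "finite E"
  by (rule finite_subset[of _ "Pow {..<n}"]) (use edge in auto)

lemma no_loop: "{v, v} \<notin> E"
  using edge[of "{v, v}"] by auto

lemma distinct_nbrs: "v < n \<Longrightarrow> distinct (nbrs G v)"
  using csr by (auto simp: csr_of_def)

lemma set_nbrs: "v < n \<Longrightarrow> set (nbrs G v) = nbhd E {..<n} v"
  using csr by (auto simp: csr_of_def)

lemma length_nbrs: "v < n \<Longrightarrow> length (nbrs G v) = card (nbhd E {..<n} v)"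
  using distinct_card[OF distinct_nbrs] set_nbrs by metis

lemma length_nbrs_le: "v < n \<Longrightarrow> length (nbrs G v) \<le> n"
  unfolding length_nbrs using card_mono[of "{..<n}" "nbhd E {..<n} v"] by (auto simp: nbhd_def)

lemma finite_nbhd: "finite U \<Longrightarrow> finite (nbhd E U v)"
  by (simp add: nbhd_def)

lemma csr_off_diff:
  assumes "v < n"
  shows "int (csr_off G ! Suc v) - int (csr_off G ! v) = int (card (nbhd E {..<n} v))"
proof -
  have "csr_off G ! v \<le> csr_off G ! Suc v"
    using csr assms by (auto simp: csr_of_def intro: sorted_nth_mono)
  then show ?thesis
    using length_nbrs[OF assms] by (simp add: nbrs_def)
qed

lemma sum_card_nbhd_le_edges:
  assumes "U \<subseteq> {..<n}"
  shows "(\<Sum>u\<in>U. card (nbhd E U u)) \<le> 2 * card E"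
proof -
  have fU: "finite U"
    using assms finite_subset by blast
  let ?S = "SIGMA u:U. nbhd E U u"
  \<comment> \<open>An ordered adjacent pair is coded by its edge and one bit for the direction;
    this is injective because there are no loops.\<close>
  let ?f = "\<lambda>(u, w). ({w, u}, u < w)"
  have "inj_on ?f ?S"
  proof (rule inj_onI, clarify)
    fix u w u' w' assume "{w, u} = {w', u'}" "(u < w) = (u' < w')" "w \<in> nbhd E U u"
    then show "u = u' \<and> w = w'"
      using no_loop by (auto simp: doubleton_eq_iff nbhd_def) 
  qed
  moreover have "?f ` ?S \<subseteq> E \<times> UNIV"
    by (auto simp: nbhd_def)
  ultimately have "card ?S \<le> card (E \<times> (UNIV :: bool set))"
    using finite_E by (intro card_inj_on_le) auto
  moreover have "card ?S = (\<Sum>u\<in>U. card (nbhd E U u))"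
    using fU by (simp add: finite_nbhd)
  ultimately show ?thesis
    by (simp add: card_cartesian_product)
qed

text \<open>The \<open>LEAST\<close> in the definition is attained, since \<open>n\<close> is an
  admissible value.\<close>

lemma degeneracy_property:
  assumes "W \<subseteq> {..<n}" "W \<noteq> {}"
  shows "\<exists>v\<in>W. card (nbhd E W v) \<le> degeneracy {..<n} E"
proof -
  have "\<forall>W. W \<subseteq> {..<n} \<and> W \<noteq> {} \<longrightarrow> (\<exists>v\<in>W. card (nbhd E W v) \<le> n)"
  proof (intro allI impI, elim conjE)
    fix W :: "nat set" assume W: "W \<subseteq> {..<n}" "W \<noteq> {}"
    have "card (nbhd E W v) \<le> card {..<n}" for v
      using W by (intro card_mono) (auto simp: nbhd_def)
    then show "\<exists>v\<in>W. card (nbhd E W v) \<le> n"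
      using W by auto
  qed
  from LeastI[where P = "\<lambda>s. \<forall>W. W \<subseteq> {..<n} \<and> W \<noteq> {} \<longrightarrow> (\<exists>v\<in>W. card (nbhd E W v) \<le> s)", OF this]
  show ?thesis
    using assms unfolding degeneracy_def by blast
qed

text \<open>Peel off a vertex of degree at most the degeneracy. The degree sum drops by twice its
  degree, once at the vertex and once over its neighbors.\<close>

lemma sum_card_nbhd_le_degeneracy:
  assumes "U \<subseteq> {..<n}"
  shows "(\<Sum>u\<in>U. card (nbhd E U u)) \<le> 2 * degeneracy {..<n} E * card U"
  using assms
proof (induction "card U" arbitrary: U)
  case 0
  then show ?case
    using finite_subset[OF 0(2)] by simp
next
  case (Suc N)
  have fU: "finite U"
    using Suc.prems finite_subset by blast
  have "U \<noteq> {}"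
    using Suc.hyps(2) by auto
  from degeneracy_property[OF Suc.prems this]
  obtain v where v: "v \<in> U" "card (nbhd E U v) \<le> degeneracy {..<n} E"
    by blast
  let ?U = "U - {v}"
  have "card (nbhd E U u) = card (nbhd E ?U u) + of_bool ({v, u} \<in> E)" if "u \<in> ?U" for u
  proof -
    have "nbhd E U u = nbhd E ?U u \<union> (if {v, u} \<in> E then {v} else {})"
      using v(1) by (auto simp: nbhd_def)
    moreover have "v \<notin> nbhd E ?U u"
      by (simp add: nbhd_def)
    ultimately show ?thesis
      using fU by (auto simp: finite_nbhd)
  qed
  then have "(\<Sum>u\<in>?U. card (nbhd E U u)) = (\<Sum>u\<in>?U. card (nbhd E ?U u)) + (\<Sum>u\<in>?U. of_bool ({v, u} \<in> E))"
    by (simp add: sum.distrib)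
  also have "(\<Sum>u\<in>?U. of_bool ({v, u} \<in> E)) = card (nbhd E U v)"
  proof -
    have "nbhd E U v = ?U \<inter> {u. {v, u} \<in> E}"
      using no_loop[of v] by (auto simp: nbhd_def insert_commute)
    then show ?thesis
      using fU by (simp add: sum.If_cases of_bool_def)
  qed
  finally have "(\<Sum>u\<in>U. card (nbhd E U u)) = (\<Sum>u\<in>?U. card (nbhd E ?U u)) + 2 * card (nbhd E U v)"
    using fU v(1) by (simp add: sum.remove)
  also have "\<dots> \<le> 2 * degeneracy {..<n} E * card ?U + 2 * degeneracy {..<n} E"
    using Suc.hyps v Suc.prems fU by (intro add_mono Suc.hyps(1)) auto
  also have "\<dots> = 2 * degeneracy {..<n} E * card U"
    using v(1) fU Suc.hyps(2) by (simp add: algebra_simps)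
  finally show ?case .
qed

end

section \<open>Closed forms of the loops of ADG\<close>

lemma fold_init_vertices:
  "fold (\<lambda>v s. s\<lparr>U_of := insert v (U_of s), D_of := (D_of s)(v := h v)\<rparr>) xs s
    = s\<lparr>U_of := U_of s \<union> set xs, D_of := \<lambda>v. if v \<in> set xs then h v else D_of s v\<rparr>"
proof (induction xs arbitrary: s)
  case (Cons x xs)
  then show ?case
    by (cases s) (auto simp: fun_eq_iff)
qed simp

lemma fold_select:
  "fold (\<lambda>u s. if of_int (D_of s u) \<le> (1 + \<eta>) * avg_of s
       then s\<lparr>R_of := (R_of s)(lev_of s := insert u (R_of s (lev_of s)))\<rparr> else s) xs s
    = s\<lparr>R_of := (R_of s)(lev_of s := R_of s (lev_of s) \<union> {u \<in> set xs. of_int (D_of s u) \<le> (1 + \<eta>) * avg_of s})\<rparr>"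
proof (induction xs arbitrary: s)
  case (Cons x xs)
  have "{u \<in> set (x # xs). of_int (D_of s u) \<le> (1 + \<eta>) * avg_of s} =
      (if of_int (D_of s x) \<le> (1 + \<eta>) * avg_of s then insert x {u \<in> set xs. of_int (D_of s u) \<le> (1 + \<eta>) * avg_of s}
       else {u \<in> set xs. of_int (D_of s u) \<le> (1 + \<eta>) * avg_of s})"
    by auto
  with Cons show ?case
    by (simp add: insert_commute cong: if_cong)
qed simp

text \<open>Multiplicities let the nested loops compose for arbitrary lists; for adjacency arrays
  they become 0 or 1.\<close>

lemma fold_decrement_inner:
  "fold (\<lambda>u s. if u \<in> U_of s then s\<lparr>D_of := (D_of s)(u := D_of s u - 1)\<rparr> else s) us s
    = s\<lparr>D_of := \<lambda>u. if u \<in> U_of s then D_of s u - int (count_list us u) else D_of s u\<rparr>"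
proof (induction us arbitrary: s)
  case (Cons x us)
  then show ?case
    by (cases s) (auto simp: fun_eq_iff)
qed (simp cong: if_cong)

lemma count_list_distinct: "distinct xs \<Longrightarrow> count_list xs x = of_bool (x \<in> set xs)"
  by (induction xs) auto

lemma fold_decrement:
  "fold (\<lambda>v s. s\<lparr>D_of := \<lambda>u. if u \<in> U_of s then D_of s u - int (c v u) else D_of s u\<rparr>) xs s
    = s\<lparr>D_of := \<lambda>u. if u \<in> U_of s then D_of s u - int (\<Sum>v\<leftarrow>xs. c v u) else D_of s u\<rparr>"
proof (induction xs arbitrary: s)
  case (Cons x xs)
  then show ?case
    by (cases s) (auto simp: fun_eq_iff)
qed (simp cong: if_cong)

lemma fold_close_level:
  "fold (\<lambda>v s. s\<lparr>U_of := U_of s - {v}, rho_of := (rho_of s)(v := lev_of s)\<rparr>) xs s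
    = s\<lparr>U_of := U_of s - set xs, rho_of := \<lambda>v. if v \<in> set xs then lev_of s else rho_of s v\<rparr>"
proof (induction xs arbitrary: s)
  case (Cons x xs)
  then show ?case
    by (cases s) (auto simp: fun_eq_iff)
qed simp

lemma fold_record_inner:
  "fold (\<lambda>u s. if rho_of s u = lev_of s then s\<lparr>nb_of := (nb_of s)(v := nb_of s v @ [u])\<rparr> else s) us s
    = s\<lparr>nb_of := (nb_of s)(v := nb_of s v @ filter (\<lambda>u. rho_of s u = lev_of s) us)\<rparr>"
proof (induction us arbitrary: s)
  case (Cons x us)
  then show ?case
    by (cases s) (auto simp: fun_eq_iff)
qed simp

lemma fold_record:
  "distinct xs \<Longrightarrow> fold (\<lambda>v s. s\<lparr>nb_of := (nb_of s)(v := nb_of s v @ filter (\<lambda>u. rho_of s u = lev_of s) (N v))\<rparr>) xs s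
    = s\<lparr>nb_of := \<lambda>v. if v \<in> set xs then nb_of s v @ filter (\<lambda>u. rho_of s u = lev_of s) (N v) else nb_of s v\<rparr>"
proof (induction xs arbitrary: s)
  case (Cons x xs)
  then show ?case
    by (cases s) (auto simp: fun_eq_iff)
qed simp

section \<open>Invariant and cost of ADG\<close>

locale dec_adg_run = csr_graph +
  fixes \<eta> :: real and k :: nat
  assumes eta: "\<eta> > 0" and n_le: "n \<le> 2 ^ k"
begin

abbreviation "degen \<equiv> degeneracy {..<n} E"

text \<open>Levels start at 1, and 0 in \<open>rho_of\<close> marks a vertex that is not yet placed.
  Of the two bounds on the recorded arrays, the one by the degeneracy limits the depth of a Reduce
  inside a level; the one by the number of edges, squared to avoid roots, limits the weights in the
  work moment.\<close>

definition adg_inv :: "mem \<Rightarrow> bool" where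
  "adg_inv s \<longleftrightarrow>
     U_of s = {v. v < n \<and> rho_of s v = 0} \<and> lev_of s \<ge> 1 \<and>
     (\<forall>u\<in>U_of s. D_of s u = int (card (nbhd E (U_of s) u))) \<and>
     R_of s = (\<lambda>i. if i = 0 then {} else {v. rho_of s v = i}) \<and>
     (\<forall>v. rho_of s v < lev_of s \<and> (rho_of s v > 0 \<longrightarrow> v < n)) \<and>
     nb_of s = (\<lambda>v. if rho_of s v = 0 then [] else filter (\<lambda>u. rho_of s u = rho_of s v) (nbrs G v)) \<and>
     (\<forall>v. real (length (nb_of s v)) \<le> (1 + \<eta>) * (2 * real degen) \<and>
          (real (length (nb_of s v)))\<^sup>2 \<le> (1 + \<eta>)\<^sup>2 * (2 * real (card E)))"

definition adg_body :: cmd where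
  "adg_body = (adg_iteration \<eta> G ;; record_partition G ;; atomic (\<lambda>s. s\<lparr>lev_of := lev_of s + 1\<rparr>))"

text \<open>Adjacency arrays are charged to the vertices that leave \<open>U\<close>, which happens
  once per vertex. Everything else is proportional to |U|, which shrinks geometrically.\<close>

lemma adg_body_step:
  assumes inv: "adg_inv s" and ne: "U_of s \<noteq> {}"
  shows "\<exists>s'. runs adg_body s s'
      (16 * real (card (U_of s)) + 2 * (\<Sum>v\<in>U_of s - U_of s'. real (length (nbrs G v)))) (4 * real k + 13) \<and>
    adg_inv s' \<and> U_of s' \<subset> U_of s \<and> (1 + \<eta>) * real (card (U_of s')) \<le> real (card (U_of s)) \<and>
    lev_of s' = lev_of s + 1 \<and> B_of s' = B_of s"
proof -
  define U where "U = U_of s"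
  define l where "l = lev_of s"
  have U_eq: "U = {v. v < n \<and> rho_of s v = 0}" and l: "l \<ge> 1"
    and rho: "\<And>v. rho_of s v < l" "\<And>v. rho_of s v > 0 \<Longrightarrow> v < n"
    and R_eq: "R_of s = (\<lambda>i. if i = 0 then {} else {v. rho_of s v = i})"
    and D_eq: "\<And>u. u \<in> U \<Longrightarrow> D_of s u = int (card (nbhd E U u))"
    and nb_eq: "nb_of s = (\<lambda>v. if rho_of s v = 0 then [] else filter (\<lambda>u. rho_of s u = rho_of s v) (nbrs G v))"
    and nb_le: "\<And>v. real (length (nb_of s v)) \<le> (1 + \<eta>) * (2 * real degen)"
      "\<And>v. (real (length (nb_of s v)))\<^sup>2 \<le> (1 + \<eta>)\<^sup>2 * (2 * real (card E))"
    using inv unfolding adg_inv_def U_def l_def by blast+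
  have Usub: "U \<subseteq> {..<n}" and fU: "finite U" and Une: "U \<noteq> {}"
    using ne by (auto simp: U_eq U_def[symmetric])
  have cU: "card U \<ge> 1"
    using fU Une by (simp add: Suc_le_eq card_gt_0_iff)
  have cUn: "card U \<le> 2 ^ k"
    using card_mono[OF _ Usub] n_le by simp
  let ?xs = "sorted_list_of_set U"
  have xs: "set ?xs = U" "distinct ?xs" "length ?xs = card U"
    using fU by auto
  have l_new: "R_of s l = {}"
    using rho(1) l by (auto simp: R_eq)
  define SD where "SD = (\<Sum>u\<in>U. D_of s u)"
  define avg where "avg = real_of_int SD / real (card U)"
  define R where "R = {u \<in> U. of_int (D_of s u) \<le> (1 + \<eta>) * avg}"
  have RU: "R \<subseteq> U" and fR: "finite R"
    using fU by (auto simp: R_def)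
  let ?rs = "sorted_list_of_set R"
  have rs: "set ?rs = R" "distinct ?rs"
    using fR by auto
  define s1 where "s1 = s\<lparr>sum_of := SD\<rparr>"
  define s2 where "s2 = s1\<lparr>cnt_of := card U\<rparr>"
  define s3 where "s3 = s2\<lparr>avg_of := avg\<rparr>"
  define s4 where "s4 = s3\<lparr>R_of := (R_of s)(l := R)\<rparr>"
  define s5 where "s5 = s4\<lparr>D_of := \<lambda>u. if u \<in> U then D_of s u - int (\<Sum>v\<leftarrow>?rs. count_list (nbrs G v) u) else D_of s u\<rparr>"
  define rho' where "rho' = (\<lambda>v. if v \<in> R then l else rho_of s v)"
  define s6 where "s6 = s5\<lparr>U_of := U - R, rho_of := rho'\<rparr>"
  define nb' where "nb' = (\<lambda>v. if v \<in> R then nb_of s v @ filter (\<lambda>u. rho' u = l) (nbrs G v) else nb_of s v)"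
  define s7 where "s7 = s6\<lparr>nb_of := nb'\<rparr>"
  define s8 where "s8 = s7\<lparr>lev_of := l + 1\<rparr>"
  note s_defs = s1_def s2_def s3_def s4_def s5_def s6_def s7_def s8_def
  have r1: "runs (reduce (\<lambda>s. sorted_list_of_set (U_of s)) D_of (\<lambda>x s. s\<lparr>sum_of := x\<rparr>)) s s1 (2 * real (card U) + 1) (2 * real k)"
    using runs_reduce[of "\<lambda>s. sorted_list_of_set (U_of s)" s k D_of "\<lambda>x s. s\<lparr>sum_of := x\<rparr>"] cUn fU
    by (simp add: s1_def U_def SD_def sum_list_distinct_conv_sum_set)
  have r2: "runs (reduce (\<lambda>s. sorted_list_of_set (U_of s)) (\<lambda>_ _. 1) (\<lambda>x s. s\<lparr>cnt_of := x\<rparr>)) s1 s2 (2 * real (card U) + 1) (2 * real k)"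
    using runs_reduce[of "\<lambda>s. sorted_list_of_set (U_of s)" s1 k "\<lambda>_ _. 1" "\<lambda>x s. s\<lparr>cnt_of := x\<rparr>"] cUn fU
    by (simp add: s1_def s2_def U_def sum_list_triv)
  have r3: "runs (atomic (\<lambda>s. s\<lparr>avg_of := of_int (sum_of s) / of_nat (cnt_of s)\<rparr>)) s2 s3 1 0"
    using runs_atomic[of "\<lambda>s. s\<lparr>avg_of := of_int (sum_of s) / of_nat (cnt_of s)\<rparr>" s2]
    by (simp add: s3_def avg_def) (simp add: s2_def s1_def)
  have r4: "runs (par_set U_of (\<lambda>u. atomic (\<lambda>s.
       if of_int (D_of s u) \<le> (1 + \<eta>) * avg_of s
       then s\<lparr>R_of := (R_of s)(lev_of s := insert u (R_of s (lev_of s)))\<rparr> else s))) s3 s4 (1 + real (card U)) 1"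
  proof -
    have "runs (par_set U_of (\<lambda>u. atomic (\<lambda>s.
       if of_int (D_of s u) \<le> (1 + \<eta>) * avg_of s
       then s\<lparr>R_of := (R_of s)(lev_of s := insert u (R_of s (lev_of s)))\<rparr> else s))) s3
       (fold (\<lambda>u s. if of_int (D_of s u) \<le> (1 + \<eta>) * avg_of s
       then s\<lparr>R_of := (R_of s)(lev_of s := insert u (R_of s (lev_of s)))\<rparr> else s) ?xs s3) (1 + real (card U)) 1"
      by (rule runs_par_set_atomic) (use fU in \<open>simp_all add: s_defs U_def\<close>)
    moreover have "R_of s3 = R_of s" "lev_of s3 = l" "avg_of s3 = avg" "D_of s3 = D_of s"
      by (simp_all add: s_defs l_def)
    ultimately show ?thesis
      unfolding fold_select by (simp add: s4_def R_def l_new xs)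
  qed
  have R4: "R_of s4 (lev_of s4) = R"
    by (simp add: s_defs l_def)
  have r5: "runs (par_set (\<lambda>s. R_of s (lev_of s)) (\<lambda>v. par_list (\<lambda>_. nbrs G v) (\<lambda>u. atomic (\<lambda>s.
       if u \<in> U_of s then s\<lparr>D_of := (D_of s)(u := D_of s u - 1)\<rparr> else s)))) s4 s5
       (1 + (\<Sum>v\<in>R. 1 + real (length (nbrs G v)))) (1 + 1)"
  proof -
    have "runs (par_set (\<lambda>s. R_of s (lev_of s)) (\<lambda>v. par_list (\<lambda>_. nbrs G v) (\<lambda>u. atomic (\<lambda>s.
       if u \<in> U_of s then s\<lparr>D_of := (D_of s)(u := D_of s u - 1)\<rparr> else s)))) s4
       (fold (\<lambda>v s. s\<lparr>D_of := \<lambda>u. if u \<in> U_of s then D_of s u - int (count_list (nbrs G v) u) else D_of s u\<rparr>) ?rs s4)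
       (1 + (\<Sum>v\<in>R. 1 + real (length (nbrs G v)))) (1 + 1)"
    proof (rule runs_par_set[where I = "\<lambda>_. True"])
      fix v and s :: mem
      show "runs (par_list (\<lambda>_. nbrs G v) (\<lambda>u. atomic (\<lambda>s. if u \<in> U_of s then s\<lparr>D_of := (D_of s)(u := D_of s u - 1)\<rparr> else s))) s
         (s\<lparr>D_of := \<lambda>u. if u \<in> U_of s then D_of s u - int (count_list (nbrs G v) u) else D_of s u\<rparr>)
         (1 + real (length (nbrs G v))) 1 \<and> True"
        using runs_par_list_atomic[of "\<lambda>_. nbrs G v" "\<lambda>u s. if u \<in> U_of s then s\<lparr>D_of := (D_of s)(u := D_of s u - 1)\<rparr> else s" s]
        unfolding fold_decrement_inner by simp
    qed (use fR R4 in simp_all)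
    moreover have "U_of s4 = U" "D_of s4 = D_of s"
      by (simp_all add: s_defs U_def)
    ultimately show ?thesis
      unfolding fold_decrement by (simp add: s5_def cong: if_cong)
  qed
  have R5: "R_of s5 (lev_of s5) = R"
    by (simp add: s_defs l_def)
  have r6: "runs (par_set (\<lambda>s. R_of s (lev_of s)) (\<lambda>v. atomic (\<lambda>s.
       s\<lparr>U_of := U_of s - {v}, rho_of := (rho_of s)(v := lev_of s)\<rparr>))) s5 s6 (1 + real (card R)) 1"
  proof -
    have "runs (par_set (\<lambda>s. R_of s (lev_of s)) (\<lambda>v. atomic (\<lambda>s.
       s\<lparr>U_of := U_of s - {v}, rho_of := (rho_of s)(v := lev_of s)\<rparr>))) s5
       (fold (\<lambda>v s. s\<lparr>U_of := U_of s - {v}, rho_of := (rho_of s)(v := lev_of s)\<rparr>) ?rs s5) (1 + real (card R)) 1"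
      by (rule runs_par_set_atomic) (use fR R5 in simp_all)
    moreover have "U_of s5 = U" "rho_of s5 = rho_of s" "lev_of s5 = l"
      by (simp_all add: s_defs U_def l_def)
    ultimately show ?thesis
      unfolding fold_close_level by (simp add: s6_def rho'_def rs cong: if_cong)
  qed
  have R6: "R_of s6 (lev_of s6) = R"
    by (simp add: s_defs l_def)
  have r7: "runs (record_partition G) s6 s7 (1 + (\<Sum>v\<in>R. 1 + real (length (nbrs G v)))) (1 + 1)"
    unfolding record_partition_def
  proof -
    have "runs (par_set (\<lambda>s. R_of s (lev_of s)) (\<lambda>v. par_list (\<lambda>_. nbrs G v) (\<lambda>u. atomic (\<lambda>s.
       if rho_of s u = lev_of s then s\<lparr>nb_of := (nb_of s)(v := nb_of s v @ [u])\<rparr> else s)))) s6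
       (fold (\<lambda>v s. s\<lparr>nb_of := (nb_of s)(v := nb_of s v @ filter (\<lambda>u. rho_of s u = lev_of s) (nbrs G v))\<rparr>) ?rs s6)
       (1 + (\<Sum>v\<in>R. 1 + real (length (nbrs G v)))) (1 + 1)"
    proof (rule runs_par_set[where I = "\<lambda>_. True"])
      fix v and s :: mem
      show "runs (par_list (\<lambda>_. nbrs G v) (\<lambda>u. atomic (\<lambda>s. if rho_of s u = lev_of s then s\<lparr>nb_of := (nb_of s)(v := nb_of s v @ [u])\<rparr> else s))) s
         (s\<lparr>nb_of := (nb_of s)(v := nb_of s v @ filter (\<lambda>u. rho_of s u = lev_of s) (nbrs G v))\<rparr>)
         (1 + real (length (nbrs G v))) 1 \<and> True"
        using runs_par_list_atomic[of "\<lambda>_. nbrs G v" "\<lambda>u s. if rho_of s u = lev_of s then s\<lparr>nb_of := (nb_of s)(v := nb_of s v @ [u])\<rparr> else s" s]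
        unfolding fold_record_inner by simp
    qed (use fR R6 in simp_all)
    moreover have "nb_of s6 = nb_of s" "rho_of s6 = rho'" "lev_of s6 = l"
      by (simp_all add: s_defs l_def)
    ultimately show "runs (par_set (\<lambda>s. R_of s (lev_of s)) (\<lambda>v. par_list (\<lambda>_. nbrs G v) (\<lambda>u. atomic (\<lambda>s.
       if rho_of s u = lev_of s then s\<lparr>nb_of := (nb_of s)(v := nb_of s v @ [u])\<rparr> else s)))) s6 s7
       (1 + (\<Sum>v\<in>R. 1 + real (length (nbrs G v)))) (1 + 1)"
      unfolding fold_record[OF rs(2)] by (simp add: s7_def nb'_def rs cong: if_cong)
  qed
  have r8: "runs (atomic (\<lambda>s. s\<lparr>lev_of := lev_of s + 1\<rparr>)) s7 s8 1 0"
    using runs_atomic[of "\<lambda>s. s\<lparr>lev_of := lev_of s + 1\<rparr>" s7] by (simp add: s8_def) (simp add: s_defs l_def)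
  have U8: "U_of s8 = U - R"
    by (simp add: s_defs)
  have UR: "U - (U - R) = R"
    using RU by auto
  have cRU: "card R \<le> card U"
    using card_mono[OF fU RU] .
  have run: "runs adg_body s s8
      (16 * real (card (U_of s)) + 2 * (\<Sum>v\<in>U_of s - U_of s8. real (length (nbrs G v)))) (4 * real k + 13)"
    unfolding adg_body_def adg_iteration_def U8 U_def[symmetric] UR
    by (rule runs_mono[OF runs_seq[OF runs_seq[OF r1 runs_seq[OF r2 runs_seq[OF r3 runs_seq[OF r4 runs_seq[OF r5 r6]]]]]
          runs_seq[OF r7 r8]]])
       (use cU cRU in \<open>auto simp: sum.distrib\<close>)
  have SD_card: "SD = int (\<Sum>u\<in>U. card (nbhd E U u))"
    by (simp add: SD_def D_eq)
  have avg0: "avg \<ge> 0"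
    by (simp add: avg_def SD_card sum_nonneg)
  have avg_card: "avg * real (card U) = real (\<Sum>u\<in>U. card (nbhd E U u))"
    using cU by (simp add: avg_def SD_card)
  have avg_d: "avg \<le> 2 * real degen"
  proof -
    have "avg * real (card U) \<le> real (2 * degen * card U)"
      unfolding avg_card by (rule of_nat_mono[OF sum_card_nbhd_le_degeneracy[OF Usub]])
    then show ?thesis
      using cU by simp
  qed
  \<comment> \<open>The average degree is at most |U|, and its product with |U| is at most twice the
    number of edges.\<close>
  have avg_m: "avg\<^sup>2 \<le> 2 * real (card E)"
  proof -
    have "(\<Sum>u\<in>U. card (nbhd E U u)) \<le> (\<Sum>u\<in>U. card U)"
      using fU by (intro sum_mono card_mono) (auto simp: nbhd_def)
    then have "avg * real (card U) \<le> real (card U) * real (card U)"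
      unfolding avg_card of_nat_mult[symmetric] of_nat_le_iff by simp
    then have "avg \<le> real (card U)"
      using cU by simp
    then have "avg\<^sup>2 \<le> avg * real (card U)"
      using avg0 by (simp add: power2_eq_square mult_left_mono)
    also have "\<dots> \<le> real (2 * card E)"
      unfolding avg_card by (rule of_nat_mono[OF sum_card_nbhd_le_edges[OF Usub]])
    finally show ?thesis
      by simp
  qed
  have shrink: "(1 + \<eta>) * real (card (U - R)) \<le> real (card U)" "U - R \<noteq> U"
  proof -
    have big: "(1 + \<eta>) * avg < real (card (nbhd E U u))" if "u \<in> U - R" for u
      using that D_eq[of u] by (auto simp: R_def)
    have le: "(\<Sum>u\<in>U - R. real (card (nbhd E U u))) \<le> (\<Sum>u\<in>U. real (card (nbhd E U u)))"
      using fU by (intro sum_mono2) auto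
    \<comment> \<open>Strictness allows the average to be cancelled: it could not hold with average
      0, so survivors force a positive average.\<close>
    have *: "real (card (U - R)) * ((1 + \<eta>) * avg) < avg * real (card U)" if "U - R \<noteq> {}"
    proof -
      have "real (card (U - R)) * ((1 + \<eta>) * avg) < (\<Sum>u\<in>U - R. real (card (nbhd E U u)))"
        using sum_strict_mono[of "U - R" "\<lambda>_. (1 + \<eta>) * avg" "\<lambda>u. real (card (nbhd E U u))"] big that fU by auto
      with le show ?thesis
        unfolding avg_card by simp
    qed
    show 1: "(1 + \<eta>) * real (card (U - R)) \<le> real (card U)"
    proof (cases "U - R = {}")
      case False
      have "avg * ((1 + \<eta>) * real (card (U - R))) < avg * real (card U)"
        using *[OF False] by (simp add: mult_ac)
      then show ?thesis
        using avg0 by (simp add: mult_less_cancel_left)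
    next
      case True
      show ?thesis
        unfolding True by simp
    qed
    show "U - R \<noteq> U"
    proof
      assume "U - R = U"
      with 1 have "(1 + \<eta>) * real (card U) \<le> real (card U)"
        by simp
      then have "\<eta> * real (card U) \<le> 0"
        by (simp add: algebra_simps)
      then show False
        using eta cU by (simp add: mult_le_0_iff)
    qed
  qed
  have inv8: "adg_inv s8"
    unfolding adg_inv_def
  proof (intro conjI)
    have rho8: "rho_of s8 = rho'" "lev_of s8 = l + 1" "R_of s8 = (R_of s)(l := R)" "nb_of s8 = nb'"
      by (simp_all add: s_defs)
    have rho'_l: "rho' v = l \<longleftrightarrow> v \<in> R" for v
      using rho(1)[of v] by (auto simp: rho'_def)
    have rho_R: "v \<in> R \<Longrightarrow> rho_of s v = 0 \<and> v < n" for v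
      using RU by (auto simp: U_eq)
    have rho'_0: "rho' v = 0 \<longleftrightarrow> v \<notin> R \<and> rho_of s v = 0" for v
      using l by (auto simp: rho'_def)
    show "U_of s8 = {v. v < n \<and> rho_of s8 v = 0}"
      unfolding U8 rho8 rho'_0 by (auto simp: U_eq)
    show "lev_of s8 \<ge> 1"
      by (simp add: rho8)
    show "R_of s8 = (\<lambda>i. if i = 0 then {} else {v. rho_of s8 v = i})"
    proof
      fix i
      show "R_of s8 i = (if i = 0 then {} else {v. rho_of s8 v = i})"
        using l rho'_l rho_R unfolding rho8 by (auto simp: R_eq rho'_def)
    qed
    show "\<forall>v. rho_of s8 v < lev_of s8 \<and> (rho_of s8 v > 0 \<longrightarrow> v < n)"
      using rho rho_R unfolding rho8 rho'_def by (auto intro: less_SucI)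
    \<comment> \<open>Vertices of \<open>R\<close> are decremented as well, being still in
      \<open>U\<close> at that time; only the entries of the survivors have to be degrees.\<close>
    show "\<forall>u\<in>U_of s8. D_of s8 u = int (card (nbhd E (U_of s8) u))"
    proof
      fix u assume "u \<in> U_of s8"
      then have u: "u \<in> U" "u \<notin> R" "u < n"
        using Usub by (auto simp: U8)
      have "(\<Sum>v\<leftarrow>?rs. count_list (nbrs G v) u) = (\<Sum>v\<in>R. count_list (nbrs G v) u)"
        using fR by (simp add: sum_list_distinct_conv_sum_set)
      also have "\<dots> = (\<Sum>v\<in>R. of_bool (v \<in> nbhd E R u))"
      proof (rule sum.cong[OF refl])
        fix v assume v: "v \<in> R"
        then have "v < n"
          using rho_R by simp
        then have "count_list (nbrs G v) u = of_bool (u \<in> set (nbrs G v))"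
          using count_list_distinct[OF distinct_nbrs[of v]] by simp
        also have "u \<in> set (nbrs G v) \<longleftrightarrow> v \<in> nbhd E R u"
          using v u \<open>v < n\<close> by (simp add: set_nbrs nbhd_def insert_commute)
        finally show "count_list (nbrs G v) u = of_bool (v \<in> nbhd E R u)" .
      qed
      also have "\<dots> = card (nbhd E R u)"
        using fR by (simp add: sum.If_cases of_bool_def Int_absorb1 nbhd_def Int_def)
      finally have cnt: "(\<Sum>v\<leftarrow>?rs. count_list (nbrs G v) u) = card (nbhd E R u)" .
      have "nbhd E U u = nbhd E (U - R) u \<union> nbhd E R u" "nbhd E (U - R) u \<inter> nbhd E R u = {}"
        using RU by (auto simp: nbhd_def)
      then have "card (nbhd E U u) = card (nbhd E (U - R) u) + card (nbhd E R u)"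
        using fU fR by (simp add: card_Un_disjoint finite_nbhd)
      moreover have "D_of s8 u = D_of s u - int (card (nbhd E R u))"
        using u cnt by (simp add: s_defs)
      ultimately show "D_of s8 u = int (card (nbhd E (U_of s8) u))"
        using D_eq[OF u(1)] by (simp add: U8)
    qed
    \<comment> \<open>Recording appends to an array that is still empty, since the vertex had level
      0 before.\<close>
    have nb_new: "nb' v = filter (\<lambda>u. u \<in> R) (nbrs G v)" if "v \<in> R" for v
      using that rho_R[of v] by (simp add: nb'_def nb_eq rho'_l)
    show "nb_of s8 = (\<lambda>v. if rho_of s8 v = 0 then [] else filter (\<lambda>u. rho_of s8 u = rho_of s8 v) (nbrs G v))"
      unfolding rho8
    proof
      fix v
      show "nb' v = (if rho' v = 0 then [] else filter (\<lambda>u. rho' u = rho' v) (nbrs G v))"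
      proof (cases "v \<in> R")
        case True
        then have l': "rho' v = l"
          by (simp add: rho'_l)
        show ?thesis
          unfolding nb_new[OF True] l' rho'_l using l by simp
      next
        case False
        have "rho' u = rho_of s v \<longleftrightarrow> rho_of s u = rho_of s v" if "rho_of s v \<noteq> 0" for u
          using that rho(1)[of v] rho_R[of u] by (auto simp: rho'_def)
        with False show ?thesis
          by (simp add: nb'_def nb_eq rho'_def cong: filter_cong)
      qed
    qed
    show "\<forall>v. real (length (nb_of s8 v)) \<le> (1 + \<eta>) * (2 * real degen) \<and>
          (real (length (nb_of s8 v)))\<^sup>2 \<le> (1 + \<eta>)\<^sup>2 * (2 * real (card E))"
      unfolding rho8
    proof
      fix v
      show "real (length (nb' v)) \<le> (1 + \<eta>) * (2 * real degen) \<and> (real (length (nb' v)))\<^sup>2 \<le> (1 + \<eta>)\<^sup>2 * (2 * real (card E))"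
      proof (cases "v \<in> R")
        case True
        then have v: "v < n" "v \<in> U"
          using rho_R RU by auto
        have "length (nb' v) = card (set (nb' v))"
          using distinct_nbrs[OF v(1)] by (subst distinct_card) (simp_all add: nb_new[OF True])
        also have "\<dots> \<le> card (nbhd E U v)"
          using fU RU v by (intro card_mono finite_nbhd) (auto simp: nb_new[OF True] set_nbrs nbhd_def)
        finally have "real (length (nb' v)) \<le> real (card (nbhd E U v))"
          by simp
        also have "\<dots> \<le> (1 + \<eta>) * avg"
          using True D_eq[OF v(2)] by (simp add: R_def)
        finally have le: "real (length (nb' v)) \<le> (1 + \<eta>) * avg" .
        have "(real (length (nb' v)))\<^sup>2 \<le> ((1 + \<eta>) * avg)\<^sup>2"
          using le by (intro power_mono) auto
        also have "\<dots> \<le> (1 + \<eta>)\<^sup>2 * (2 * real (card E))"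
          using avg_m eta by (simp add: power_mult_distrib)
        moreover have "(1 + \<eta>) * avg \<le> (1 + \<eta>) * (2 * real degen)"
          using avg_d eta by (intro mult_left_mono) auto
        ultimately show ?thesis
          using le by linarith
      qed (use nb_le in \<open>simp add: nb'_def\<close>)
    qed
  qed
  have "U_of s8 \<subset> U_of s"
    using shrink(2) U8 by (auto simp: U_def)
  moreover have "(1 + \<eta>) * real (card (U_of s8)) \<le> real (card (U_of s))"
    using shrink(1) by (simp add: U8 U_def)
  moreover have "lev_of s8 = lev_of s + 1" "B_of s8 = B_of s"
    by (simp_all add: s_defs l_def)
  ultimately show ?thesis
    using run inv8 by blast
qed

lemma adg_inv_finite: "adg_inv s \<Longrightarrow> finite (U_of s)"
  by (simp add: adg_inv_def)

text \<open>The constant (1 + \<eta>) / \<eta> is the sum of the geometric series of the shrinking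
  sets, and 17 is 16 plus the loop test. The last iteration empties \<open>U\<close> without a
  shrinking ratio to count, hence the extra factor \<open>1 + \<eta>\<close> in the bound on the
  levels.\<close>

lemma adg_loop:
  assumes "adg_inv s"
  shows "\<exists>s'. runs (while_cmd (\<lambda>s. U_of s \<noteq> {}) adg_body) s s'
      (17 * ((1 + \<eta>) / \<eta>) * real (card (U_of s)) + 2 * (\<Sum>v\<in>U_of s. real (length (nbrs G v))) + 1)
      ((4 * real k + 15) * real (lev_of s' - lev_of s)) \<and>
    adg_inv s' \<and> U_of s' = {} \<and> B_of s' = B_of s \<and> lev_of s \<le> lev_of s' \<and>
    lev_of s' - lev_of s \<le> card (U_of s) \<and>
    (U_of s \<noteq> {} \<longrightarrow> (1 + \<eta>) ^ (lev_of s' - lev_of s) \<le> (1 + \<eta>) * real (card (U_of s)))"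
  using assms
proof (induction "card (U_of s)" arbitrary: s rule: less_induct)
  case less
  let ?c = "(1 + \<eta>) / \<eta>"
  show ?case
  proof (cases "U_of s = {}")
    case True
    then show ?thesis
      using less.prems eta by (intro exI[of _ s]) (auto intro!: runs_mono[OF runs_while_exit])
  next
    case False
    obtain s1 where s1: "runs adg_body s s1
        (16 * real (card (U_of s)) + 2 * (\<Sum>v\<in>U_of s - U_of s1. real (length (nbrs G v)))) (4 * real k + 13)"
      "adg_inv s1" "U_of s1 \<subset> U_of s" "(1 + \<eta>) * real (card (U_of s1)) \<le> real (card (U_of s))"
      "lev_of s1 = lev_of s + 1" "B_of s1 = B_of s"
      using adg_body_step[OF less.prems False] by blast
    have fU: "finite (U_of s)"
      using adg_inv_finite[OF less.prems] .
    have less1: "card (U_of s1) < card (U_of s)"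
      using psubset_card_mono[OF fU s1(3)] .
    from less.hyps[OF this s1(2)]
    obtain s' where s': "runs (while_cmd (\<lambda>s. U_of s \<noteq> {}) adg_body) s1 s'
      (17 * ?c * real (card (U_of s1)) + 2 * (\<Sum>v\<in>U_of s1. real (length (nbrs G v))) + 1)
      ((4 * real k + 15) * real (lev_of s' - lev_of s1))"
      "adg_inv s'" "U_of s' = {}" "B_of s' = B_of s1" "lev_of s1 \<le> lev_of s'"
      "lev_of s' - lev_of s1 \<le> card (U_of s1)"
      "U_of s1 \<noteq> {} \<longrightarrow> (1 + \<eta>) ^ (lev_of s' - lev_of s1) \<le> (1 + \<eta>) * real (card (U_of s1))"
      by blast
    have lev: "lev_of s' - lev_of s = Suc (lev_of s' - lev_of s1)"
      using s'(5) s1(5) by auto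
    have cU: "card (U_of s) \<ge> 1"
      using False fU by (simp add: Suc_le_eq card_gt_0_iff)
    have "runs (while_cmd (\<lambda>s. U_of s \<noteq> {}) adg_body) s s'
      (17 * ?c * real (card (U_of s)) + 2 * (\<Sum>v\<in>U_of s. real (length (nbrs G v))) + 1)
      ((4 * real k + 15) * real (lev_of s' - lev_of s))"
    proof (rule runs_mono[OF runs_while_step[OF _ s1(1) s'(1)]])
      have "(\<Sum>v\<in>U_of s. real (length (nbrs G v))) =
          (\<Sum>v\<in>U_of s - U_of s1. real (length (nbrs G v))) + (\<Sum>v\<in>U_of s1. real (length (nbrs G v)))"
        using s1(3) fU by (intro sum.subset_diff) auto
      moreover have "17 * real (card (U_of s)) + 17 * ?c * real (card (U_of s1)) \<le> 17 * ?c * real (card (U_of s))"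
      proof -
        have "?c * real (card (U_of s1)) \<le> real (card (U_of s)) / \<eta>"
          using divide_right_mono[OF s1(4), of \<eta>] eta by simp
        moreover have "?c * real (card (U_of s)) = real (card (U_of s)) / \<eta> + real (card (U_of s))"
          using eta by (simp add: field_simps)
        ultimately show ?thesis
          unfolding mult.assoc by linarith
      qed
      ultimately show "1 + (16 * real (card (U_of s)) + 2 * (\<Sum>v\<in>U_of s - U_of s1. real (length (nbrs G v)))) +
          (17 * ?c * real (card (U_of s1)) + 2 * (\<Sum>v\<in>U_of s1. real (length (nbrs G v))) + 1)
        \<le> 17 * ?c * real (card (U_of s)) + 2 * (\<Sum>v\<in>U_of s. real (length (nbrs G v))) + 1"
        using cU by simp
      show "2 + (4 * real k + 13) + (4 * real k + 15) * real (lev_of s' - lev_of s1) \<le> (4 * real k + 15) * real (lev_of s' - lev_of s)"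
        unfolding lev by (simp add: algebra_simps)
    qed (use False in simp)
    moreover have "(1 + \<eta>) ^ (lev_of s' - lev_of s) \<le> (1 + \<eta>) * real (card (U_of s))"
    proof (cases "U_of s1 = {}")
      case True
      then have "lev_of s' - lev_of s1 = 0"
        using s'(6) by simp
      then show ?thesis
        unfolding lev using eta cU by simp
    next
      case False
      then have "(1 + \<eta>) ^ (lev_of s' - lev_of s1) \<le> (1 + \<eta>) * real (card (U_of s1))"
        using s'(7) by blast
      then show ?thesis
        unfolding lev power_Suc using s1(4) eta by (intro mult_left_mono) auto
    qed
    ultimately show ?thesis
      using s' s1(5,6) lev less1 by (intro exI[of _ s']) auto
  qed
qed

end

section \<open>DEC-ADG\<close>

lemma fold_set_degree:
  "fold (\<lambda>v s. s\<lparr>deg_of := (deg_of s)(v := \<Sum>u\<leftarrow>N v. if rho_of s u \<ge> lev_of s then 1 else 0)\<rparr>) xs s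
    = s\<lparr>deg_of := \<lambda>v. if v \<in> set xs then \<Sum>u\<leftarrow>N v. if rho_of s u \<ge> lev_of s then 1 else 0 else deg_of s v\<rparr>"
proof (induction xs arbitrary: s)
  case (Cons x xs)
  then show ?case
    by (cases s) (auto simp: fun_eq_iff)
qed simp

lemma fold_insert_U: "fold (\<lambda>v s. s\<lparr>U_of := insert v (U_of s)\<rparr>) xs s = s\<lparr>U_of := U_of s \<union> set xs\<rparr>"
  by (induction xs arbitrary: s) auto

lemma lossless_seq_runs: "runs p s s1 w d \<Longrightarrow> lossless_spmf (q s1) \<Longrightarrow> lossless_spmf ((p ;; q) s)"
  by (auto simp: runs_def seq_def split_beta)

lemma sum_list_indicator: "(\<Sum>u\<leftarrow>us. if Q u then 1 else 0 :: nat) = length (filter Q us)"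
  by (induction us) auto

text \<open>\<open>sA\<close> is the memory left by ADG. The bounds \<open>k\<close> and
  \<open>k'\<close> are kept apart: a Reduce over a full adjacency array, with depth controlled by
  \<open>k\<close>, happens once per level, while the Reduce of every round stays inside a level and
  is controlled by \<open>k'\<close>, which is what gives log d.\<close>

locale dec_adg_coloring = dec_adg_run +
  fixes \<mu> :: real and k' :: nat and sA :: mem
  assumes mu: "\<mu> > 1" and k': "(1 + \<eta>) * (2 * real degen) \<le> 2 ^ k'"
    and sA: "adg_inv sA" "U_of sA = {}" "\<And>v. B_of sA v = {}"
begin

definition level :: "nat \<Rightarrow> nat set" where
  "level i = {v. rho_of sA v = i}"

text \<open>Levels still to be colored have empty forbidden sets, so a level starts with the colors
  of its neighbors in Q only. Nothing is required of \<open>C_of\<close>: the bounds hold for every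
  outcome on the earlier levels.\<close>

definition lev_inv :: "mem \<Rightarrow> bool" where
  "lev_inv s \<longleftrightarrow> nb_of s = nb_of sA \<and> rho_of s = rho_of sA \<and> R_of s = R_of sA \<and> U_of s = {} \<and>
     1 \<le> lev_of s \<and> (\<forall>v. rho_of sA v < lev_of s \<longrightarrow> B_of s v = {})"

definition level_body :: cmd where
  "level_body =
     (atomic (\<lambda>s. s\<lparr>lev_of := lev_of s - 1\<rparr>) ;;
        par_set (\<lambda>s. R_of s (lev_of s)) (\<lambda>v. par_list (\<lambda>_. nbrs G v) (\<lambda>u. atomic (\<lambda>s.
          if rho_of s u > lev_of s
          then s\<lparr>B_of := (B_of s)(v := insert (C_of s u) (B_of s v))\<rparr> else s))) ;;
        sim_col \<mu> G)"

abbreviation "deg v \<equiv> real (length (nbrs G v))"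

lemma lev_inv_sA: "lev_inv sA"
  using sA by (auto simp: lev_inv_def adg_inv_def)

lemma level_sub: "1 \<le> i \<Longrightarrow> level i \<subseteq> {..<n}"
  using sA(1) by (auto simp: level_def adg_inv_def)

lemma R_sA: "1 \<le> i \<Longrightarrow> R_of sA i = level i"
  using sA(1) by (auto simp: level_def adg_inv_def)

lemma nb_sA: "1 \<le> i \<Longrightarrow> v \<in> level i \<Longrightarrow> nb_of sA v = filter (\<lambda>u. rho_of sA u = i) (nbrs G v)"
  using sA(1) by (auto simp: level_def adg_inv_def)

text \<open>The body is deterministic up to the loop of SIM-COL. Its outcome \<open>s0\<close> comes
  with a moment bound and a transfer of termination, so that the arguments below only need to treat
  the random loop.\<close>

lemma level_prefix:
  assumes inv: "lev_inv s" and lev: "lev_of s = Suc l" "1 \<le> l"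
  obtains s0 where "coloring_level \<mu> s0 k'" "sim_inv s0 s0" "U_of s0 = level l" "nb_of s0 = nb_of sA"
    "\<And>s'. sim_inv s0 s' \<Longrightarrow> U_of s' = {} \<Longrightarrow> lev_inv s' \<and> lev_of s' = l"
    "\<And>a b F. a \<ge> 0 \<Longrightarrow> b \<ge> 0 \<Longrightarrow> mgf a b (level_body s) F \<le>
       ennreal (exp (a * (4 + 3 * (\<Sum>v\<in>level l. 1 + deg v)) + b * (8 + 2 * real k))) *
       mgf a b (coloring_level.coloring_loop \<mu> s0) F"
    "lossless_spmf (coloring_level.coloring_loop \<mu> s0) \<Longrightarrow> lossless_spmf (level_body s)"
proof -
  have eqs: "nb_of s = nb_of sA" "rho_of s = rho_of sA" "R_of s l = level l" "R_of s = R_of sA" "U_of s = {}"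
    "\<And>v. rho_of sA v \<le> l \<Longrightarrow> B_of s v = {}"
    using inv lev R_sA[OF lev(2)] by (auto simp: lev_inv_def)
  let ?R = "level l" and ?rs = "sorted_list_of_set (level l)"
  have fR: "finite ?R"
    using level_sub[OF lev(2)] finite_subset by blast
  then have rs: "set ?rs = ?R" "distinct ?rs"
    by auto
  have v_n: "v \<in> ?R \<Longrightarrow> v < n" for v
    using level_sub[OF lev(2)] by auto
  define s1 where "s1 = s\<lparr>lev_of := l\<rparr>"
  define B where "B = (\<lambda>v. if v \<in> ?R then C_of s ` {u \<in> set (nbrs G v). rho_of sA u > l} else B_of s v)"
  define s2 where "s2 = s1\<lparr>B_of := B\<rparr>"
  define dg where "dg = (\<lambda>v. if v \<in> ?R then \<Sum>u\<leftarrow>nbrs G v. if rho_of sA u \<ge> l then 1 else 0 else deg_of s v)"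
  define s3 where "s3 = s2\<lparr>deg_of := dg\<rparr>"
  define s4 where "s4 = s3\<lparr>U_of := ?R\<rparr>"
  note s_defs = s1_def s2_def s3_def s4_def
  have r1: "runs (atomic (\<lambda>s. s\<lparr>lev_of := lev_of s - 1\<rparr>)) s s1 1 0"
    using runs_atomic[of "\<lambda>s. s\<lparr>lev_of := lev_of s - 1\<rparr>" s] by (simp add: s1_def lev)
  have R1: "R_of s1 (lev_of s1) = ?R" "R_of s2 (lev_of s2) = ?R" "R_of s3 (lev_of s3) = ?R"
    by (simp_all add: s_defs eqs(3))
  have r2: "runs (par_set (\<lambda>s. R_of s (lev_of s)) (\<lambda>v. par_list (\<lambda>_. nbrs G v) (\<lambda>u. atomic (\<lambda>s.
          if rho_of s u > lev_of s
          then s\<lparr>B_of := (B_of s)(v := insert (C_of s u) (B_of s v))\<rparr> else s)))) s1 s2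
          (1 + (\<Sum>v\<in>?R. 1 + deg v)) (1 + 1)"
  proof -
    have "runs (par_set (\<lambda>s. R_of s (lev_of s)) (\<lambda>v. par_list (\<lambda>_. nbrs G v) (\<lambda>u. atomic (\<lambda>s.
          if rho_of s u > lev_of s
          then s\<lparr>B_of := (B_of s)(v := insert (C_of s u) (B_of s v))\<rparr> else s)))) s1
       (fold (\<lambda>v s. s\<lparr>B_of := (B_of s)(v := B_of s v \<union> C_of s ` {u \<in> set (nbrs G v). rho_of s u > lev_of s})\<rparr>) ?rs s1)
       (1 + (\<Sum>v\<in>?R. 1 + deg v)) (1 + 1)"
    proof (rule runs_par_set[where I = "\<lambda>_. True"])
      fix v and s :: mem
      show "runs (par_list (\<lambda>_. nbrs G v) (\<lambda>u. atomic (\<lambda>s.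
          if rho_of s u > lev_of s
          then s\<lparr>B_of := (B_of s)(v := insert (C_of s u) (B_of s v))\<rparr> else s))) s
         (s\<lparr>B_of := (B_of s)(v := B_of s v \<union> C_of s ` {u \<in> set (nbrs G v). rho_of s u > lev_of s})\<rparr>)
         (1 + deg v) 1 \<and> True"
        using runs_par_list_atomic[of "\<lambda>_. nbrs G v" "\<lambda>u s. if rho_of s u > lev_of s
          then s\<lparr>B_of := (B_of s)(v := insert (C_of s u) (B_of s v))\<rparr> else s" s]
        by (subst (asm) fold_forbid_inner) auto
    qed (use fR R1 in simp_all)
    moreover have "fold (\<lambda>v s. s\<lparr>B_of := (B_of s)(v := B_of s v \<union> C_of s ` {u \<in> set (nbrs G v). rho_of s u > lev_of s})\<rparr>) ?rs s1 = s2"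
    proof -
      have "B_of s v = {}" if "v \<in> ?R" for v
        using that eqs(6) by (simp add: level_def)
      then have "B = (\<lambda>v. if v \<in> ?R then B_of s1 v \<union> C_of s1 ` {u \<in> set (nbrs G v). rho_of s1 u > lev_of s1} else B_of s1 v)"
        by (auto simp: B_def s1_def eqs(2) fun_eq_iff)
      then show ?thesis
        by (subst fold_forbid[where N = "\<lambda>v s. nbrs G v" and Q = "\<lambda>u s. rho_of s u > lev_of s"])
           (simp_all add: rs s2_def)
    qed
    ultimately show ?thesis
      by simp
  qed
  have r3: "runs (par_set (\<lambda>s. R_of s (lev_of s)) (\<lambda>v. reduce (\<lambda>_. nbrs G v)
       (\<lambda>s u. if rho_of s u \<ge> lev_of s then 1 else 0)
       (\<lambda>x s. s\<lparr>deg_of := (deg_of s)(v := x)\<rparr>))) s2 s3 (1 + (\<Sum>v\<in>?R. 2 * deg v + 1)) (1 + 2 * real k)"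
  proof -
    have "runs (par_set (\<lambda>s. R_of s (lev_of s)) (\<lambda>v. reduce (\<lambda>_. nbrs G v)
       (\<lambda>s u. if rho_of s u \<ge> lev_of s then 1 else 0)
       (\<lambda>x s. s\<lparr>deg_of := (deg_of s)(v := x)\<rparr>))) s2
       (fold (\<lambda>v s. s\<lparr>deg_of := (deg_of s)(v := \<Sum>u\<leftarrow>nbrs G v. if rho_of s u \<ge> lev_of s then 1 else 0)\<rparr>) ?rs s2)
       (1 + (\<Sum>v\<in>?R. 2 * deg v + 1)) (1 + 2 * real k)"
    proof (rule runs_par_set[where I = "\<lambda>_. True"])
      fix v and s :: mem assume "v \<in> ?R"
      then have "length (nbrs G v) \<le> 2 ^ k"
        using length_nbrs_le[OF v_n] n_le by (meson order_trans)
      then show "runs (reduce (\<lambda>_. nbrs G v) (\<lambda>s u. if rho_of s u \<ge> lev_of s then 1 else 0)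
          (\<lambda>x s. s\<lparr>deg_of := (deg_of s)(v := x)\<rparr>)) s
          (s\<lparr>deg_of := (deg_of s)(v := \<Sum>u\<leftarrow>nbrs G v. if rho_of s u \<ge> lev_of s then 1 else 0)\<rparr>)
          (2 * deg v + 1) (2 * real k) \<and> True"
        using runs_reduce[of "\<lambda>_. nbrs G v" s k "\<lambda>s u. if rho_of s u \<ge> lev_of s then 1 else 0"
            "\<lambda>x s. s\<lparr>deg_of := (deg_of s)(v := x)\<rparr>"] by simp
    qed (use fR R1 in simp_all)
    moreover have "rho_of s2 = rho_of sA" "lev_of s2 = l" "deg_of s2 = deg_of s"
      by (simp_all add: s_defs eqs)
    ultimately show ?thesis
      unfolding fold_set_degree by (simp add: s3_def dg_def rs cong: if_cong)
  qed
  have r4: "runs (par_set (\<lambda>s. R_of s (lev_of s)) (\<lambda>v. atomic (\<lambda>s. s\<lparr>U_of := insert v (U_of s)\<rparr>))) s3 s4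
      (1 + real (card ?R)) 1"
  proof -
    have "runs (par_set (\<lambda>s. R_of s (lev_of s)) (\<lambda>v. atomic (\<lambda>s. s\<lparr>U_of := insert v (U_of s)\<rparr>))) s3
        (fold (\<lambda>v s. s\<lparr>U_of := insert v (U_of s)\<rparr>) ?rs s3) (1 + real (card ?R)) 1"
      by (rule runs_par_set_atomic) (use fR R1 in simp_all)
    moreover have "U_of s3 = {}"
      by (simp add: s_defs eqs)
    ultimately show ?thesis
      unfolding fold_insert_U by (simp add: s4_def rs)
  qed
  have s4_eqs: "nb_of s4 = nb_of sA" "U_of s4 = ?R" "B_of s4 = B" "deg_of s4 = dg" "lev_of s4 = l"
    "rho_of s4 = rho_of sA" "R_of s4 = R_of sA"
    by (simp_all add: s_defs eqs)
  have lvl: "coloring_level \<mu> s4 k'"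
  proof
    fix v assume "v \<in> U_of s4"
    then have v: "v \<in> ?R"
      by (simp add: s4_eqs)
    have "real (length (nb_of s4 v)) \<le> (1 + \<eta>) * (2 * real degen)"
      using sA(1) unfolding s4_eqs adg_inv_def by blast
    also have "\<dots> \<le> real (2 ^ k')"
      using k' by simp
    finally show "length (nb_of s4 v) \<le> 2 ^ k'"
      by (simp only: of_nat_le_iff)
    show "v \<notin> set (nb_of s4 v)"
      using no_loop[of v] v by (simp add: s4_eqs nb_sA[OF lev(2) v] set_nbrs[OF v_n] nbhd_def)
  qed (use mu fR in \<open>simp_all add: s4_eqs\<close>)
  \<comment> \<open>Neighbors in Q account for the forbidden colors and neighbors in the level for
    the remaining ones; together they are exactly what the degree counts.\<close>
  have siminv: "sim_inv s4 s4"
    unfolding sim_inv_def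
  proof (intro conjI ballI)
    fix v assume "v \<in> U_of s4"
    then have v: "v \<in> ?R"
      by (simp add: s4_eqs)
    let ?N = "set (nbrs G v)"
    have B: "B v = C_of s ` {u \<in> ?N. rho_of sA u > l}"
      using v by (simp add: B_def)
    show "finite (B_of s4 v)"
      by (simp add: s4_eqs B)
    have "card (B v) \<le> card {u \<in> ?N. rho_of sA u > l}"
      unfolding B by (rule card_image_le) simp
    moreover have "card (set (nb_of sA v) \<inter> ?R) \<le> card {u \<in> ?N. rho_of sA u = l}"
      by (intro card_mono) (auto simp: nb_sA[OF lev(2) v])
    moreover have "card {u \<in> ?N. rho_of sA u > l} + card {u \<in> ?N. rho_of sA u = l} = card ({u \<in> ?N. rho_of sA u > l} \<union> {u \<in> ?N. rho_of sA u = l})"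
      by (rule card_Un_disjoint[symmetric]) auto
    moreover have "\<dots> = card (set (filter (\<lambda>u. rho_of sA u \<ge> l) (nbrs G v)))"
      by (auto intro!: arg_cong[where f = card])
    moreover have "\<dots> = dg v"
      using distinct_nbrs[OF v_n[OF v]] v by (subst distinct_card) (simp_all add: dg_def sum_list_indicator)
    ultimately show "card (B_of s4 v) + card (set (nb_of s4 v) \<inter> U_of s4) \<le> deg_of s4 v"
      by (simp add: s4_eqs)
  qed auto
  let ?loop = "coloring_level.coloring_loop \<mu>"
  have body: "level_body = (atomic (\<lambda>s. s\<lparr>lev_of := lev_of s - 1\<rparr>) ;;
        par_set (\<lambda>s. R_of s (lev_of s)) (\<lambda>v. par_list (\<lambda>_. nbrs G v) (\<lambda>u. atomic (\<lambda>s.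
          if rho_of s u > lev_of s
          then s\<lparr>B_of := (B_of s)(v := insert (C_of s u) (B_of s v))\<rparr> else s))) ;;
        par_set (\<lambda>s. R_of s (lev_of s)) (\<lambda>v. reduce (\<lambda>_. nbrs G v)
       (\<lambda>s u. if rho_of s u \<ge> lev_of s then 1 else 0)
       (\<lambda>x s. s\<lparr>deg_of := (deg_of s)(v := x)\<rparr>)) ;;
       par_set (\<lambda>s. R_of s (lev_of s)) (\<lambda>v. atomic (\<lambda>s. s\<lparr>U_of := insert v (U_of s)\<rparr>)) ;; ?loop)"
    by (simp add: level_body_def sim_col_def)
  show thesis
  proof (rule that[OF lvl siminv])
    show "U_of s4 = ?R" "nb_of s4 = nb_of sA"
      by (simp_all add: s4_eqs)
    show "lev_inv s' \<and> lev_of s' = l" if s': "sim_inv s4 s'" "U_of s' = {}" for s'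
    proof -
      have "B_of s' v = {}" if "rho_of sA v < l" for v
      proof -
        have "v \<notin> ?R"
          using that by (simp add: level_def)
        then show ?thesis
          using s' that eqs(6)[of v] by (simp add: sim_inv_def s4_eqs B_def)
      qed
      then show ?thesis
        using s' lev by (simp add: sim_inv_def lev_inv_def s4_eqs)
    qed
    show "lossless_spmf (level_body s)" if "lossless_spmf (?loop s4)"
      unfolding body
      by (rule lossless_seq_runs[OF r1], rule lossless_seq_runs[OF r2], rule lossless_seq_runs[OF r3],
          rule lossless_seq_runs[OF r4], rule that)
    fix a b :: real and F assume ab: "a \<ge> 0" "b \<ge> 0"
    let ?x1 = "a * 1 + b * (0 + 1)" and ?x2 = "a * (1 + (\<Sum>v\<in>?R. 1 + deg v)) + b * (1 + 1 + 1)"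
      and ?x3 = "a * (1 + (\<Sum>v\<in>?R. 2 * deg v + 1)) + b * (1 + 2 * real k + 1)"
      and ?x4 = "a * (1 + real (card ?R)) + b * (1 + 1)"
    have "mgf a b (level_body s) F \<le> ennreal (exp ?x1) * (ennreal (exp ?x2) * (ennreal (exp ?x3) * (ennreal (exp ?x4) * mgf a b (?loop s4) F)))"
      unfolding body
      by (rule order_trans[OF mgf_seq_runs[OF r1 ab]], rule mult_left_mono,
          rule order_trans[OF mgf_seq_runs[OF r2 ab]], rule mult_left_mono,
          rule order_trans[OF mgf_seq_runs[OF r3 ab]], rule mult_left_mono,
          rule mgf_seq_runs[OF r4 ab]) simp_all
    also have "\<dots> = ennreal (exp (?x1 + ?x2 + ?x3 + ?x4)) * mgf a b (?loop s4) F"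
      by (simp only: mult.assoc[symmetric] ennreal_mult[symmetric] exp_ge_zero exp_add[symmetric] mult_nonneg_nonneg add.assoc)
    also have "?x1 + ?x2 + ?x3 + ?x4 = a * (4 + 3 * (\<Sum>v\<in>?R. 1 + deg v)) + b * (8 + 2 * real k)"
    proof -
      have "(\<Sum>v\<in>?R. 1 + deg v) = real (card ?R) + (\<Sum>v\<in>?R. deg v)"
        "(\<Sum>v\<in>?R. 2 * deg v + 1) = 2 * (\<Sum>v\<in>?R. deg v) + real (card ?R)"
        by (simp_all add: sum.distrib sum_distrib_left)
      then show ?thesis
        by (simp only:) (simp add: algebra_simps)
    qed
    finally show "mgf a b (level_body s) F \<le> ennreal (exp (a * (4 + 3 * (\<Sum>v\<in>?R. 1 + deg v)) + b * (8 + 2 * real k))) * mgf a b (?loop s4) F" .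
  qed
qed

section \<open>The loop over the levels\<close>

abbreviation "outer_loop \<equiv> while_cmd (\<lambda>s. lev_of s > 1) level_body"

lemma mgf_level_body:
  assumes inv: "lev_inv s" and lev: "lev_of s = Suc l" "1 \<le> l" and ab: "a \<ge> 0" "b \<ge> 0"
    and \<Gamma>: "\<And>s0. coloring_level \<mu> s0 k' \<Longrightarrow> sim_inv s0 s0 \<Longrightarrow> U_of s0 = level l \<Longrightarrow> nb_of s0 = nb_of sA \<Longrightarrow>
      mgf a b (coloring_level.coloring_loop \<mu> s0) (\<lambda>s. if sim_inv s0 s \<and> U_of s = {} then 1 else \<infinity>) \<le> ennreal \<Gamma>"
  shows "mgf a b (level_body s) (\<lambda>s'. if lev_inv s' \<and> lev_of s' = l then 1 else \<infinity>)
    \<le> ennreal (exp (a * (4 + 3 * (\<Sum>v\<in>level l. 1 + deg v)) + b * (8 + 2 * real k))) * ennreal \<Gamma>"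
proof (rule level_prefix[OF inv lev])
  fix s0 assume s0: "coloring_level \<mu> s0 k'" "sim_inv s0 s0" "U_of s0 = level l" "nb_of s0 = nb_of sA"
    and post: "\<And>s'. sim_inv s0 s' \<Longrightarrow> U_of s' = {} \<Longrightarrow> lev_inv s' \<and> lev_of s' = l"
    and le: "\<And>a b F. a \<ge> 0 \<Longrightarrow> b \<ge> 0 \<Longrightarrow> mgf a b (level_body s) F \<le>
       ennreal (exp (a * (4 + 3 * (\<Sum>v\<in>level l. 1 + deg v)) + b * (8 + 2 * real k))) *
       mgf a b (coloring_level.coloring_loop \<mu> s0) F"
  have "mgf a b (coloring_level.coloring_loop \<mu> s0) (\<lambda>s'. if lev_inv s' \<and> lev_of s' = l then 1 else \<infinity>)
      \<le> mgf a b (coloring_level.coloring_loop \<mu> s0) (\<lambda>s. if sim_inv s0 s \<and> U_of s = {} then 1 else \<infinity>)"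
    by (rule mgf_mono) (use post in auto)
  also have "\<dots> \<le> ennreal \<Gamma>"
    by (rule \<Gamma>[OF s0])
  finally show ?thesis
    by (intro order_trans[OF le[OF ab]] mult_left_mono) auto
qed

text \<open>The potential is the product of the bounds of the remaining levels. Each \<Gamma> is
  uniform over the memories in which its level may start, so the factors multiply. The loop test and
  the two loop edges turn 4 and 8 into 5 and 10.\<close>

lemma mgf_outer_loop:
  assumes ab: "a \<ge> 0" "b \<ge> 0" and pos: "\<And>i. \<Gamma> i > 0"
    and \<Gamma>: "\<And>s0 i. 1 \<le> i \<Longrightarrow> coloring_level \<mu> s0 k' \<Longrightarrow> sim_inv s0 s0 \<Longrightarrow> U_of s0 = level i \<Longrightarrow> nb_of s0 = nb_of sA \<Longrightarrow>
      mgf a b (coloring_level.coloring_loop \<mu> s0) (\<lambda>s. if sim_inv s0 s \<and> U_of s = {} then 1 else \<infinity>) \<le> ennreal (\<Gamma> i)"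
  shows "mgf a b (outer_loop sA) (\<lambda>_. 1) \<le>
    ennreal (exp a * (\<Prod>i\<in>{1..<lev_of sA}. exp (a * (5 + 3 * (\<Sum>v\<in>level i. 1 + deg v)) + b * (10 + 2 * real k)) * \<Gamma> i))"
proof -
  define g where "g i = exp (a * (5 + 3 * (\<Sum>v\<in>level i. 1 + deg v)) + b * (10 + 2 * real k)) * \<Gamma> i" for i
  have g0: "g i > 0" for i
    using pos by (simp add: g_def)
  define H where "H l = exp a * (\<Prod>i\<in>{1..<l}. g i)" for l
  have H0: "H l > 0" for l
    using g0 by (auto simp: H_def intro!: mult_pos_pos prod_pos)
  define \<Phi> where "\<Phi> s = (if lev_inv s then ennreal (H (lev_of s)) else \<infinity>)" for s
  have "mgf a b (outer_loop sA) (\<lambda>_. 1) \<le> \<Phi> sA"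
  proof (rule mgf_while)
    fix s :: mem assume lev1: "lev_of s > 1"
    show "ennreal (exp (a + 2 * b)) * mgf a b (level_body s) \<Phi> \<le> \<Phi> s"
    proof (cases "lev_inv s")
      case True
      obtain l where l: "lev_of s = Suc l" "1 \<le> l"
        using lev1 by (cases "lev_of s") auto
      have "mgf a b (level_body s) \<Phi> \<le> mgf a b (level_body s) (\<lambda>s'. ennreal (H l) * (if lev_inv s' \<and> lev_of s' = l then 1 else \<infinity>))"
      proof (rule mgf_mono)
        fix s'
        show "\<Phi> s' \<le> ennreal (H l) * (if lev_inv s' \<and> lev_of s' = l then 1 else \<infinity>)"
          using H0[of l] by (auto simp: \<Phi>_def ennreal_mult_top)
      qed
      also have "\<dots> \<le> ennreal (H l) * (ennreal (exp (a * (4 + 3 * (\<Sum>v\<in>level l. 1 + deg v)) + b * (8 + 2 * real k))) * ennreal (\<Gamma> l))"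
        unfolding mgf_cmult by (intro mult_left_mono mgf_level_body True l ab \<Gamma>) auto
      finally have "ennreal (exp (a + 2 * b)) * mgf a b (level_body s) \<Phi> \<le> ennreal (exp (a + 2 * b)) *
          (ennreal (H l) * (ennreal (exp (a * (4 + 3 * (\<Sum>v\<in>level l. 1 + deg v)) + b * (8 + 2 * real k))) * ennreal (\<Gamma> l)))"
        by (rule mult_left_mono) simp
      also have "\<dots> = ennreal (exp (a + 2 * b) * (H l * (exp (a * (4 + 3 * (\<Sum>v\<in>level l. 1 + deg v)) + b * (8 + 2 * real k)) * \<Gamma> l)))"
        using H0[of l] pos[of l] by (simp only: ennreal_mult' exp_ge_zero less_imp_le)
      also have "exp (a + 2 * b) * (H l * (exp (a * (4 + 3 * (\<Sum>v\<in>level l. 1 + deg v)) + b * (8 + 2 * real k)) * \<Gamma> l)) = H l * g l"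
      proof -
        have "a * (5 + 3 * (\<Sum>v\<in>level l. 1 + deg v)) + b * (10 + 2 * real k)
          = (a + 2 * b) + (a * (4 + 3 * (\<Sum>v\<in>level l. 1 + deg v)) + b * (8 + 2 * real k))"
          by (simp add: algebra_simps)
        then show ?thesis
          unfolding g_def by (simp only: exp_add mult_ac)
      qed
      also have "H l * g l = H (Suc l)"
        using l(2) by (simp add: H_def)
      also have "ennreal (H (Suc l)) = \<Phi> s"
        using True l by (simp add: \<Phi>_def)
      finally show ?thesis .
    qed (simp add: \<Phi>_def)
  qed (auto simp: \<Phi>_def H_def)
  then show ?thesis
    using lev_inv_sA by (simp add: \<Phi>_def H_def g_def)
qed

text \<open>The level falls by exactly one per iteration; a power of 2 turns this into a contraction
  by 1/2.\<close>

lemma lossless_outer_loop: "lossless_spmf (outer_loop sA)"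
proof (rule lossless_while[where V = "\<lambda>s. if lev_inv s then ennreal (2 ^ lev_of s) else \<infinity>" and r = "1 / 2"])
  let ?V = "\<lambda>s. if lev_inv s then ennreal (2 ^ lev_of s) else \<infinity>"
  show "?V sA < \<infinity>"
    using lev_inv_sA by simp
  fix s :: mem assume lev1: "lev_of s > 1"
  show "?V s \<ge> 1"
    by (auto simp: ennreal_ge_1)
  assume "?V s < \<infinity>"
  then have inv: "lev_inv s"
    by (auto split: if_splits)
  obtain l where l: "lev_of s = Suc l" "1 \<le> l"
    using lev1 by (cases "lev_of s") auto
  show "lossless_spmf (level_body s)"
  proof (rule level_prefix[OF inv l])
    fix s0 assume "coloring_level \<mu> s0 k'" "sim_inv s0 s0"
      and "lossless_spmf (coloring_level.coloring_loop \<mu> s0) \<Longrightarrow> lossless_spmf (level_body s)"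
    then show ?thesis
      using coloring_level.lossless_coloring_loop by blast
  qed
  have "mgf 0 0 (level_body s) ?V \<le> mgf 0 0 (level_body s) (\<lambda>s'. ennreal (2 ^ l) * (if lev_inv s' \<and> lev_of s' = l then 1 else \<infinity>))"
    by (rule mgf_mono) (auto simp: ennreal_mult_top)
  also have "\<dots> \<le> ennreal (2 ^ l) * (ennreal (exp (0 * (4 + 3 * (\<Sum>v\<in>level l. 1 + deg v)) + 0 * (8 + 2 * real k))) * ennreal 1)"
    unfolding mgf_cmult
  proof (intro mult_left_mono mgf_level_body inv l)
    fix s0 assume s0: "coloring_level \<mu> s0 k'" "sim_inv s0 s0"
    \<comment> \<open>For \<open>b = 0\<close> and \<beta> = 1 the depth bound degenerates to 1, a
      finite moment that certifies the postcondition.\<close>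
    show "mgf 0 0 (coloring_level.coloring_loop \<mu> s0) (\<lambda>s. if sim_inv s0 s \<and> U_of s = {} then 1 else \<infinity>) \<le> ennreal 1"
      using coloring_level.mgf_coloring_loop_depth[OF s0, of 0 1] coloring_level.q[OF s0(1)] by simp
  qed auto
  also have "\<dots> = ennreal (1 / 2) * ?V s"
    using inv l by (simp add: ennreal_mult'[symmetric] del: ennreal_half)
  finally show "mgf 0 0 (level_body s) ?V \<le> ennreal (1 / 2) * ?V s" .
qed auto

end

section \<open>Moments of all levels and the initialization\<close>

lemma fold_init_colors:
  "fold (\<lambda>v s. s\<lparr>B_of := (B_of s)(v := {}), C_of := (C_of s)(v := 0)\<rparr>) xs s
    = s\<lparr>B_of := \<lambda>v. if v \<in> set xs then {} else B_of s v, C_of := \<lambda>v. if v \<in> set xs then 0 else C_of s v\<rparr>"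
proof (induction xs arbitrary: s)
  case (Cons x xs)
  then show ?case
    by (cases s) (auto simp: fun_eq_iff)
qed simp

text \<open>The constants depend on \<mu> alone, so the locale is interpreted at a trivial memory to
  obtain their properties.\<close>

lemma coloring_constants:
  assumes "\<mu> > 1"
  shows "0 < coloring_level.q \<mu>" "2 * coloring_level.q \<mu> < 1" "coloring_level.\<alpha> \<mu> > 0"
proof -
  interpret coloring_level \<mu> empty_mem 0
    by unfold_locales (use assms in \<open>auto simp: empty_mem_def\<close>)
  show "0 < q" "2 * q < 1" "\<alpha> > 0"
    using q alpha by auto
qed

context dec_adg_coloring
begin

text \<open>Every vertex lies in exactly one level: the emptiness of \<open>U_of sA\<close> leaves
  no vertex of the graph at level 0.\<close>

lemma sum_levels: "(\<Sum>i\<in>{1..<lev_of sA}. \<Sum>v\<in>level i. 1 + deg v) \<le> real n + 2 * real (card E)"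
proof -
  have rho: "rho_of sA v > 0 \<and> rho_of sA v < lev_of sA" if "v < n" for v
    using sA(1,2) that by (auto simp: adg_inv_def)
  have "level i = {v \<in> {..<n}. rho_of sA v = i}" if "i \<in> {1..<lev_of sA}" for i
    using level_sub[of i] that by (auto simp: level_def)
  then have "(\<Sum>i\<in>{1..<lev_of sA}. \<Sum>v\<in>level i. 1 + deg v) =
      (\<Sum>i\<in>{1..<lev_of sA}. \<Sum>v\<in>{v \<in> {..<n}. rho_of sA v = i}. 1 + deg v)"
    by (intro sum.cong) auto
  also have "\<dots> = (\<Sum>v<n. 1 + deg v)"
    by (rule sum.group) (use rho in \<open>auto simp: Suc_le_eq\<close>)
  also have "\<dots> = real n + real (\<Sum>v<n. card (nbhd E {..<n} v))"
    by (simp add: sum.distrib length_nbrs)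
  also have "real (\<Sum>v<n. card (nbhd E {..<n} v)) \<le> real (2 * card E)"
    using sum_card_nbhd_le_edges[of "{..<n}"] by (intro of_nat_mono) auto
  finally show ?thesis
    by simp
qed

text \<open>The exponents of the levels add up. Besides its size each level costs 6 units, harmless
  because there are at most \<open>n\<close> levels.\<close>

lemma mgf_outer_loop_work:
  assumes \<theta>: "\<theta> > 0" "\<And>v. 2 * \<theta> * coloring_level.\<alpha> \<mu> * (1 + real (length (nb_of sA v))) \<le> 1 - 2 * coloring_level.q \<mu>"
  shows "mgf \<theta> 0 (outer_loop sA) (\<lambda>_. 1) \<le>
    ennreal (exp (\<theta> * (1 + 6 * real (lev_of sA - 1) + (3 + coloring_level.\<alpha> \<mu>) * (real n + 2 * real (card E)))))"
proof -
  define \<alpha> where "\<alpha> = coloring_level.\<alpha> \<mu>"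
  have \<alpha>: "\<alpha> > 0"
    using coloring_constants[OF mu] by (simp add: \<alpha>_def)
  define D where "D i = (\<Sum>v\<in>level i. 1 + deg v)" for i
  define \<Gamma> where "\<Gamma> i = exp (\<theta> * (\<alpha> * D i + 1))" for i
  have "mgf \<theta> 0 (outer_loop sA) (\<lambda>_. 1) \<le>
    ennreal (exp \<theta> * (\<Prod>i\<in>{1..<lev_of sA}. exp (\<theta> * (5 + 3 * (\<Sum>v\<in>level i. 1 + deg v)) + 0 * (10 + 2 * real k)) * \<Gamma> i))"
  proof (rule mgf_outer_loop)
    fix s0 i assume i: "1 \<le> i" and lvl: "coloring_level \<mu> s0 k'" and inv: "sim_inv s0 s0"
      and U: "U_of s0 = level i" and nb: "nb_of s0 = nb_of sA"
    have w: "coloring_level.weight s0 v = 1 + real (length (nb_of sA v))" for v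
      by (simp add: coloring_level.weight_def[OF lvl] nb)
    have "mgf \<theta> 0 (coloring_level.coloring_loop \<mu> s0) (\<lambda>s. if sim_inv s0 s \<and> U_of s = {} then 1 else \<infinity>)
        \<le> ennreal (exp (\<theta> * (\<alpha> * (\<Sum>v\<in>U_of s0. coloring_level.weight s0 v) + 1)))"
      unfolding \<alpha>_def by (rule coloring_level.mgf_coloring_loop_work[OF lvl inv \<theta>(1)]) (use \<theta>(2) in \<open>simp add: w\<close>)
    also have "\<dots> \<le> ennreal (\<Gamma> i)"
    proof -
      have "(\<Sum>v\<in>U_of s0. coloring_level.weight s0 v) \<le> D i"
        unfolding D_def U w using nb_sA[OF i] by (intro sum_mono) simp
      then show ?thesis
        unfolding \<Gamma>_def using \<theta>(1) \<alpha> by (intro ennreal_leI) simp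
    qed
    finally show "mgf \<theta> 0 (coloring_level.coloring_loop \<mu> s0) (\<lambda>s. if sim_inv s0 s \<and> U_of s = {} then 1 else \<infinity>) \<le> ennreal (\<Gamma> i)" .
  qed (use \<theta>(1) in \<open>auto simp: \<Gamma>_def\<close>)
  also have "exp \<theta> * (\<Prod>i\<in>{1..<lev_of sA}. exp (\<theta> * (5 + 3 * (\<Sum>v\<in>level i. 1 + deg v)) + 0 * (10 + 2 * real k)) * \<Gamma> i)
      = exp (\<theta> * (1 + (\<Sum>i\<in>{1..<lev_of sA}. 6 + (3 + \<alpha>) * D i)))"
  proof -
    have "exp (\<theta> * (5 + 3 * D i) + 0 * (10 + 2 * real k)) * \<Gamma> i = exp (\<theta> * (6 + (3 + \<alpha>) * D i))" for i
      unfolding \<Gamma>_def exp_add[symmetric] by (simp add: algebra_simps)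
    then show ?thesis
      unfolding D_def[symmetric] by (simp add: exp_sum sum_distrib_left exp_add distrib_left)
  qed
  also have "(\<Sum>i\<in>{1..<lev_of sA}. 6 + (3 + \<alpha>) * D i) = 6 * real (lev_of sA - 1) + (3 + \<alpha>) * (\<Sum>i\<in>{1..<lev_of sA}. D i)"
    by (simp add: sum.distrib sum_distrib_left)
  also have "ennreal (exp (\<theta> * (1 + \<dots>))) \<le> ennreal (exp (\<theta> * (1 + 6 * real (lev_of sA - 1) + (3 + \<alpha>) * (real n + 2 * real (card E)))))"
  proof -
    have "(3 + \<alpha>) * (\<Sum>i\<in>{1..<lev_of sA}. D i) \<le> (3 + \<alpha>) * (real n + 2 * real (card E))"
      using sum_levels \<alpha> unfolding D_def by (intro mult_left_mono) auto
    then show ?thesis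
      using \<theta>(1) by (intro ennreal_leI) (simp add: add.assoc)
  qed
  finally show ?thesis
    unfolding \<alpha>_def .
qed

text \<open>Replacing the size of every level by \<open>n\<close> is crude but affordable, as it
  enters the exponent only through its logarithm.\<close>

lemma mgf_outer_loop_depth:
  assumes b: "b \<ge> 0" and \<beta>: "\<beta> = exp (b * (12 + 2 * real k'))" "2 * coloring_level.q \<mu> * \<beta> < 1"
  shows "mgf 0 b (outer_loop sA) (\<lambda>_. 1) \<le>
    ennreal ((exp (b * (10 + 2 * real k)) * (1 + (\<beta> - 1) / (1 - 2 * coloring_level.q \<mu> * \<beta>) * real n)) ^ (lev_of sA - 1))"
proof -
  define A where "A = (\<beta> - 1) / (1 - 2 * coloring_level.q \<mu> * \<beta>)"
  have A: "A \<ge> 0"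
    using \<beta> b by (auto simp: A_def intro!: divide_nonneg_pos)
  define \<Gamma> where "\<Gamma> i = 1 + A * real (card (level i))" for i
  have pos: "\<Gamma> i > 0" for i
    using A by (simp add: \<Gamma>_def add_pos_nonneg)
  have "mgf 0 b (outer_loop sA) (\<lambda>_. 1) \<le>
    ennreal (exp 0 * (\<Prod>i\<in>{1..<lev_of sA}. exp (0 * (5 + 3 * (\<Sum>v\<in>level i. 1 + deg v)) + b * (10 + 2 * real k)) * \<Gamma> i))"
  proof (rule mgf_outer_loop)
    fix s0 i assume lvl: "coloring_level \<mu> s0 k'" and inv: "sim_inv s0 s0" and U: "U_of s0 = level i"
    show "mgf 0 b (coloring_level.coloring_loop \<mu> s0) (\<lambda>s. if sim_inv s0 s \<and> U_of s = {} then 1 else \<infinity>) \<le> ennreal (\<Gamma> i)"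
      using coloring_level.mgf_coloring_loop_depth[OF lvl inv b \<beta>] by (simp add: \<Gamma>_def A_def U)
  qed (use b pos in auto)
  also have "exp 0 * (\<Prod>i\<in>{1..<lev_of sA}. exp (0 * (5 + 3 * (\<Sum>v\<in>level i. 1 + deg v)) + b * (10 + 2 * real k)) * \<Gamma> i)
      \<le> (\<Prod>i\<in>{1..<lev_of sA}. exp (b * (10 + 2 * real k)) * (1 + A * real n))"
  proof -
    have "\<Gamma> i \<le> 1 + A * real n" if "1 \<le> i" for i
      using card_mono[OF _ level_sub[OF that]] A by (simp add: \<Gamma>_def mult_left_mono)
    then show ?thesis
      unfolding exp_zero mult_1_left mult_zero_left add_0_left
      by (intro prod_mono conjI mult_left_mono mult_nonneg_nonneg) (use pos in \<open>auto simp: less_imp_le\<close>)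
  qed
  finally show ?thesis
    by (simp add: A_def ennreal_leI)
qed

end

context dec_adg_run
begin

definition init_colors :: cmd where
  "init_colors = par_list (\<lambda>_. [0..<n]) (\<lambda>v. atomic (\<lambda>s.
       s\<lparr>B_of := (B_of s)(v := {}), C_of := (C_of s)(v := 0)\<rparr>))"

lemma runs_adg:
  assumes n1: "n \<ge> 1"
  obtains s0 sA where "runs init_colors empty_mem s0 (1 + real n) 1"
    "runs (adg \<eta> n G) s0 sA (3 + real n + 17 * ((1 + \<eta>) / \<eta>) * real n + 4 * real (card E))
      (3 + (4 * real k + 15) * real (lev_of sA - 1))"
    "adg_inv sA" "U_of sA = {}" "\<And>v. B_of sA v = {}" "lev_of sA - 1 \<le> n"
    "(1 + \<eta>) ^ (lev_of sA - 1) \<le> (1 + \<eta>) * real n"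
proof -
  define s0 where "s0 = empty_mem\<lparr>B_of := \<lambda>_. {}, C_of := \<lambda>_. 0\<rparr>"
  have r0: "runs init_colors empty_mem s0 (1 + real n) 1"
  proof -
    have "runs init_colors empty_mem
        (fold (\<lambda>v s. s\<lparr>B_of := (B_of s)(v := {}), C_of := (C_of s)(v := 0)\<rparr>) [0..<n] empty_mem) (1 + real n) 1"
      using runs_par_list_atomic[of "\<lambda>_. [0..<n]" "\<lambda>v s. s\<lparr>B_of := (B_of s)(v := {}), C_of := (C_of s)(v := 0)\<rparr>" empty_mem]
      by (simp add: init_colors_def)
    then show ?thesis
      unfolding fold_init_colors by (simp add: s0_def empty_mem_def cong: if_cong)
  qed
  define s1 where "s1 = s0\<lparr>U_of := {..<n}, D_of := \<lambda>v. if v < n then int (csr_off G ! Suc v) - int (csr_off G ! v) else 0\<rparr>"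
  define s2 where "s2 = s1\<lparr>lev_of := 1\<rparr>"
  have r1: "runs (par_list (\<lambda>_. [0..<n]) (\<lambda>v. atomic (\<lambda>s.
       s\<lparr>U_of := insert v (U_of s),
         D_of := (D_of s)(v := int (csr_off G ! Suc v) - int (csr_off G ! v))\<rparr>))) s0 s1 (1 + real n) 1"
  proof -
    have "runs (par_list (\<lambda>_. [0..<n]) (\<lambda>v. atomic (\<lambda>s.
       s\<lparr>U_of := insert v (U_of s),
         D_of := (D_of s)(v := int (csr_off G ! Suc v) - int (csr_off G ! v))\<rparr>))) s0
        (fold (\<lambda>v s. s\<lparr>U_of := insert v (U_of s), D_of := (D_of s)(v := int (csr_off G ! Suc v) - int (csr_off G ! v))\<rparr>) [0..<n] s0) (1 + real n) 1"
      using runs_par_list_atomic[of "\<lambda>_. [0..<n]" "\<lambda>v s. s\<lparr>U_of := insert v (U_of s), D_of := (D_of s)(v := int (csr_off G ! Suc v) - int (csr_off G ! v))\<rparr>" s0]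
      by simp
    moreover have "U_of s0 = {}" "D_of s0 = (\<lambda>_. 0)"
      by (simp_all add: s0_def empty_mem_def)
    ultimately show ?thesis
      unfolding fold_init_vertices by (simp add: s1_def atLeast0LessThan cong: if_cong)
  qed
  have r2: "runs (atomic (\<lambda>s. s\<lparr>lev_of := 1\<rparr>)) s1 s2 1 0"
    using runs_atomic[of "\<lambda>s. s\<lparr>lev_of := 1\<rparr>" s1] by (simp add: s2_def)
  have U2: "U_of s2 = {..<n}" "lev_of s2 = 1" "rho_of s2 = (\<lambda>_. 0)" "R_of s2 = (\<lambda>_. {})" "nb_of s2 = (\<lambda>_. [])" "B_of s2 = (\<lambda>_. {})"
    "D_of s2 = (\<lambda>v. if v < n then int (csr_off G ! Suc v) - int (csr_off G ! v) else 0)"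
    by (simp_all add: s2_def s1_def s0_def empty_mem_def)
  have inv: "adg_inv s2"
    unfolding adg_inv_def U2 using eta by (auto simp: csr_off_diff fun_eq_iff)
  \<comment> \<open>For \<open>n = 0\<close> the bound on the number of levels would read 1 \<le>
    0.\<close>
  have "U_of s2 \<noteq> {}"
    using n1 by (simp add: U2 lessThan_empty_iff)
  then obtain sA where A: "runs (while_cmd (\<lambda>s. U_of s \<noteq> {}) adg_body) s2 sA
      (17 * ((1 + \<eta>) / \<eta>) * real (card (U_of s2)) + 2 * (\<Sum>v\<in>U_of s2. real (length (nbrs G v))) + 1)
      ((4 * real k + 15) * real (lev_of sA - lev_of s2))"
    "adg_inv sA" "U_of sA = {}" "B_of sA = B_of s2" "lev_of sA - lev_of s2 \<le> card (U_of s2)"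
    "(1 + \<eta>) ^ (lev_of sA - lev_of s2) \<le> (1 + \<eta>) * real (card (U_of s2))"
    using adg_loop[OF inv] by blast
  have "runs (adg \<eta> n G) s0 sA (3 + real n + 17 * ((1 + \<eta>) / \<eta>) * real n + 4 * real (card E))
      (3 + (4 * real k + 15) * real (lev_of sA - 1))"
    unfolding adg_def adg_init_def adg_body_def[symmetric]
  proof (rule runs_mono[OF runs_seq[OF runs_seq[OF r1 r2] A(1)]])
    have "(\<Sum>v<n. real (length (nbrs G v))) = real (\<Sum>v<n. card (nbhd E {..<n} v))"
      by (simp add: length_nbrs)
    also have "\<dots> \<le> real (2 * card E)"
      using sum_card_nbhd_le_edges[of "{..<n}"] by (intro of_nat_mono) auto
    finally have "(\<Sum>v<n. real (length (nbrs G v))) \<le> 2 * real (card E)"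
      by simp
    then show "1 + real n + 1 + (17 * ((1 + \<eta>) / \<eta>) * real (card (U_of s2)) + 2 * (\<Sum>v\<in>U_of s2. real (length (nbrs G v))) + 1)
        \<le> 3 + real n + 17 * ((1 + \<eta>) / \<eta>) * real n + 4 * real (card E)"
      by (simp add: U2)
  qed (simp add: U2)
  then show ?thesis
    using r0 A(2-) by (intro that[of s0 sA]) (auto simp: U2)
qed

end

section \<open>Tail bounds\<close>

lemma emeasure_cost_tail:
  assumes "mgf a b p (\<lambda>_. 1) \<le> ennreal M"
  shows "emeasure (measure_spmf p) {(s, t). a * real (work t) + b * real (dep t) > Y} \<le> ennreal (M * exp (- Y))"
proof -
  have "emeasure (measure_spmf p) {(s, t). a * real (work t) + b * real (dep t) > Y}
      = (\<integral>\<^sup>+x. indicator {(s, t). a * real (work t) + b * real (dep t) > Y} x \<partial>measure_spmf p)"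
    by simp
  also have "\<dots> \<le> (\<integral>\<^sup>+x. (case x of (s, t) \<Rightarrow> ennreal (exp (a * real (work t) + b * real (dep t))) * 1) * ennreal (exp (- Y)) \<partial>measure_spmf p)"
  proof (rule nn_integral_mono, clarify)
    fix s t
    show "indicator {(s, t). a * real (work t) + b * real (dep t) > Y} (s, t)
        \<le> ennreal (exp (a * real (work t) + b * real (dep t))) * 1 * ennreal (exp (- Y))"
      by (auto simp: indicator_def ennreal_mult'[symmetric] exp_add[symmetric] ennreal_ge_1)
  qed
  also have "\<dots> = mgf a b p (\<lambda>_. 1) * ennreal (exp (- Y))"
    unfolding mgf_def by (rule nn_integral_multc) simp
  also have "\<dots> \<le> ennreal M * ennreal (exp (- Y))"
    by (rule mult_right_mono[OF assms]) simp
  finally show ?thesis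
    by (simp add: ennreal_mult'')
qed

text \<open>A union bound that needs total mass 1: mass lost to divergence would lie in neither
  tail.\<close>

lemma measure_ge_of_tails:
  assumes "lossless_spmf p"
    and "emeasure (measure_spmf p) A \<le> ennreal x" "emeasure (measure_spmf p) B \<le> ennreal y" "x \<ge> 0" "y \<ge> 0"
    and "UNIV - A - B \<subseteq> S"
  shows "measure (measure_spmf p) S \<ge> 1 - (x + y)"
proof -
  have m: "measure (measure_spmf p) A \<le> x" "measure (measure_spmf p) B \<le> y"
    using assms by (auto simp: measure_spmf.emeasure_eq_measure)
  have "1 = measure (measure_spmf p) UNIV"
    using assms(1) by (simp add: lossless_spmf_def weight_spmf_def space_measure_spmf)
  also have "\<dots> \<le> measure (measure_spmf p) (S \<union> (A \<union> B))"
    using assms(6) by (intro measure_spmf.finite_measure_mono) auto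
  also have "\<dots> \<le> measure (measure_spmf p) S + measure (measure_spmf p) (A \<union> B)"
    by (rule measure_Un_le) auto
  also have "measure (measure_spmf p) (A \<union> B) \<le> measure (measure_spmf p) A + measure (measure_spmf p) B"
    by (rule measure_Un_le) auto
  finally show ?thesis
    using m by linarith
qed


lemma (in dec_adg_run) mgf_dec_adg:
  assumes \<epsilon>: "\<eta> = \<epsilon> / 12" "\<mu> = \<epsilon> / 4" and mu: "\<mu> > 1" and k': "(1 + \<eta>) * (2 * real degen) \<le> 2 ^ k'" and n1: "n \<ge> 1"
  obtains sA where "dec_adg_coloring n E G \<eta> k \<mu> k' sA" "lev_of sA - 1 \<le> n"
    "(1 + \<eta>) ^ (lev_of sA - 1) \<le> (1 + \<eta>) * real n"
    "lossless_spmf (dec_adg \<epsilon> n G)"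
    "\<And>a b. a \<ge> 0 \<Longrightarrow> b \<ge> 0 \<Longrightarrow> mgf a b (dec_adg \<epsilon> n G) (\<lambda>_. 1) \<le>
      ennreal (exp (a * (4 + 2 * real n + 17 * ((1 + \<eta>) / \<eta>) * real n + 4 * real (card E)) + b * (6 + (4 * real k + 15) * real (lev_of sA - 1)))) *
      mgf a b (while_cmd (\<lambda>s. lev_of s > 1) (dec_adg_coloring.level_body G \<mu>) sA) (\<lambda>_. 1)"
proof (rule runs_adg[OF n1])
  fix s0 sA
  assume r0: "runs init_colors empty_mem s0 (1 + real n) 1"
    and r1: "runs (adg \<eta> n G) s0 sA (3 + real n + 17 * ((1 + \<eta>) / \<eta>) * real n + 4 * real (card E))
      (3 + (4 * real k + 15) * real (lev_of sA - 1))"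
    and A: "adg_inv sA" "U_of sA = {}" "\<And>v. B_of sA v = {}" "lev_of sA - 1 \<le> n"
    "(1 + \<eta>) ^ (lev_of sA - 1) \<le> (1 + \<eta>) * real n"
  interpret dec_adg_coloring n E G \<eta> k \<mu> k' sA
    by unfold_locales (use mu k' A in auto)
  have cmd: "dec_adg_cmd \<epsilon> n G = (init_colors ;; adg \<eta> n G ;; outer_loop)"
    unfolding dec_adg_cmd_def init_colors_def level_body_def unfolding \<epsilon> ..
  show thesis
  proof (rule that[OF dec_adg_coloring_axioms A(4,5)])
    show "lossless_spmf (dec_adg \<epsilon> n G)"
      unfolding dec_adg_def cmd
      by (rule lossless_seq_runs[OF r0], rule lossless_seq_runs[OF r1], rule lossless_outer_loop)
    fix a b :: real assume ab: "a \<ge> 0" "b \<ge> 0"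
    let ?x0 = "a * (1 + real n) + b * (1 + 1)"
      and ?x1 = "a * (3 + real n + 17 * ((1 + \<eta>) / \<eta>) * real n + 4 * real (card E)) + b * (3 + (4 * real k + 15) * real (lev_of sA - 1) + 1)"
    have "mgf a b (dec_adg \<epsilon> n G) (\<lambda>_. 1) \<le> ennreal (exp ?x0) * (ennreal (exp ?x1) * mgf a b (outer_loop sA) (\<lambda>_. 1))"
      unfolding dec_adg_def cmd
      by (rule order_trans[OF mgf_seq_runs[OF r0 ab]], rule mult_left_mono, rule mgf_seq_runs[OF r1 ab]) simp
    also have "\<dots> = ennreal (exp (?x0 + ?x1)) * mgf a b (outer_loop sA) (\<lambda>_. 1)"
      by (simp only: mult.assoc[symmetric] ennreal_mult[symmetric] exp_ge_zero exp_add[symmetric])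
    also have "?x0 + ?x1 = a * (4 + 2 * real n + 17 * ((1 + \<eta>) / \<eta>) * real n + 4 * real (card E)) + b * (6 + (4 * real k + 15) * real (lev_of sA - 1))"
      by (simp add: distrib_left add_ac)
    finally show "mgf a b (dec_adg \<epsilon> n G) (\<lambda>_. 1) \<le>
      ennreal (exp (a * (4 + 2 * real n + 17 * ((1 + \<eta>) / \<eta>) * real n + 4 * real (card E)) + b * (6 + (4 * real k + 15) * real (lev_of sA - 1)))) *
      mgf a b (outer_loop sA) (\<lambda>_. 1)" .
  qed
qed

section \<open>Logarithms and numerical estimates\<close>

lemma ln_le_lg: "1 \<le> n \<Longrightarrow> ln (real n) \<le> lg n"
proof -
  assume n: "1 \<le> n"
  have "ln (real n) * ln 2 \<le> ln (real n) * 1"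
    using n ln_le_minus_one[of "2::real"] by (intro mult_left_mono) auto
  then have "ln (real n) \<le> log 2 (real n)"
    by (simp add: log_def field_simps)
  then show ?thesis
    by (simp add: lg_def)
qed

lemma lg_ge_1: "lg n \<ge> 1"
  by (simp add: lg_def)

lemma exists_power2_ge:
  assumes "0 \<le> x"
  obtains k where "x \<le> 2 ^ k" "real k \<le> 1 + log 2 (max 1 x)"
proof
  let ?k = "nat \<lceil>log 2 (max 1 x)\<rceil>"
  have nonneg: "0 \<le> log 2 (max 1 x)"
    by (simp add: zero_le_log_cancel_iff)
  have "x \<le> 2 powr (log 2 (max 1 x))"
    by simp
  also have "\<dots> \<le> 2 powr (real ?k)"
    using nonneg by (intro powr_mono) (auto simp: of_nat_ceiling)
  also have "\<dots> = 2 ^ ?k"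
    by (rule powr_realpow) simp
  finally show "x \<le> 2 ^ ?k" .
  show "real ?k \<le> 1 + log 2 (max 1 x)"
    using nonneg by linarith
qed

text \<open>The extra unit in \<open>c1\<close> buys a factor 1 / n \<le> 1/2, so that two tails fit
  into one. The absolute value keeps \<open>c1\<close> positive for negative
  \<open>c\<close>.\<close>

lemma powr_tail_half:
  assumes "n \<ge> 2" "c1 = \<bar>c\<bar> + 1"
  shows "exp (- (c1 * ln (real n))) \<le> real n powr (- c) / 2"
proof -
  have "exp (- (c1 * ln (real n))) = real n powr (- c1)"
    using assms by (simp add: powr_def algebra_simps)
  also have "\<dots> \<le> real n powr (- c - 1)"
    using assms by (intro powr_mono) auto
  also have "\<dots> = real n powr (- c) / real n"
    using assms by (simp add: powr_diff)
  also have "\<dots> \<le> real n powr (- c) / 2"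
    using assms by (intro divide_left_mono) auto
  finally show ?thesis .
qed

text \<open>Per level, 4 k + 15 comes from ADG and 2 k + 10 from the coloring; their sum 6 k + 25 is
  at most 37 g. The O(g) levels times O(g) each, from this and from ln (1 + A n), give the
  square.\<close>

lemma depth_moment_bound:
  fixes b A g KL :: real and n k L :: nat
  assumes b: "0 \<le> b" "b \<le> b1" and A: "A \<ge> 0" and n: "n \<ge> 1" and k: "real k \<le> 2 * g"
    and L: "real L \<le> KL * g" and g: "g \<ge> 1" "ln (real n) \<le> g"
  shows "exp (b * (6 + (4 * real k + 15) * real L)) * (exp (b * (10 + 2 * real k)) * (1 + A * real n)) ^ L
    \<le> exp ((b1 * (6 + 37 * KL) + KL * (ln (1 + A) + 1)) * g\<^sup>2)"
proof -
  have pos: "1 + A * real n > 0"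
    using A by (simp add: add_pos_nonneg)
  have KL: "KL * g \<ge> 0"
    using L of_nat_0_le_iff[of L, where 'a = real] by linarith
  have "(exp (b * (10 + 2 * real k)) * (1 + A * real n)) ^ L = exp (real L * (b * (10 + 2 * real k) + ln (1 + A * real n)))"
    using pos by (simp add: exp_of_nat_mult exp_add)
  then have "exp (b * (6 + (4 * real k + 15) * real L)) * (exp (b * (10 + 2 * real k)) * (1 + A * real n)) ^ L
      = exp (b * (6 + real L * (6 * real k + 25)) + real L * ln (1 + A * real n))"
    by (simp add: exp_add[symmetric] algebra_simps)
  also have "\<dots> \<le> exp ((b1 * (6 + 37 * KL) + KL * (ln (1 + A) + 1)) * g\<^sup>2)"
  proof -
    have "real L * (6 * real k + 25) \<le> (KL * g) * (37 * g)"
      using L k g KL by (intro mult_mono) auto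
    moreover have "1 \<le> g * g"
      using g mult_mono[of 1 g 1 g] by simp
    ultimately have "6 + real L * (6 * real k + 25) \<le> (6 + 37 * KL) * g\<^sup>2"
      by (simp add: power2_eq_square algebra_simps)
    then have 1: "b * (6 + real L * (6 * real k + 25)) \<le> b1 * ((6 + 37 * KL) * g\<^sup>2)"
      using b by (intro mult_mono) auto
    have "1 + A * real n \<le> (1 + A) * real n"
      using n by (simp add: algebra_simps)
    then have "ln (1 + A * real n) \<le> ln ((1 + A) * real n)"
      using pos by (intro ln_mono) auto
    also have "\<dots> = ln (1 + A) + ln (real n)"
      using A n by (intro ln_mult_pos) auto
    also have "\<dots> \<le> ln (1 + A) * g + g"
      using g A mult_left_mono[of 1 g "ln (1 + A)"] by (intro add_mono) auto
    finally have "ln (1 + A * real n) \<le> (ln (1 + A) + 1) * g"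
      by (simp add: algebra_simps)
    moreover have "ln (1 + A * real n) \<ge> 0"
      using A by simp
    ultimately have "real L * ln (1 + A * real n) \<le> (KL * g) * ((ln (1 + A) + 1) * g)"
      using L KL by (intro mult_mono) auto
    with 1 show ?thesis
      by (simp add: power2_eq_square algebra_simps)
  qed
  finally show ?thesis .
qed

lemma level_count_bound:
  fixes \<eta> g :: real
  assumes "\<eta> > 0" "n \<ge> 1" "(1 + \<eta>) ^ L \<le> (1 + \<eta>) * real n" "ln (real n) \<le> g" "g \<ge> 1"
  shows "real L \<le> (1 + 1 / ln (1 + \<eta>)) * g"
proof -
  have l: "ln (1 + \<eta>) > 0"
    using assms by simp
  have "ln ((1 + \<eta>) ^ L) \<le> ln ((1 + \<eta>) * real n)"
    using assms by (intro ln_mono) auto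
  then have "real L * ln (1 + \<eta>) \<le> ln (1 + \<eta>) + g"
    using assms by (simp add: ln_realpow ln_mult_pos)
  then have "real L \<le> 1 + g / ln (1 + \<eta>)"
    using l by (simp add: field_simps)
  also have "\<dots> \<le> (1 + 1 / ln (1 + \<eta>)) * g"
    using assms by (simp add: algebra_simps)
  finally show ?thesis .
qed

text \<open>Brings the exponent \<open>k'\<close> down to log d; the lower limit 1 in
  \<open>lg\<close> covers \<open>d = 0\<close>.\<close>

lemma log_palette_bound:
  fixes \<eta> :: real
  assumes "\<eta> > 0"
  shows "1 + log 2 (max 1 ((1 + \<eta>) * (2 * real d))) \<le> (3 + log 2 (1 + \<eta>)) * lg d"
proof -
  have l: "log 2 (1 + \<eta>) \<ge> 0"
    using assms by simp
  have "max 1 ((1 + \<eta>) * (2 * real d)) \<le> (1 + \<eta>) * (2 * max 1 (real d))"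
  proof (cases "d = 0")
    case False
    then have "1 * 1 \<le> (1 + \<eta>) * (2 * real d)"
      using assms by (intro mult_mono) auto
    with False show ?thesis
      by simp
  qed (use assms in auto)
  then have "log 2 (max 1 ((1 + \<eta>) * (2 * real d))) \<le> log 2 ((1 + \<eta>) * (2 * max 1 (real d)))"
    using assms by (subst log_le_cancel_iff) auto
  also have "\<dots> = log 2 (1 + \<eta>) + (1 + log 2 (max 1 (real d)))"
    using assms by (simp add: log_mult_pos)
  also have "log 2 (max 1 (real d)) \<le> lg d"
    by (cases "d = 0") (auto simp: lg_def max_def)
  finally have "1 + log 2 (max 1 ((1 + \<eta>) * (2 * real d))) \<le> 2 + log 2 (1 + \<eta>) + lg d"
    by simp
  also have "\<dots> \<le> (3 + log 2 (1 + \<eta>)) * lg d"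
    using mult_left_mono[OF lg_ge_1[of d], of "2 + log 2 (1 + \<eta>)"] l by (simp add: algebra_simps)
  finally show ?thesis .
qed

theorem lemma12:
  fixes \<epsilon> c :: real
  assumes "\<epsilon> > 4"
  shows "\<exists>K>0. \<forall>n E G. n \<ge> 1 \<and> simple_graph {..<n} E \<and> csr_of n E G \<longrightarrow>
    measure (measure_spmf (dec_adg \<epsilon> n G))
      {(s, t). real (depth t) \<le> K * (lg (degeneracy {..<n} E) * (lg n)\<^sup>2) \<and>
               real (work t) \<le> K * (real n + real (card E))}
      \<ge> 1 - real n powr (-c)"
proof -
  define \<eta> where "\<eta> = \<epsilon> / 12"
  define \<mu> where "\<mu> = \<epsilon> / 4"
  have eta: "\<eta> > 0" and mu: "\<mu> > 1"
    using assms by (auto simp: \<eta>_def \<mu>_def)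
  define q where "q = coloring_level.q \<mu>"
  define \<alpha> where "\<alpha> = coloring_level.\<alpha> \<mu>"
  have q: "0 < q" "2 * q < 1" and alpha: "\<alpha> > 0"
    using coloring_constants[OF mu] by (auto simp: q_def \<alpha>_def)
  define c1 where "c1 = \<bar>c\<bar> + 1"
  have c1: "c1 > 0"
    by (simp add: c1_def)
  \<comment> \<open>With 1 and the number of levels at most n, the coefficients 4 + 1, 2, 6 and 3 of
    n add up to 16; the 10 for the edges is smaller. The rest comes from ADG and from \<alpha> (n +
    2 m).\<close>
  define K3 where "K3 = 16 + 17 * ((1 + \<eta>) / \<eta>) + 2 * \<alpha>"
  \<comment> \<open>Solves 2 \<theta> \<alpha> w = 1 - 2 q for w = (3 + 2 \<eta>) y and \<theta> =
    \<theta>0 / y, where y = sqrt (n + m) and w bounds all weights.\<close>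
  define \<theta>0 where "\<theta>0 = (1 - 2 * q) / (2 * \<alpha> * (3 + 2 * \<eta>))"
  have \<theta>0: "\<theta>0 > 0"
    using q alpha eta by (simp add: \<theta>0_def)
  \<comment> \<open>K3 covers the moment; the second term covers the tail, through ln n \<le> 2 y
    and \<theta> y = \<theta>0.\<close>
  define KW where "KW = K3 + 2 * c1 / \<theta>0"
  \<comment> \<open>The midpoint between 1 and 1 / (2 q).\<close>
  define \<beta> where "\<beta> = (1 + 2 * q) / (4 * q)"
  have \<beta>: "\<beta> > 1" "2 * q * \<beta> < 1"
    using q by (auto simp: \<beta>_def field_simps)
  define A where "A = (\<beta> - 1) / (1 - 2 * q * \<beta>)"
  have A: "A \<ge> 0"
    using \<beta> by (simp add: A_def)
  define KL where "KL = 1 + 1 / ln (1 + \<eta>)"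
  define K' where "K' = 3 + log 2 (1 + \<eta>)"
  have K': "K' > 0"
    using eta by (simp add: K'_def add_pos_nonneg)
  define K2 where "K2 = ln \<beta> * (6 + 37 * KL) + KL * (ln (1 + A) + 1)"
  \<comment> \<open>A lower bound for b lg d that is independent of the graph, as 12 + 2 k' is at
    most (12 + 2 K') lg d.\<close>
  define b0 where "b0 = ln \<beta> / (12 + 2 * K')"
  have b0: "b0 > 0"
    using \<beta> K' by (simp add: b0_def)
  \<comment> \<open>K2 cancels the moment and c1 pays for the tail.\<close>
  define KD where "KD = (K2 + c1) / b0"
  define K where "K = max 1 (max KW KD)"
  have K: "K > 0" "KW \<le> K" "KD \<le> K"
    by (auto simp: K_def)
  have main: "measure (measure_spmf (dec_adg \<epsilon> n G))
      {(s, t). real (depth t) \<le> K * (lg (degeneracy {..<n} E) * (lg n)\<^sup>2) \<and>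
               real (work t) \<le> K * (real n + real (card E))}
      \<ge> 1 - real n powr (-c)" if n2: "n \<ge> 2" and G: "simple_graph {..<n} E" "csr_of n E G" for n E G
  proof -
    obtain k where k: "real n \<le> 2 ^ k" "real k \<le> 1 + log 2 (max 1 (real n))"
      using exists_power2_ge[of "real n"] by auto
    define d where "d = degeneracy {..<n} E"
    have "0 \<le> (1 + \<eta>) * (2 * real d)"
      using eta by simp
    from exists_power2_ge[OF this] obtain k' where k': "(1 + \<eta>) * (2 * real d) \<le> 2 ^ k'" "real k' \<le> 1 + log 2 (max 1 ((1 + \<eta>) * (2 * real d)))"
      by blast
    have "real n \<le> real (2 ^ k)"
      using k(1) by simp
    then have "n \<le> 2 ^ k"
      by (simp only: of_nat_le_iff)
    then interpret dec_adg_run n E G \<eta> k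
      by unfold_locales (rule G eta | assumption)+
    define N where "N = real n + real (card E)"
    define g where "g = lg n"
    have g: "g \<ge> 1" "ln (real n) \<le> g"
      using lg_ge_1 ln_le_lg n2 by (auto simp: g_def)
    have k_g: "real k \<le> 2 * g"
    proof -
      have "max 1 (real n) = real n" "log 2 (real n) \<le> g"
        using n2 by (simp_all add: g_def lg_def)
      then show ?thesis
        using k(2) g(1) by simp
    qed
    have k'_d: "real k' \<le> K' * lg d"
      using k'(2) log_palette_bound[OF eta, of d] by (simp add: K'_def)
    let ?p = "dec_adg \<epsilon> n G"
    show ?thesis
    proof (rule mgf_dec_adg[OF \<eta>_def \<mu>_def mu k'(1)[unfolded d_def]])
      show "n \<ge> 1"
        using n2 by simp
      fix sA
      assume "dec_adg_coloring n E G \<eta> k \<mu> k' sA"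
        and L: "lev_of sA - 1 \<le> n" "(1 + \<eta>) ^ (lev_of sA - 1) \<le> (1 + \<eta>) * real n"
        and lossless: "lossless_spmf ?p"
        and mgf_le: "\<And>a b. a \<ge> 0 \<Longrightarrow> b \<ge> 0 \<Longrightarrow> mgf a b ?p (\<lambda>_. 1) \<le>
          ennreal (exp (a * (4 + 2 * real n + 17 * ((1 + \<eta>) / \<eta>) * real n + 4 * real (card E)) + b * (6 + (4 * real k + 15) * real (lev_of sA - 1)))) *
          mgf a b (while_cmd (\<lambda>s. lev_of s > 1) (dec_adg_coloring.level_body G \<mu>) sA) (\<lambda>_. 1)"
      interpret dec_adg_coloring n E G \<eta> k \<mu> k' sA
        by fact
      define L where "L = lev_of sA - 1"
      have LK: "real L \<le> KL * g"
        using level_count_bound[OF eta _ L(2) g(2,1)] n2 by (simp add: L_def KL_def)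

      \<comment> \<open>Chosen so that a round, with depth at most 12 + 2 k', has moment exactly
        \<beta>.\<close>
      define b where "b = ln \<beta> / (12 + 2 * real k')"
      have b: "0 \<le> b" "b \<le> ln \<beta>"
        using \<beta> by (auto simp: b_def field_simps)
      have "mgf 0 b ?p (\<lambda>_. 1) \<le> ennreal (exp (b * (6 + (4 * real k + 15) * real L))) *
          ennreal ((exp (b * (10 + 2 * real k)) * (1 + A * real n)) ^ L)"
      proof -
        have "mgf 0 b (outer_loop sA) (\<lambda>_. 1) \<le> ennreal ((exp (b * (10 + 2 * real k)) * (1 + A * real n)) ^ L)"
          unfolding A_def q_def L_def
          by (rule mgf_outer_loop_depth) (use b \<beta> in \<open>auto simp: b_def q_def\<close>)
        then show ?thesis
          using order_trans[OF mgf_le[of 0 b] mult_left_mono] b by (simp add: L_def)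
      qed
      also have "\<dots> = ennreal (exp (b * (6 + (4 * real k + 15) * real L)) *
          (exp (b * (10 + 2 * real k)) * (1 + A * real n)) ^ L)"
        by (rule ennreal_mult'[symmetric]) simp
      also have "\<dots> \<le> ennreal (exp (K2 * g\<^sup>2))"
        unfolding K2_def using depth_moment_bound[OF b A _ k_g LK g] n2 by (intro ennreal_leI) auto
      finally have mgf_depth: "mgf 0 b ?p (\<lambda>_. 1) \<le> ennreal (exp (K2 * g\<^sup>2))" .
      define X where "X = K * (lg d * g\<^sup>2)"
      have tail_depth: "emeasure (measure_spmf ?p) {(s, t). 0 * real (work t) + b * real (dep t) > b * X} \<le> ennreal (real n powr (-c) / 2)"
      proof (rule order_trans[OF emeasure_cost_tail[OF mgf_depth] ennreal_leI])
        have "12 + 2 * real k' \<le> (12 + 2 * K') * lg d"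
          using k'_d lg_ge_1[of d] by (simp add: algebra_simps)
        then have "ln \<beta> * (12 + 2 * real k') \<le> ln \<beta> * ((12 + 2 * K') * lg d)"
          using \<beta> by (intro mult_left_mono) auto
        then have "b0 \<le> b * lg d"
          using K' by (simp add: b0_def b_def field_simps)
        then have "b0 * (K * g\<^sup>2) \<le> (b * lg d) * (K * g\<^sup>2)"
          using K by (intro mult_right_mono) auto
        moreover have "(b0 * KD) * g\<^sup>2 \<le> (b0 * K) * g\<^sup>2"
          using K b0 by (intro mult_right_mono mult_left_mono) auto
        moreover have "b0 * KD = K2 + c1"
          using b0 by (simp add: KD_def)
        moreover have "b * X = (b * lg d) * (K * g\<^sup>2)" "(b0 * K) * g\<^sup>2 = b0 * (K * g\<^sup>2)"
          by (simp_all add: X_def)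
        ultimately have "(K2 + c1) * g\<^sup>2 \<le> b * X"
          by (simp only:)
        moreover have "ln (real n) \<le> g\<^sup>2"
          by (rule order_trans[OF g(2)]) (use g in \<open>simp add: power2_eq_square\<close>)
        then have "c1 * ln (real n) \<le> c1 * g\<^sup>2"
          using c1 by (intro mult_left_mono) auto
        ultimately have "K2 * g\<^sup>2 + - (b * X) \<le> - (c1 * ln (real n))"
          by (simp add: algebra_simps)
        then have "exp (K2 * g\<^sup>2) * exp (- (b * X)) \<le> exp (- (c1 * ln (real n)))"
          unfolding exp_add[symmetric] by simp
        also have "\<dots> \<le> real n powr (-c) / 2"
          by (rule powr_tail_half[OF n2 c1_def])
        finally show "exp (K2 * g\<^sup>2) * exp (- (b * X)) \<le> real n powr (-c) / 2" .
      qed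

      have N: "N \<ge> 1" "real n \<le> N"
        using n2 by (auto simp: N_def)
      define y where "y = sqrt N"
      have y: "y \<ge> 1" "y * y = N"
        using N by (auto simp: y_def)
      define \<theta> where "\<theta> = \<theta>0 / y"
      have \<theta>: "\<theta> > 0" and \<theta>y: "\<theta> * y = \<theta>0"
        using \<theta>0 y by (auto simp: \<theta>_def)
      have cond: "2 * \<theta> * \<alpha> * (1 + real (length (nb_of sA v))) \<le> 1 - 2 * q" for v
      proof -
        have "(real (length (nb_of sA v)))\<^sup>2 \<le> (1 + \<eta>)\<^sup>2 * (2 * real (card E))"
          using sA(1) unfolding adg_inv_def by blast
        also have "\<dots> \<le> (1 + \<eta>)\<^sup>2 * (4 * N)"
          by (intro mult_left_mono) (auto simp: N_def)
        also have "\<dots> = (2 * (1 + \<eta>) * y)\<^sup>2"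
          unfolding y(2)[symmetric] by (simp add: power2_eq_square algebra_simps)
        finally have "real (length (nb_of sA v)) \<le> 2 * (1 + \<eta>) * y"
          by (rule power2_le_imp_le) (use eta y in auto)
        moreover have "2 * (1 + \<eta>) * y + y = (3 + 2 * \<eta>) * y"
          by (simp add: algebra_simps)
        ultimately have "1 + real (length (nb_of sA v)) \<le> (3 + 2 * \<eta>) * y"
          using y(1) by linarith
        then have "2 * \<theta> * \<alpha> * (1 + real (length (nb_of sA v))) \<le> 2 * \<theta> * \<alpha> * ((3 + 2 * \<eta>) * y)"
          using \<theta> alpha by (intro mult_left_mono) auto
        also have "\<dots> = (\<theta> * y) * (2 * \<alpha> * (3 + 2 * \<eta>))"
          by (simp only: mult_ac)
        also have "\<dots> = 1 - 2 * q"
          unfolding \<theta>y using alpha eta by (simp add: \<theta>0_def)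
        finally show ?thesis .
      qed
      have "mgf \<theta> 0 (outer_loop sA) (\<lambda>_. 1) \<le> ennreal (exp (\<theta> * (1 + 6 * real L + (3 + \<alpha>) * (real n + 2 * real (card E)))))"
        unfolding L_def \<alpha>_def by (rule mgf_outer_loop_work[OF \<theta>]) (use cond in \<open>simp add: \<alpha>_def q_def\<close>)
      then have "mgf \<theta> 0 ?p (\<lambda>_. 1) \<le> ennreal (exp (\<theta> * (4 + 2 * real n + 17 * ((1 + \<eta>) / \<eta>) * real n + 4 * real (card E)))) *
          ennreal (exp (\<theta> * (1 + 6 * real L + (3 + \<alpha>) * (real n + 2 * real (card E)))))"
        using order_trans[OF mgf_le[of \<theta> 0] mult_left_mono] \<theta> by simp
      also have "\<dots> = ennreal (exp (\<theta> * (4 + 2 * real n + 17 * ((1 + \<eta>) / \<eta>) * real n + 4 * real (card E)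
          + (1 + 6 * real L + (3 + \<alpha>) * (real n + 2 * real (card E))))))"
        by (simp only: ennreal_mult'[symmetric] exp_ge_zero exp_add[symmetric] distrib_left)
      also have "\<dots> \<le> ennreal (exp (\<theta> * (K3 * N)))"
      proof -
        have "real L \<le> real n" "1 \<le> real n" "0 \<le> 17 * ((1 + \<eta>) / \<eta>) * real (card E)" "0 \<le> \<alpha> * real n"
          using L(1) n2 eta alpha by (auto simp: L_def)
        then have "4 + 2 * real n + 17 * ((1 + \<eta>) / \<eta>) * real n + 4 * real (card E)
          + (1 + 6 * real L + (3 + \<alpha>) * (real n + 2 * real (card E))) \<le> K3 * N"
          unfolding K3_def N_def distrib_left distrib_right by linarith
        then show ?thesis
          using \<theta> by (intro ennreal_leI) simp
      qed
      finally have mgf_work: "mgf \<theta> 0 ?p (\<lambda>_. 1) \<le> ennreal (exp (\<theta> * (K3 * N)))" .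
      have tail_work: "emeasure (measure_spmf ?p) {(s, t). \<theta> * real (work t) + 0 * real (dep t) > \<theta> * (K * N)} \<le> ennreal (real n powr (-c) / 2)"
      proof (rule order_trans[OF emeasure_cost_tail[OF mgf_work] ennreal_leI])
        have "sqrt (real n) \<ge> 0" "real n = sqrt (real n) * sqrt (real n)"
          by auto
        \<comment> \<open>Passing to the root first gives ln n = O(sqrt n), as needed for a \<theta>
          of order 1 / sqrt (n + m).\<close>
        then have "ln (real n) = 2 * ln (sqrt (real n))"
          using n2 by (simp add: ln_sqrt)
        also have "\<dots> \<le> 2 * sqrt (real n)"
          using ln_le_minus_one[of "sqrt (real n)"] n2 by simp
        also have "\<dots> \<le> 2 * y"
          using N by (simp add: y_def)
        finally have "c1 * ln (real n) \<le> 2 * c1 * y"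
          using c1 by simp
        also have "\<dots> = (\<theta> * y) * ((2 * c1 / \<theta>0) * y)"
          unfolding \<theta>y using \<theta>0 by simp
        also have "\<dots> = \<theta> * ((KW - K3) * N)"
          unfolding y(2)[symmetric] by (simp add: KW_def mult_ac)
        also have "\<dots> \<le> \<theta> * ((K - K3) * N)"
          using \<theta> K N by (intro mult_left_mono mult_right_mono) auto
        finally have "\<theta> * (K3 * N) + - (\<theta> * (K * N)) \<le> - (c1 * ln (real n))"
          by (simp add: algebra_simps)
        then have "exp (\<theta> * (K3 * N)) * exp (- (\<theta> * (K * N))) \<le> exp (- (c1 * ln (real n)))"
          unfolding exp_add[symmetric] by simp
        also have "\<dots> \<le> real n powr (-c) / 2"
          by (rule powr_tail_half[OF n2 c1_def])
        finally show "exp (\<theta> * (K3 * N)) * exp (- (\<theta> * (K * N))) \<le> real n powr (-c) / 2" .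
      qed

      have "measure (measure_spmf ?p)
          {(s, t). real (depth t) \<le> X \<and> real (work t) \<le> K * N} \<ge> 1 - (real n powr (-c) / 2 + real n powr (-c) / 2)"
      proof (rule measure_ge_of_tails[OF lossless tail_depth tail_work])
        \<comment> \<open>Positive parameters can be divided out of the tail events, and
          \<open>dep\<close> bounds \<open>depth\<close>.\<close>
        have "b > 0"
          using \<beta> by (simp add: b_def)
        then show "UNIV - {(s, t). 0 * real (work t) + b * real (dep t) > b * X} - {(s, t). \<theta> * real (work t) + 0 * real (dep t) > \<theta> * (K * N)}
            \<subseteq> {(s, t). real (depth t) \<le> X \<and> real (work t) \<le> K * N}"
          using \<theta> by (auto simp: not_less intro: order_trans[OF of_nat_mono[OF depth_le_dep]])
      qed auto
      then show ?thesis
        by (simp add: X_def N_def d_def g_def)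
    qed
  qed
  show ?thesis
  proof (intro exI[of _ K] conjI allI impI K(1), elim conjE)
    fix n :: nat and E G assume *: "1 \<le> n" "simple_graph {..<n} E" "csr_of n E G"
    show "measure (measure_spmf (dec_adg \<epsilon> n G))
      {(s, t). real (depth t) \<le> K * (lg (degeneracy {..<n} E) * (lg n)\<^sup>2) \<and>
               real (work t) \<le> K * (real n + real (card E))}
      \<ge> 1 - real n powr (-c)"
    \<comment> \<open>For one vertex the claimed probability is at least 0; halving the tails
      requires n \<ge> 2.\<close>
    proof (cases "n = 1")
      case False
      then show ?thesis
        using main * by simp
    qed simp
  qed
qed

end
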